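(* Let $m\ge 1$, let $V_m$ be a surface obtained by the construction described in the context (with exponents $k=3$, $l=2$), let $E_m\subset V_m$ be its last exceptional curve, and let $V_m^*=V_m\setminus E_m$. Then for every tangent vector $\nu\in TV_m^*$ there is a holomorphic map $h:\mathbb{C}\to V_m$ such that $h_*\big(\frac{\mathrm{d}}{\mathrm{d}\xi}\big|_0\big)=\nu$, where $\xi$ is the coordinate on $\mathbb{C}$.
   Context: Construction of $V_m$. All varieties are over $\mathbb{C}$. Let $L_0\subset\mathbb{C}^2_{u,v}$ be the curve $u^3-v^2=0$. Let $V_1'\to\mathbb{C}^2_{u,v}$ be the blow-up at the point $(1,1)$, $E_1'$ its exceptional divisor, $\tilde L_0\subset V_1'$ the proper transform of $L_0$, and put $V_1=V_1'\setminus\tilde L_0$, $E_1=E_1'\setminus\tilde L_0$. For $i=2,\dots,m$ let $V_i'\to V_{i-1}$ be the blow-up at a (freely chosen) point of $E_{i-1}$, $E_i'$ its exceptional divisor, $\tilde E_{i-1}\subset V_i'$ the proper transform of $E_{i-1}$, and put $V_i=V_i'\setminus\tilde E_{i-1}$, $E_i=E_i'\setminus\tilde E_{i-1}$. Thus $V_m$ is a smooth surface which is the disjoint union of an open subset $V_m^*\simeq\mathbb{C}^2\setminus L_0$ and the closed curve $E_m\simeq\mathbb{C}$. $TV_m^*$ denotes the (holomorphic) tangent bundle of $V_m^*$. *)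

theory Defs
  imports "HOL-Analysis.Analysis"
begin

definition cscale :: "complex \<Rightarrow> complex \<times> complex \<Rightarrow> complex \<times> complex" where
  "cscale c z = (c * fst z, c * snd z)"

definition holo2 :: "(complex \<times> complex \<Rightarrow> complex \<times> complex) \<Rightarrow> (complex \<times> complex) set \<Rightarrow> bool" where
  "holo2 f S \<longleftrightarrow>
     (\<forall>x\<in>S. \<exists>D. (f has_derivative D) (at x) \<and> (\<forall>c v. D (cscale c v) = cscale c (D v)))"

text \<open>A surface is given by a holomorphic atlas on a set of points; the carrier and the topology
  are the ones determined by the atlas. Connectedness is not part of the definition.\<close>

type_synonym 'a chart = "'a set \<times> ('a \<Rightarrow> complex \<times> complex)"
type_synonym 'a atlas = "'a chart set"

definition pts :: "'a atlas \<Rightarrow> 'a set" where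
  "pts X = (\<Union>(U, \<phi>)\<in>X. U)"

definition holo_atlas :: "'a atlas \<Rightarrow> bool" where
  "holo_atlas X \<longleftrightarrow>
     (\<forall>(U, \<phi>)\<in>X. inj_on \<phi> U \<and> open (\<phi> ` U)) \<and>
     (\<forall>(U, \<phi>)\<in>X. \<forall>(W, \<psi>)\<in>X.
        open (\<phi> ` (U \<inter> W)) \<and> holo2 (\<psi> \<circ> inv_into U \<phi>) (\<phi> ` (U \<inter> W)))"

definition surf_top :: "'a atlas \<Rightarrow> 'a topology" where
  "surf_top X = topology (\<lambda>A. A \<subseteq> pts X \<and> (\<forall>(U, \<phi>)\<in>X. open (\<phi> ` (A \<inter> U))))"

definition complex_surface :: "'a atlas \<Rightarrow> bool" where
  "complex_surface X \<longleftrightarrow>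
     holo_atlas X \<and> Hausdorff_space (surf_top X) \<and> second_countable (surf_top X)"

lemma openin_surf_top:
  assumes "holo_atlas X"
  shows "openin (surf_top X) A \<longleftrightarrow> A \<subseteq> pts X \<and> (\<forall>(U, \<phi>)\<in>X. open (\<phi> ` (A \<inter> U)))"
proof -
  have "istopology (\<lambda>A. A \<subseteq> pts X \<and> (\<forall>(U, \<phi>)\<in>X. open (\<phi> ` (A \<inter> U))))"
    unfolding istopology_def
  proof (intro conjI allI impI)
    fix A B
    assume A: "A \<subseteq> pts X \<and> (\<forall>(U, \<phi>)\<in>X. open (\<phi> ` (A \<inter> U)))"
      and B: "B \<subseteq> pts X \<and> (\<forall>(U, \<phi>)\<in>X. open (\<phi> ` (B \<inter> U)))"
    show "A \<inter> B \<subseteq> pts X" using A by blast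
    show "\<forall>(U, \<phi>)\<in>X. open (\<phi> ` (A \<inter> B \<inter> U))"
    proof (clarify)
      fix U \<phi> assume c: "(U, \<phi>) \<in> X"
      have "inj_on \<phi> U" using assms c unfolding holo_atlas_def by blast
      then have "\<phi> ` (A \<inter> B \<inter> U) = \<phi> ` (A \<inter> U) \<inter> \<phi> ` (B \<inter> U)"
        unfolding inj_on_def by blast
      then show "open (\<phi> ` (A \<inter> B \<inter> U))" using A B c by auto
    qed
  next
    fix K
    assume K: "\<forall>A\<in>K. A \<subseteq> pts X \<and> (\<forall>(U, \<phi>)\<in>X. open (\<phi> ` (A \<inter> U)))"
    show "\<Union>K \<subseteq> pts X" using K by blast
    show "\<forall>(U, \<phi>)\<in>X. open (\<phi> ` (\<Union>K \<inter> U))"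
    proof (clarify)
      fix U \<phi> assume c: "(U, \<phi>) \<in> X"
      have "\<phi> ` (\<Union>K \<inter> U) = (\<Union>A\<in>K. \<phi> ` (A \<inter> U))" by blast
      moreover have "open (\<Union>A\<in>K. \<phi> ` (A \<inter> U))" by (rule open_UN) (use K c in blast)
      ultimately show "open (\<phi> ` (\<Union>K \<inter> U))" by simp
    qed
  qed
  then show ?thesis
    unfolding surf_top_def by (simp add: topology_inverse')
qed

text \<open>The restriction of a surface to a subset \<open>W\<close> (only meaningful for open \<open>W\<close>).\<close>

definition restr :: "'a atlas \<Rightarrow> 'a set \<Rightarrow> 'a atlas" where
  "restr X W = (\<lambda>(U, \<phi>). (U \<inter> W, \<phi>)) ` X"

definition C2 :: "(complex \<times> complex) atlas" where
  "C2 = {(UNIV, \<lambda>z. z)}"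

definition holo_map :: "'a atlas \<Rightarrow> 'b atlas \<Rightarrow> ('a \<Rightarrow> 'b) \<Rightarrow> bool" where
  "holo_map X Y f \<longleftrightarrow>
     continuous_map (surf_top X) (surf_top Y) f \<and>
     (\<forall>(U, \<phi>)\<in>X. \<forall>(W, \<psi>)\<in>Y. holo2 (\<psi> \<circ> f \<circ> inv_into U \<phi>) (\<phi> ` (U \<inter> f -` W)))"

definition biholo :: "'a atlas \<Rightarrow> 'b atlas \<Rightarrow> ('a \<Rightarrow> 'b) \<Rightarrow> bool" where
  "biholo X Y f \<longleftrightarrow>
     bij_betw f (pts X) (pts Y) \<and> holo_map X Y f \<and> holo_map Y X (inv_into (pts X) f)"

definition entire_curve :: "'a atlas \<Rightarrow> (complex \<Rightarrow> 'a) \<Rightarrow> bool" where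
  "entire_curve X h \<longleftrightarrow>
     continuous_map euclidean (surf_top X) h \<and>
     (\<forall>(U, \<phi>)\<in>X. (\<lambda>\<xi>. fst (\<phi> (h \<xi>))) holomorphic_on (h -` U) \<and>
                  (\<lambda>\<xi>. snd (\<phi> (h \<xi>))) holomorphic_on (h -` U))"

text \<open>A tangent vector is a base point together with its coordinates in every chart around that
  point, subject to the usual transformation rule; the coordinates are set to zero for everything
  that is not a chart around the base point.\<close>

type_synonym 'a tvec = "'a \<times> ('a chart \<Rightarrow> complex \<times> complex)"

definition tangent_bundle :: "'a atlas \<Rightarrow> 'a tvec set" where
  "tangent_bundle X = {(q, v). q \<in> pts X \<and>
     (\<forall>(U, \<phi>)\<in>X. \<forall>(W, \<psi>)\<in>X. q \<in> U \<and> q \<in> W \<longrightarrow>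
        v (W, \<psi>) = frechet_derivative (\<psi> \<circ> inv_into U \<phi>) (at (\<phi> q)) (v (U, \<phi>))) \<and>
     (\<forall>U \<phi>. \<not> ((U, \<phi>) \<in> X \<and> q \<in> U) \<longrightarrow> v (U, \<phi>) = 0)}"

text \<open>The image of \<open>d/d\<xi>\<close> at \<open>\<xi>\<^sub>0\<close> under the differential of \<open>h\<close>. Only the germ of \<open>h\<close> at
  \<open>\<xi>\<^sub>0\<close> matters, so for \<open>h\<close> with values in a larger surface and \<open>h \<xi>\<^sub>0\<close> in an open subset one may
  take \<open>X\<close> to be that open subset.\<close>

definition velocity :: "'a atlas \<Rightarrow> (complex \<Rightarrow> 'a) \<Rightarrow> complex \<Rightarrow> 'a tvec" where
  "velocity X h \<xi>\<^sub>0 = (h \<xi>\<^sub>0, \<lambda>(U, \<phi>). if (U, \<phi>) \<in> X \<and> h \<xi>\<^sub>0 \<in> U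
      then (deriv (\<lambda>\<xi>. fst (\<phi> (h \<xi>))) \<xi>\<^sub>0, deriv (\<lambda>\<xi>. snd (\<phi> (h \<xi>))) \<xi>\<^sub>0) else 0)"

definition CP1 :: "(complex \<times> complex) set set" where
  "CP1 = {range (\<lambda>c. cscale c v) | v. v \<noteq> 0}"

definition Bl0_pts :: "((complex \<times> complex) \<times> (complex \<times> complex) set) set" where
  "Bl0_pts = {(x, l). l \<in> CP1 \<and> x \<in> l}"

text \<open>The incidence variety as a surface: with \<open>x = (x\<^sub>1, x\<^sub>2)\<close>, the coordinates are
  \<open>(x\<^sub>1, t)\<close> where \<open>l\<close> is spanned by \<open>(1, t)\<close>, and \<open>(x\<^sub>2, t)\<close> where \<open>l\<close> is spanned by \<open>(t, 1)\<close>.\<close>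

definition Bl0 :: "((complex \<times> complex) \<times> (complex \<times> complex) set) atlas" where
  "Bl0 = {({(x, l) \<in> Bl0_pts. (0, 1) \<notin> l}, \<lambda>(x, l). (fst x, THE t. (1, t) \<in> l)),
          ({(x, l) \<in> Bl0_pts. (1, 0) \<notin> l}, \<lambda>(x, l). (snd x, THE t. (t, 1) \<in> l))}"

text \<open>\<open>blowup X p X' \<pi>\<close>: the map \<open>\<pi>\<close> from \<open>X'\<close> to \<open>X\<close> is the blow-up of \<open>X\<close> at \<open>p\<close>. This
  determines \<open>X'\<close> and \<open>\<pi>\<close> up to isomorphism over \<open>X\<close>.\<close>

definition blowup :: "'b atlas \<Rightarrow> 'b \<Rightarrow> 'a atlas \<Rightarrow> ('a \<Rightarrow> 'b) \<Rightarrow> bool" where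
  "blowup X p X' \<pi> \<longleftrightarrow>
     complex_surface X \<and> p \<in> pts X \<and> complex_surface X' \<and> holo_map X' X \<pi> \<and>
     biholo (restr X' (pts X' - \<pi> -` {p})) (restr X (pts X - {p})) \<pi> \<and>
     (\<exists>U S \<phi> \<Phi>. openin (surf_top X) U \<and> p \<in> U \<and> open S \<and>
        biholo (restr X U) (restr C2 S) \<phi> \<and> \<phi> p = (0, 0) \<and>
        biholo (restr X' (pts X' \<inter> \<pi> -` U)) (restr Bl0 {(x, l) \<in> Bl0_pts. x \<in> S}) \<Phi> \<and>
        (\<forall>z \<in> pts X' \<inter> \<pi> -` U. fst (\<Phi> z) = \<phi> (\<pi> z)))"

definition exc_curve :: "'b \<Rightarrow> 'a atlas \<Rightarrow> ('a \<Rightarrow> 'b) \<Rightarrow> 'a set" where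
  "exc_curve p X' \<pi> = pts X' \<inter> \<pi> -` {p}"

definition proper_transform :: "'b \<Rightarrow> 'a atlas \<Rightarrow> ('a \<Rightarrow> 'b) \<Rightarrow> 'b set \<Rightarrow> 'a set" where
  "proper_transform p X' \<pi> C = surf_top X' closure_of (pts X' \<inter> \<pi> -` (C - {p}))"

definition L0 :: "(complex \<times> complex) set" where
  "L0 = {(u, v). u ^ 3 - v ^ 2 = 0}"

text \<open>\<open>V_surface m V E\<close>: \<open>V\<close> is a surface \<open>V\<^sub>m\<close> obtained by the construction (for some choice of
  centres) and \<open>E\<close> is its last exceptional curve \<open>E\<^sub>m\<close>. All the surfaces of a tower live on the
  same point type; this is no loss of generality, as surfaces can be transported along bijections.\<close>

inductive V_surface :: "nat \<Rightarrow> 'a atlas \<Rightarrow> 'a set \<Rightarrow> bool" where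
  first: "blowup C2 (1, 1) V' \<pi> \<Longrightarrow> L = proper_transform (1, 1) V' \<pi> L0 \<Longrightarrow>
    V_surface 1 (restr V' (pts V' - L)) (exc_curve (1, 1) V' \<pi> - L)"
| step: "V_surface i V E \<Longrightarrow> p \<in> E \<Longrightarrow> blowup V p V' \<pi> \<Longrightarrow> F = proper_transform p V' \<pi> E \<Longrightarrow>
    V_surface (Suc i) (restr V' (pts V' - F)) (exc_curve p V' \<pi> - F)"

end

theory Submission
  imports Defs "HOL-Complex_Analysis.Complex_Analysis"
begin

text \<open>
  On \<open>u v \<noteq> 0\<close> put \<open>\<zeta> = 1 - v\<^sup>2 / u\<^sup>3\<close> and \<open>t = v / u\<close>, so that \<open>L\<^sub>0\<close> is \<open>\<zeta> = 0\<close> and the first centre is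
  \<open>(0, 1)\<close>. By induction along the tower, a neighbourhood of \<open>E\<^sub>m\<close> in \<open>V\<^sub>m\<close> has global coordinates
  \<open>(\<zeta>, w)\<close> with \<open>t = R(\<zeta>) + \<zeta>\<^sup>m w\<close> for a polynomial \<open>R\<close> with \<open>R(0) \<noteq> 0\<close>, and \<open>E\<^sub>m\<close> is \<open>\<zeta> = 0\<close>.

  For a given tangent vector take polynomials \<open>\<alpha>, \<beta>\<close> without common zero whose 1-jet at \<open>0\<close> is that
  vector. The curve \<open>(\<lambda>\<^sup>2 \<alpha>, \<lambda>\<^sup>3 \<beta>)\<close>, with \<open>\<lambda>\<close> entire and nowhere zero, has
  \<open>\<zeta> = 1 - \<beta>\<^sup>2 / \<alpha>\<^sup>3\<close> independent of \<open>\<lambda>\<close>, and \<open>t = \<lambda> \<beta> / \<alpha>\<close>. It lifts to \<open>V\<^sub>m\<close> as soon as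
  \<open>\<lambda> \<beta> / \<alpha> \<equiv> R(\<zeta>)\<close> modulo \<open>\<zeta>\<^sup>m\<close> at the finitely many zeros of \<open>\<alpha>\<^sup>3 - \<beta>\<^sup>2\<close>, which
  Hermite interpolation of \<open>log \<lambda>\<close> by a polynomial achieves, keeping \<open>\<lambda> = 1 + O(\<xi>\<^sup>2)\<close> at \<open>0\<close>.
\<close>

subsection \<open>Complex differentiability in two variables\<close>

text \<open>The curve \<open>L0\<close> minus the origin is a single orbit of the action
  (\<lambda>^2 u, \<lambda>^3 v), with t as coordinate on it. A plane curve that lifts to V_m may
  meet \<open>L0\<close> only at (1, 1), and there with a jet constrained by all the centres.
  Rescaling by \<lambda> slides each meeting point along the orbit and leaves enough freedom to
  correct its jet. The origin lies on \<open>L0\<close> and is fixed by the action, so a curve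
  through it could not be moved away: this is why \<alpha> and \<beta> must not vanish together.
  Writing \<lambda> as an exponential keeps it free of zeros and turns the multiplicative conditions
  into interpolation of a logarithm, which exists at the relevant points because R(0) is not zero.
  The obstacle on the geometric side is that a blow-up is given only through some unspecified chart
  at its centre, unrelated to (\<zeta>, w). Passing to the coordinates of the tower requires that a
  change of coordinates fixing the centre lifts holomorphically, that is, that the substitution (z,
  z w) followed by division by z preserves complex differentiability also at z = 0.\<close>

definition mat2 :: "complex \<Rightarrow> complex \<Rightarrow> complex \<Rightarrow> complex \<Rightarrow> complex \<times> complex \<Rightarrow> complex \<times> complex" where
  "mat2 A B C E h = (A * fst h + B * snd h, C * fst h + E * snd h)"

definition cdiff2 :: "(complex \<times> complex \<Rightarrow> complex \<times> complex) \<Rightarrow> complex \<times> complex \<Rightarrow> bool" where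
  "cdiff2 f x \<longleftrightarrow> (\<exists>A B C E. (f has_derivative mat2 A B C E) (at x))"

definition immers :: "(complex \<times> complex \<Rightarrow> complex \<times> complex) \<Rightarrow> complex \<times> complex \<Rightarrow> bool" where
  "immers f x \<longleftrightarrow> (\<exists>A B C E. A * E \<noteq> B * C \<and> (f has_derivative mat2 A B C E) (at x))"

text \<open>\<open>A\<close> and \<open>B\<close> are the two complex partial derivatives. They are
  carried explicitly because Jacobian determinants are computed from them; \<open>sdf\<close> below
  forgets them.\<close>

definition sdiff :: "(complex \<times> complex \<Rightarrow> complex) \<Rightarrow> complex \<times> complex \<Rightarrow> complex \<Rightarrow> complex \<Rightarrow> bool" where
  "sdiff f x A B \<longleftrightarrow> (f has_derivative (\<lambda>h. A * fst h + B * snd h)) (at x)"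

text \<open>Compatibility with complex scalars determines a real linear map by its values on the two
  basis vectors. This ties \<open>holo2\<close> to explicit matrices with determinants and
  inverses.\<close>

lemma clinear_mat2:
  assumes "linear D" "\<forall>c v. D (cscale c v) = cscale c (D v)"
  shows "D = mat2 (fst (D (1,0))) (fst (D (0,1))) (snd (D (1,0))) (snd (D (0,1)))"
proof
  fix h :: "complex \<times> complex"
  have h: "h = cscale (fst h) (1,0) + cscale (snd h) (0,1)"
    by (simp add: cscale_def prod_eq_iff)
  have "D h = cscale (fst h) (D (1,0)) + cscale (snd h) (D (0,1))"
    by (subst h, subst linear_add[OF assms(1)]) (simp only: assms(2)[rule_format])
  then show "D h = mat2 (fst (D (1,0))) (fst (D (0,1))) (snd (D (1,0))) (snd (D (0,1))) h"
    by (simp add: mat2_def cscale_def prod_eq_iff mult.commute)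
qed

lemma mat2_cscale: "mat2 A B C E (cscale c v) = cscale c (mat2 A B C E v)"
  by (simp add: mat2_def cscale_def algebra_simps)

lemma cdiff2_iff: "cdiff2 f x \<longleftrightarrow> (\<exists>D. (f has_derivative D) (at x) \<and> (\<forall>c v. D (cscale c v) = cscale c (D v)))"
proof
  assume "cdiff2 f x"
  then show "\<exists>D. (f has_derivative D) (at x) \<and> (\<forall>c v. D (cscale c v) = cscale c (D v))"
    unfolding cdiff2_def using mat2_cscale by blast
next
  assume "\<exists>D. (f has_derivative D) (at x) \<and> (\<forall>c v. D (cscale c v) = cscale c (D v))"
  then obtain D where D: "(f has_derivative D) (at x)" "\<forall>c v. D (cscale c v) = cscale c (D v)" by blast
  have "linear D" using D(1) has_derivative_linear by blast
  from clinear_mat2[OF this D(2)] show "cdiff2 f x" unfolding cdiff2_def using D(1) by metis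
qed

lemma holo2_iff: "holo2 f S \<longleftrightarrow> (\<forall>x\<in>S. cdiff2 f x)"
  unfolding holo2_def cdiff2_iff ..

lemma mat2_comp:
  "mat2 A B C E \<circ> mat2 A' B' C' E' = mat2 (A*A'+B*C') (A*B'+B*E') (C*A'+E*C') (C*B'+E*E')"
  by (rule ext) (simp add: mat2_def algebra_simps)

lemma mat2_eqD: "mat2 A B C E = mat2 A' B' C' E' \<Longrightarrow> A = A' \<and> B = B' \<and> C = C' \<and> E = E'"
  by (frule fun_cong[of _ _ "(1,0)"], drule fun_cong[of _ _ "(0,1)"]) (simp add: mat2_def)

lemma mat2_id: "(\<lambda>h. h) = mat2 1 0 0 1" "id = mat2 1 0 0 1"
  by (auto simp: mat2_def fun_eq_iff)

lemma immers_cdiff2: "immers f x \<Longrightarrow> cdiff2 f x"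
  unfolding immers_def cdiff2_def by blast

lemma cdiff2_isCont: "cdiff2 f x \<Longrightarrow> isCont f x"
  unfolding cdiff2_def using has_derivative_continuous by blast

lemma immers_isCont: "immers f x \<Longrightarrow> isCont f x"
  using cdiff2_isCont immers_cdiff2 by blast

lemma cdiff2_compose:
  assumes "cdiff2 f (g x)" "cdiff2 g x"
  shows "cdiff2 (f \<circ> g) x"
proof -
  obtain A B C E where 1: "(f has_derivative mat2 A B C E) (at (g x))" using assms(1) unfolding cdiff2_def by blast
  obtain A' B' C' E' where 2: "(g has_derivative mat2 A' B' C' E') (at x)" using assms(2) unfolding cdiff2_def by blast
  show ?thesis using diff_chain_at[OF 2 1] unfolding mat2_comp cdiff2_def by blast
qed

lemma immers_compose:
  assumes "immers f (g x)" "immers g x"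
  shows "immers (f \<circ> g) x"
proof -
  obtain A B C E where 1: "(f has_derivative mat2 A B C E) (at (g x))" "A*E\<noteq>B*C" using assms(1) unfolding immers_def by blast
  obtain A' B' C' E' where 2: "(g has_derivative mat2 A' B' C' E') (at x)" "A'*E'\<noteq>B'*C'" using assms(2) unfolding immers_def by blast
  have "(A*A'+B*C') * (C*B'+E*E') - (A*B'+B*E') * (C*A'+E*C') = (A*E-B*C)*(A'*E'-B'*C')"
    by (simp add: algebra_simps)
  also have "\<dots> \<noteq> 0" using 1 2 by simp
  finally have "(A*A'+B*C') * (C*B'+E*E') \<noteq> (A*B'+B*E') * (C*A'+E*C')" by simp
  then show ?thesis using diff_chain_at[OF 2(1) 1(1)] unfolding mat2_comp immers_def by blast
qed

lemma has_derivative_cong_ev: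
  assumes "eventually (\<lambda>y. f y = g y) (nhds x)"
  shows "(f has_derivative D) (at x) \<longleftrightarrow> (g has_derivative D) (at x)"
proof -
  have *: "(h has_derivative D) (at x)" if "eventually (\<lambda>y. k y = h y) (nhds x)" "(k has_derivative D) (at x)" for h k :: "'a \<Rightarrow> 'b"
  proof (rule has_derivative_transform_eventually[OF that(2)])
    show "\<forall>\<^sub>F x' in at x. k x' = h x'"
      using that(1) by (auto simp: eventually_at_filter elim: eventually_mono)
    show "k x = h x" using that(1) by (rule eventually_nhds_x_imp_x)
  qed simp
  have "eventually (\<lambda>y. g y = f y) (nhds x)"
    using assms by (rule eventually_mono) simp
  then show ?thesis using *[of f g] *[of g f] assms by blast
qed

lemma immers_cong_ev: "eventually (\<lambda>y. f y = g y) (nhds x) \<Longrightarrow> immers f x \<longleftrightarrow> immers g x"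
  unfolding immers_def using has_derivative_cong_ev by blast

lemma cdiff2_cong_ev: "eventually (\<lambda>y. f y = g y) (nhds x) \<Longrightarrow> cdiff2 f x \<longleftrightarrow> cdiff2 g x"
  unfolding cdiff2_def using has_derivative_cong_ev by blast

text \<open>The derivatives of \<open>f\<close> and \<open>g\<close> compose to the identity by
  uniqueness of derivatives, and multiplicativity of the determinant forces both to be
  invertible.\<close>

lemma immers_left_inverse:
  assumes "cdiff2 f x" "cdiff2 g (f x)" "eventually (\<lambda>y. g (f y) = y) (nhds x)"
  shows "immers f x"
proof -
  obtain A B C E where 1: "(g has_derivative mat2 A B C E) (at (f x))" using assms(2) unfolding cdiff2_def by blast
  obtain A' B' C' E' where 2: "(f has_derivative mat2 A' B' C' E') (at x)" using assms(1) unfolding cdiff2_def by blast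
  have 3: "((g \<circ> f) has_derivative mat2 A B C E \<circ> mat2 A' B' C' E') (at x)"
    using diff_chain_at[OF 2 1] .
  have "((g \<circ> f) has_derivative (\<lambda>h. h)) (at x) \<longleftrightarrow> ((\<lambda>y. y) has_derivative (\<lambda>h. h)) (at x)"
    by (rule has_derivative_cong_ev) (use assms(3) in simp)
  then have "((g \<circ> f) has_derivative (\<lambda>h. h)) (at x)" by simp
  then have "mat2 A B C E \<circ> mat2 A' B' C' E' = (\<lambda>h. h)"
    using 3 has_derivative_unique by blast
  then have m: "A*A'+B*C' = 1" "A*B'+B*E' = 0" "C*A'+E*C' = 0" "C*B'+E*E' = 1"
    unfolding mat2_comp mat2_id by (auto dest: mat2_eqD)
  have "(A*E-B*C)*(A'*E'-B'*C') = (A*A'+B*C')*(C*B'+E*E') - (A*B'+B*E')*(C*A'+E*C')"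
    by (simp add: algebra_simps)
  also have "\<dots> = 1" by (simp add: m)
  finally have "A'*E' \<noteq> B'*C'" by auto
  then show ?thesis unfolding immers_def using 2 by blast
qed

section \<open>Scalar functions of two variables and their partial derivatives\<close>

lemma sdiff_pair:
  assumes "sdiff f x A B" "sdiff g x C E"
  shows "((\<lambda>z. (f z, g z)) has_derivative mat2 A B C E) (at x)"
  using has_derivative_Pair[OF assms[unfolded sdiff_def]] by (simp add: mat2_def[abs_def])

lemma sdiff_fst_snd:
  assumes "(f has_derivative mat2 A B C E) (at x)"
  shows "sdiff (\<lambda>z. fst (f z)) x A B" "sdiff (\<lambda>z. snd (f z)) x C E"
  using has_derivative_fst[OF assms] has_derivative_snd[OF assms]
  by (simp_all add: sdiff_def mat2_def)

lemma immers_pairI: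
  "sdiff f x A B \<Longrightarrow> sdiff g x C E \<Longrightarrow> A * E \<noteq> B * C \<Longrightarrow> immers (\<lambda>z. (f z, g z)) x"
  unfolding immers_def using sdiff_pair by blast

definition sdf :: "(complex \<times> complex \<Rightarrow> complex) \<Rightarrow> complex \<times> complex \<Rightarrow> bool" where
  "sdf f x \<longleftrightarrow> (\<exists>A B. sdiff f x A B)"

lemma cdiff2_pairI: "sdf f x \<Longrightarrow> sdf g x \<Longrightarrow> cdiff2 (\<lambda>z. (f z, g z)) x"
  unfolding sdf_def cdiff2_def using sdiff_pair by blast

lemma sdiff_const: "sdiff (\<lambda>z. c) x 0 0"
  by (simp add: sdiff_def)
lemma sdiff_fst: "sdiff fst x 1 0"
  by (simp add: sdiff_def has_derivative_fst)
lemma sdiff_snd: "sdiff snd x 0 1"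
  by (simp add: sdiff_def has_derivative_snd)
lemma sdiff_add: "sdiff f x A B \<Longrightarrow> sdiff g x C E \<Longrightarrow> sdiff (\<lambda>z. f z + g z) x (A+C) (B+E)"
  unfolding sdiff_def by (drule (1) has_derivative_add) (simp add: algebra_simps)
lemma sdiff_diff: "sdiff f x A B \<Longrightarrow> sdiff g x C E \<Longrightarrow> sdiff (\<lambda>z. f z - g z) x (A-C) (B-E)"
  unfolding sdiff_def by (drule (1) has_derivative_diff) (simp add: algebra_simps)
lemma sdiff_mult: "sdiff f x A B \<Longrightarrow> sdiff g x C E \<Longrightarrow> sdiff (\<lambda>z. f z * g z) x (A * g x + f x * C) (B * g x + f x * E)"
  unfolding sdiff_def by (drule (1) has_derivative_mult) (simp add: algebra_simps)
lemma sdiff_divide: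
  assumes "sdiff f x A B" "sdiff g x C E" "g x \<noteq> 0"
  shows "sdiff (\<lambda>z. f z / g z) x ((A * g x - f x * C) / (g x)^2) ((B * g x - f x * E) / (g x)^2)"
proof -
  have eq: "- f x * (inverse (g x) * (C * fst h + E * snd h) * inverse (g x)) + (A * fst h + B * snd h) / g x
    = (A * g x - f x * C) / (g x)^2 * fst h + (B * g x - f x * E) / (g x)^2 * snd h" for h
    using assms(3) by (simp add: divide_simps) (simp add: algebra_simps power2_eq_square)
  show ?thesis
    using has_derivative_divide[OF assms(1,2)[unfolded sdiff_def] assms(3)]
    unfolding sdiff_def by (rule has_derivative_eq_rhs) (rule ext, rule eq)
qed

lemma sdf_const: "sdf (\<lambda>z. c) x"
  unfolding sdf_def using sdiff_const by metis
lemma sdf_fst: "sdf fst x"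
  unfolding sdf_def using sdiff_fst by metis
lemma sdf_snd: "sdf snd x"
  unfolding sdf_def using sdiff_snd by metis
lemma sdf_add: "sdf f x \<Longrightarrow> sdf g x \<Longrightarrow> sdf (\<lambda>z. f z + g z) x"
  unfolding sdf_def using sdiff_add by metis
lemma sdf_diff: "sdf f x \<Longrightarrow> sdf g x \<Longrightarrow> sdf (\<lambda>z. f z - g z) x"
  unfolding sdf_def using sdiff_diff by metis
lemma sdf_mult: "sdf f x \<Longrightarrow> sdf g x \<Longrightarrow> sdf (\<lambda>z. f z * g z) x"
  unfolding sdf_def using sdiff_mult by metis
lemma sdf_divide: "sdf f x \<Longrightarrow> sdf g x \<Longrightarrow> g x \<noteq> 0 \<Longrightarrow> sdf (\<lambda>z. f z / g z) x"
  unfolding sdf_def using sdiff_divide by metis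
lemmas sdf_intros = sdf_const sdf_fst sdf_snd sdf_add sdf_diff sdf_mult sdf_divide

lemma sdf_power: "sdf f x \<Longrightarrow> sdf (\<lambda>z. f z ^ n) x"
  by (induction n) (auto intro!: sdf_intros)

lemma sdf_isCont: "sdf f x \<Longrightarrow> isCont f x"
  unfolding sdf_def sdiff_def using has_derivative_continuous by blast

lemma sdf_deriv_snd:
  assumes "sdiff f (x,y) A B"
  shows "((\<lambda>\<eta>. f (x, \<eta>)) has_field_derivative B) (at y)"
proof -
  have "((\<lambda>\<eta>. (x,\<eta>)) has_derivative (\<lambda>h. (0,h))) (at y)"
    by (auto intro!: derivative_eq_intros)
  from diff_chain_at[OF this assms[unfolded sdiff_def]]
  show ?thesis by (simp add: has_field_derivative_def o_def)
qed

text \<open>Cauchy's inequality on a fixed circle turns uniform closeness of the slices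
  \<open>f (x, \<cdot>)\<close> into closeness of their derivatives.\<close>

lemma isCont_deriv_snd:
  assumes "open N" "(x0, y0) \<in> N" and f: "\<And>z. z \<in> N \<Longrightarrow> sdf f z"
  shows "isCont (\<lambda>z. deriv (\<lambda>\<eta>. f (fst z, \<eta>)) (snd z)) (x0, y0)"
proof -
  obtain A B where AB: "open A" "open B" "x0 \<in> A" "y0 \<in> B" "A \<times> B \<subseteq> N"
  proof -
    from open_prod_elim[OF assms(1,2)] obtain A B
      where "open A" "open B" "(x0, y0) \<in> A \<times> B" "A \<times> B \<subseteq> N" .
    then show ?thesis using that by blast
  qed
  obtain r where r: "r > 0" "cball x0 r \<subseteq> A" using AB open_contains_cball by blast
  obtain s where s: "s > 0" "cball y0 s \<subseteq> B" using AB open_contains_cball by blast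
  define K where "K = cball x0 r \<times> cball y0 s"
  have KN: "K \<subseteq> N" using AB r s unfolding K_def by blast
  have cK: "continuous_on K f"
    using f KN by (intro continuous_at_imp_continuous_on) (auto intro: sdf_isCont)
  have uK: "uniformly_continuous_on K f"
    by (rule compact_uniformly_continuous[OF cK]) (simp add: K_def compact_Times)
  have hol: "(\<lambda>\<eta>. f (x, \<eta>)) holomorphic_on cball y0 s" if "x \<in> cball x0 r" for x
  proof -
    have "(\<lambda>\<eta>. f (x, \<eta>)) field_differentiable at y within cball y0 s" if "y \<in> cball y0 s" for y
    proof -
      have "sdf f (x,y)" using f KN that \<open>x \<in> _\<close> unfolding K_def by blast
      then show ?thesis
        unfolding sdf_def field_differentiable_def
        using sdf_deriv_snd has_field_derivative_at_within by blast
    qed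
    then show ?thesis unfolding holomorphic_on_def by blast
  qed
  define g where "g = deriv (\<lambda>\<eta>. f (x0, \<eta>))"
  have "g holomorphic_on ball y0 s"
    unfolding g_def using hol[of x0] r
    by (intro holomorphic_deriv) (auto intro: holomorphic_on_subset)
  then have gc: "isCont g y0"
    using s(1) holomorphic_on_imp_continuous_on[of g "ball y0 s"]
    by (simp add: continuous_on_eq_continuous_at)
  show ?thesis
    unfolding isCont_def
  proof (rule tendstoI)
    fix e :: real assume e: "e > 0"
    \<comment> \<open>On circles of radius s/2, Cauchy's inequality turns a bound d on the
      difference of two slices into d / (s/2) = e/4 for their derivatives.\<close>
    define d where "d = e * s / 8"
    have "d > 0" using e s by (simp add: d_def)
    obtain \<delta> where \<delta>: "\<delta> > 0" "\<And>z w. z \<in> K \<Longrightarrow> w \<in> K \<Longrightarrow> dist w z < \<delta> \<Longrightarrow> dist (f w) (f z) < d"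
      using uK \<open>d > 0\<close> unfolding uniformly_continuous_on_def by metis
    have bound: "norm (deriv (\<lambda>\<eta>. f (x, \<eta>)) y - g y) \<le> e / 4"
      if x: "dist x x0 < min \<delta> r" and y: "dist y y0 < s / 2" for x y
    proof -
      have xr: "x \<in> cball x0 r" using x by (simp add: dist_commute)
      have sub: "cball y (s/2) \<subseteq> cball y0 s"
      proof
        fix z assume "z \<in> cball y (s/2)"
        then have "dist y z \<le> s/2" by simp
        then have "dist y0 z \<le> s" using y dist_triangle[of y0 z y] by (simp add: dist_commute)
        then show "z \<in> cball y0 s" by simp
      qed
      let ?h = "\<lambda>\<eta>. f (x, \<eta>) - f (x0, \<eta>)"
      have hx: "(\<lambda>\<eta>. f (x, \<eta>)) holomorphic_on cball y (s/2)"
        using hol[OF xr] sub holomorphic_on_subset by blast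
      have hx0: "(\<lambda>\<eta>. f (x0, \<eta>)) holomorphic_on cball y (s/2)"
        using hol[of x0] r sub holomorphic_on_subset by force
      have hh: "?h holomorphic_on cball y (s/2)"
        using hx hx0 by (rule holomorphic_on_diff)
      have "norm ((deriv ^^ 1) ?h y) \<le> fact 1 * d / (s/2)^1"
      proof (rule Cauchy_inequality)
        show "?h holomorphic_on ball y (s/2)" using hh holomorphic_on_subset ball_subset_cball by blast
        show "continuous_on (cball y (s/2)) ?h" using hh holomorphic_on_imp_continuous_on by blast
        show "0 < s/2" using s by simp
        fix w assume "norm (y - w) = s/2"
        then have "w \<in> cball y (s/2)" by (simp add: dist_norm)
        then have w: "w \<in> cball y0 s" using sub by blast
        have "dist (f (x,w)) (f (x0,w)) < d"
          by (rule \<delta>(2)) (use w xr r x in \<open>auto simp: K_def dist_Pair_Pair\<close>)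
        then show "norm (?h w) \<le> d" by (simp add: dist_norm)
      qed
      moreover have "deriv ?h y = deriv (\<lambda>\<eta>. f (x, \<eta>)) y - g y"
        unfolding g_def
      proof (rule deriv_diff)
        have y: "y \<in> ball y (s/2)" using s by simp
        show "(\<lambda>\<eta>. f (x, \<eta>)) field_differentiable at y"
          by (rule holomorphic_on_imp_differentiable_at[OF holomorphic_on_subset[OF hx ball_subset_cball] open_ball y])
        show "(\<lambda>\<eta>. f (x0, \<eta>)) field_differentiable at y"
          by (rule holomorphic_on_imp_differentiable_at[OF holomorphic_on_subset[OF hx0 ball_subset_cball] open_ball y])
      qed
      ultimately show ?thesis using s by (simp add: d_def field_simps)
    qed
    obtain \<delta>' where \<delta>': "\<delta>' > 0" "\<And>y. dist y y0 < \<delta>' \<Longrightarrow> dist (g y) (g y0) < e/2"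
      using gc e unfolding continuous_at_eps_delta by (meson half_gt_zero)
    \<comment> \<open>Changing the slice costs e/4 and moving the point within the fixed slice e/2,
      which together stay below e.\<close>
    define \<epsilon> where "\<epsilon> = min (min \<delta> r) (min (s/2) \<delta>')"
    have "\<epsilon> > 0" using \<delta> \<delta>' r s by (simp add: \<epsilon>_def)
    show "\<forall>\<^sub>F z in at (x0,y0). dist (deriv (\<lambda>\<eta>. f (fst z, \<eta>)) (snd z)) (deriv (\<lambda>\<eta>. f (fst (x0,y0), \<eta>)) (snd (x0,y0))) < e"
      unfolding eventually_at
    proof (intro exI conjI ballI impI)
      show "\<epsilon> > 0" by fact
      fix z :: "complex \<times> complex" assume z: "z \<noteq> (x0,y0) \<and> dist z (x0,y0) < \<epsilon>"
      have z1: "dist (fst z) x0 < \<epsilon>" using z dist_fst_le[of z "(x0,y0)"] by simp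
      have z2: "dist (snd z) y0 < \<epsilon>" using z dist_snd_le[of z "(x0,y0)"] by simp
      have "dist (deriv (\<lambda>\<eta>. f (fst z, \<eta>)) (snd z)) (g (snd z)) \<le> e/4"
        using bound[of "fst z" "snd z"] z1 z2 by (simp add: \<epsilon>_def dist_norm)
      moreover have "dist (g (snd z)) (g y0) < e/2" using \<delta>'(2)[of "snd z"] z2 by (simp add: \<epsilon>_def)
      ultimately have "dist (deriv (\<lambda>\<eta>. f (fst z, \<eta>)) (snd z)) (g y0) < e"
        using dist_triangle[of "deriv (\<lambda>\<eta>. f (fst z, \<eta>)) (snd z)" "g y0" "g (snd z)"] e by linarith
      then show "dist (deriv (\<lambda>\<eta>. f (fst z, \<eta>)) (snd z)) (deriv (\<lambda>\<eta>. f (fst (x0,y0), \<eta>)) (snd (x0,y0))) < e"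
        by (simp add: g_def)
    qed
  qed
qed

subsection \<open>A division lemma\<close>

text \<open>The \<open>w\<close>-derivative of \<open>f (z, z w) / z\<close> is the second partial of \<open>f\<close> at \<open>(z, z w)\<close>, with no
  division left; together with the removable singularity in \<open>z\<close> this gives differentiability.\<close>

lemma sdiff_divided:
  fixes f :: "complex \<times> complex \<Rightarrow> complex"
  assumes N: "open N" "(0,0) \<in> N" and f: "\<And>z. z \<in> N \<Longrightarrow> sdf f z" and f0: "f (0,0) = 0"
    and AB: "sdiff f (0,0) A B"
  shows "\<exists>C. sdiff (\<lambda>z. if fst z = 0 then A + B * snd z else f (fst z, fst z * snd z) / fst z) (0,w0) C B"
proof -
  \<comment> \<open>A product neighbourhood of (0, w0) is wanted whose image under this substitution
    lies in \<open>N\<close>: the differentiability criterion used below works on a product with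
    convex second factor.\<close>
  define \<sigma> :: "complex \<times> complex \<Rightarrow> complex \<times> complex" where "\<sigma> = (\<lambda>z. (fst z, fst z * snd z))"
  have \<sigma>c: "continuous_on UNIV \<sigma>" unfolding \<sigma>_def by (intro continuous_intros)
  have "open (\<sigma> -` N)" using N(1) \<sigma>c continuous_on_open_vimage by (metis open_UNIV Int_UNIV_right)
  moreover have "(0,w0) \<in> \<sigma> -` N" using N(2) by (simp add: \<sigma>_def)
  ultimately obtain X0 Y0 where XY0: "open X0" "open Y0" "(0,w0) \<in> X0 \<times> Y0" "X0 \<times> Y0 \<subseteq> \<sigma> -` N"
    by (rule open_prod_elim)
  have "0 \<in> X0" "w0 \<in> Y0" using XY0(3) by auto
  then obtain r s where rs: "r > 0" "ball 0 r \<subseteq> X0" "s > 0" "ball w0 s \<subseteq> Y0"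
    using XY0(1,2) unfolding open_contains_ball by (metis)
  define X where "X = ball (0::complex) r"
  define Y where "Y = ball w0 s"
  have XY: "open X" "open Y" "convex Y" "0 \<in> X" "w0 \<in> Y" unfolding X_def Y_def using rs by auto
  have inN: "(x, x * y) \<in> N" if "x \<in> X" "y \<in> Y" for x y
  proof -
    have "(x,y) \<in> X0 \<times> Y0" using that rs unfolding X_def Y_def by auto
    then have "(x,y) \<in> \<sigma> -` N" using XY0(4) by (rule subsetD[rotated])
    then show ?thesis by (simp add: \<sigma>_def)
  qed
  define k where "k = (\<lambda>x y. if x = 0 then A + B * y else f (x, x * y) / x)"
  define d where "d = (\<lambda>x y. deriv (\<lambda>\<eta>. f (x, \<eta>)) (x * y))"
  \<comment> \<open>The restriction of \<open>f (z, z w)\<close> to w = w0, a function of one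
    variable. Its difference quotient at 0 is the slice of \<open>k\<close>.\<close>
  define \<phi> where "\<phi> = (\<lambda>x. f (x, x * w0))"
  have line: "sdiff f (x, x * w0) P Q \<Longrightarrow> (\<phi> has_field_derivative (P + Q * w0)) (at x)" for x P Q
  proof -
    assume a: "sdiff f (x, x * w0) P Q"
    have "((\<lambda>x. (x, x * w0)) has_derivative (\<lambda>h. (h, h * w0))) (at x)"
      by (auto intro!: derivative_eq_intros)
    from diff_chain_at[OF this a[unfolded sdiff_def]]
    have "(\<phi> has_derivative (\<lambda>h. P * h + Q * (h * w0))) (at x)" by (simp add: o_def \<phi>_def)
    moreover have "(\<lambda>h. P * h + Q * (h * w0)) = (*) (P + Q * w0)" by (simp add: fun_eq_iff algebra_simps)
    ultimately show ?thesis by (simp add: has_field_derivative_def)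
  qed
  have \<phi>d: "\<phi> holomorphic_on X"
  proof (unfold holomorphic_on_def, intro ballI)
    fix x assume "x \<in> X"
    then have "sdf f (x, x * w0)" using f inN XY by simp
    then obtain P Q where "sdiff f (x, x * w0) P Q" unfolding sdf_def by (elim exE)
    from line[OF this] show "\<phi> field_differentiable at x within X"
      unfolding field_differentiable_def by (meson has_field_derivative_at_within)
  qed
  have \<phi>0: "\<phi> 0 = 0" by (simp add: \<phi>_def f0)
  have d\<phi>: "deriv \<phi> 0 = A + B * w0"
    by (rule DERIV_imp_deriv, rule line) (simp add: AB)
  have "(\<lambda>z. if z = 0 then deriv \<phi> 0 else (\<phi> z - \<phi> 0) / (z - 0)) holomorphic_on X"
    by (rule pole_lemma_open[OF \<phi>d XY(1)])
  also have "(\<lambda>z. if z = 0 then deriv \<phi> 0 else (\<phi> z - \<phi> 0) / (z - 0)) = (\<lambda>x. k x w0)"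
    unfolding d\<phi> \<phi>0 k_def by (simp add: \<phi>_def fun_eq_iff)
  finally have "(\<lambda>x. k x w0) field_differentiable at 0"
    by (rule holomorphic_on_imp_differentiable_at) (use XY in auto)
  then obtain C where C: "((\<lambda>x. k x w0) has_field_derivative C) (at 0)"
    unfolding field_differentiable_def by (elim exE)
  \<comment> \<open>The criterion asks for the partial in x only at the point itself, and for the
    partial in y on a neighbourhood, continuous at the point. The factor x from the chain rule
    cancels the denominator, so \<open>d\<close> is the second partial also at x = 0.\<close>
  have "((\<lambda>(x, y). k x y) has_derivative (\<lambda>(tx, ty). C * tx + blinfun_mult_right (d 0 w0) ty)) (at (0, w0) within X \<times> Y)"
  proof (rule has_derivative_partialsI)
    show "((\<lambda>x. k x w0) has_derivative (*) C) (at 0 within X)"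
      using C unfolding has_field_derivative_def by (rule has_derivative_at_withinI)
    show "((\<lambda>y. k x y) has_derivative blinfun_apply (blinfun_mult_right (d x y))) (at y within Y)"
      if xy: "x \<in> X" "y \<in> Y" for x y
    proof (cases "x = 0")
      case True
      have "deriv (\<lambda>\<eta>. f (0, \<eta>)) 0 = B"
        by (rule DERIV_imp_deriv, rule sdf_deriv_snd, rule AB)
      then have dB: "d x y = B" by (simp add: d_def True)
      have "((\<lambda>y. A + B * y) has_derivative (\<lambda>h. B * h)) (at y within Y)"
        by (auto intro!: derivative_eq_intros)
      then show ?thesis by (simp add: k_def True dB[unfolded True])
    next
      case False
      have "sdf f (x, x * y)" using f inN xy by simp
      then obtain P Q where PQ: "sdiff f (x, x * y) P Q" unfolding sdf_def by (elim exE)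
      from sdf_deriv_snd[OF PQ] have Q: "((\<lambda>\<eta>. f (x, \<eta>)) has_field_derivative Q) (at (x * y))" .
      have dQ: "d x y = Q" unfolding d_def by (rule DERIV_imp_deriv, rule Q)
      have "((\<lambda>y. x * y) has_field_derivative x) (at y)"
        by (auto intro!: derivative_eq_intros)
      from DERIV_chain[OF Q this] have "((\<lambda>y. f (x, x * y)) has_field_derivative Q * x) (at y)"
        by (simp add: o_def)
      from DERIV_cdivide[OF this, of x] have "((\<lambda>y. f (x, x * y) / x) has_field_derivative Q) (at y)"
        using False by simp
      then have "((\<lambda>y. f (x, x * y) / x) has_derivative (*) Q) (at y within Y)"
        unfolding has_field_derivative_def by (rule has_derivative_at_withinI)
      then show ?thesis by (simp add: k_def False dQ)
    qed
    have "isCont \<sigma> (0, w0)" using \<sigma>c by (simp add: continuous_on_eq_continuous_at)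
    moreover have "isCont (\<lambda>z. deriv (\<lambda>\<eta>. f (fst z, \<eta>)) (snd z)) (\<sigma> (0, w0))"
      using isCont_deriv_snd[OF N f] by (simp add: \<sigma>_def)
    ultimately have "isCont ((\<lambda>z. deriv (\<lambda>\<eta>. f (fst z, \<eta>)) (snd z)) \<circ> \<sigma>) (0, w0)"
      by (rule continuous_at_compose)
    moreover have "((\<lambda>z. deriv (\<lambda>\<eta>. f (fst z, \<eta>)) (snd z)) \<circ> \<sigma>) = (\<lambda>(x,y). d x y)"
      by (auto simp: d_def \<sigma>_def fun_eq_iff)
    ultimately have "isCont (\<lambda>(x,y). d x y) (0, w0)" by simp
    then have "isCont (\<lambda>z. blinfun_mult_right ((\<lambda>(x,y). d x y) z)) (0, w0)"
      by (rule bounded_linear.isCont[OF bounded_linear_blinfun_mult_right])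
    then show "continuous (at (0, w0) within X \<times> Y) (\<lambda>(x, y). blinfun_mult_right (d x y))"
      by (simp add: case_prod_unfold continuous_at_imp_continuous_at_within)
    show "w0 \<in> Y" "convex Y" using XY by auto
  qed
  moreover have "at (0, w0) within X \<times> Y = at (0, w0)"
    by (rule at_within_open) (use XY in \<open>auto intro: open_Times\<close>)
  moreover have "d 0 w0 = B"
    unfolding d_def mult_zero_left by (rule DERIV_imp_deriv, rule sdf_deriv_snd, rule AB)
  ultimately have "((\<lambda>(x, y). k x y) has_derivative (\<lambda>(tx, ty). C * tx + B * ty)) (at (0, w0))"
    by simp
  then have "sdiff (\<lambda>z. if fst z = 0 then A + B * snd z else f (fst z, fst z * snd z) / fst z) (0,w0) C B"
    by (simp add: sdiff_def k_def case_prod_unfold)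
  then show ?thesis by (rule exI)
qed

subsection \<open>Parametrisations of a surface\<close>

text \<open>\<open>pimm\<close> abbreviates a pointwise holomorphic immersion; a \<open>param\<close> is the inverse of a
  holomorphic chart compatible with the atlas.\<close>

definition pimm :: "'a atlas \<Rightarrow> (complex \<times> complex \<Rightarrow> 'a) \<Rightarrow> complex \<times> complex \<Rightarrow> bool" where
  "pimm X g x \<longleftrightarrow> g x \<in> pts X \<and>
    (\<forall>(U, \<phi>)\<in>X. g x \<in> U \<longrightarrow> eventually (\<lambda>y. g y \<in> U) (nhds x) \<and> immers (\<phi> \<circ> g) x)"

definition param :: "'a atlas \<Rightarrow> (complex \<times> complex) set \<Rightarrow> (complex \<times> complex \<Rightarrow> 'a) \<Rightarrow> bool" where
  "param X \<Omega> g \<longleftrightarrow> open \<Omega> \<and> inj_on g \<Omega> \<and> (\<forall>x\<in>\<Omega>. pimm X g x)"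

lemma pimmI:
  assumes "g x \<in> pts X"
    and "\<And>U \<phi>. (U, \<phi>) \<in> X \<Longrightarrow> g x \<in> U \<Longrightarrow> eventually (\<lambda>y. g y \<in> U) (nhds x) \<and> immers (\<phi> \<circ> g) x"
  shows "pimm X g x"
  unfolding pimm_def using assms by auto

lemma pimmD:
  assumes "pimm X g x"
  shows "g x \<in> pts X"
    and "(U, \<phi>) \<in> X \<Longrightarrow> g x \<in> U \<Longrightarrow> eventually (\<lambda>y. g y \<in> U) (nhds x)"
    and "(U, \<phi>) \<in> X \<Longrightarrow> g x \<in> U \<Longrightarrow> immers (\<phi> \<circ> g) x"
  using assms unfolding pimm_def by auto

lemma in_ptsE:
  assumes "q \<in> pts X"
  obtains U \<phi> where "(U, \<phi>) \<in> X" "q \<in> U"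
  using assms unfolding pts_def by auto

lemma in_ptsI: "(U, \<phi>) \<in> X \<Longrightarrow> q \<in> U \<Longrightarrow> q \<in> pts X"
  unfolding pts_def by auto

lemma pimm_cong_ev:
  assumes "pimm X g x" and ev: "eventually (\<lambda>y. f y = g y) (nhds x)"
  shows "pimm X f x"
proof (rule pimmI)
  have fx: "f x = g x" using ev by (rule eventually_nhds_x_imp_x)
  show "f x \<in> pts X" using pimmD(1)[OF assms(1)] fx by simp
  fix U \<phi> assume c: "(U, \<phi>) \<in> X" "f x \<in> U"
  have g: "eventually (\<lambda>y. g y \<in> U) (nhds x)" "immers (\<phi> \<circ> g) x"
    using pimmD(2,3)[OF assms(1) c(1)] c(2) fx by auto
  have "eventually (\<lambda>y. f y \<in> U) (nhds x)" using g(1) ev by eventually_elim simp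
  moreover have "eventually (\<lambda>y. (\<phi> \<circ> f) y = (\<phi> \<circ> g) y) (nhds x)"
    using ev by eventually_elim simp
  ultimately show "eventually (\<lambda>y. f y \<in> U) (nhds x) \<and> immers (\<phi> \<circ> f) x"
    using g(2) immers_cong_ev by metis
qed

lemma eventually_isCont:
  "isCont f x \<Longrightarrow> eventually P (nhds (f x)) \<Longrightarrow> eventually (\<lambda>y. P (f y)) (nhds x)"
  using tendsto_at_iff_tendsto_nhds[of f x] unfolding isCont_def filterlim_iff by blast

lemma pimm_compose:
  assumes "pimm X g (\<kappa> x)" "immers \<kappa> x"
  shows "pimm X (g \<circ> \<kappa>) x"
proof (rule pimmI)
  show "(g \<circ> \<kappa>) x \<in> pts X" using pimmD(1)[OF assms(1)] by simp
  fix U \<phi> assume c: "(U, \<phi>) \<in> X" "(g \<circ> \<kappa>) x \<in> U"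
  have g: "eventually (\<lambda>y. g y \<in> U) (nhds (\<kappa> x))" "immers (\<phi> \<circ> g) (\<kappa> x)"
    using pimmD(2,3)[OF assms(1) c(1)] c(2) by auto
  have "eventually (\<lambda>y. g (\<kappa> y) \<in> U) (nhds x)"
    by (rule eventually_isCont[OF immers_isCont[OF assms(2)] g(1)])
  moreover have "immers (\<phi> \<circ> (g \<circ> \<kappa>)) x"
    using immers_compose[OF g(2) assms(2)] by (simp add: o_assoc)
  ultimately show "eventually (\<lambda>y. (g \<circ> \<kappa>) y \<in> U) (nhds x) \<and> immers (\<phi> \<circ> (g \<circ> \<kappa>)) x" by simp
qed

lemma paramD:
  assumes "param X \<Omega> g"
  shows "open \<Omega>" "inj_on g \<Omega>" "x \<in> \<Omega> \<Longrightarrow> pimm X g x" "x \<in> \<Omega> \<Longrightarrow> g x \<in> pts X"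
  using assms pimmD(1)[of X g x] unfolding param_def by blast+

lemma param_subset: "param X \<Omega> g \<Longrightarrow> open \<Omega>' \<Longrightarrow> \<Omega>' \<subseteq> \<Omega> \<Longrightarrow> param X \<Omega>' g"
  unfolding param_def by (meson inj_on_subset subsetD)

lemma param_compose:
  assumes "param X \<Omega> g" "open N" "inj_on \<kappa> N" "\<kappa> ` N \<subseteq> \<Omega>" "\<And>x. x \<in> N \<Longrightarrow> immers \<kappa> x"
  shows "param X N (g \<circ> \<kappa>)"
  unfolding param_def
proof (intro conjI ballI)
  show "open N" by fact
  show "inj_on (g \<circ> \<kappa>) N"
    using assms(3) inj_on_subset[OF paramD(2)[OF assms(1)] assms(4)] by (rule comp_inj_on)
  fix x assume "x \<in> N"
  then show "pimm X (g \<circ> \<kappa>) x"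
    using assms(4) by (intro pimm_compose paramD(3)[OF assms(1)] assms(5)) auto
qed

lemma holo_atlasD:
  assumes "holo_atlas X" "(U, \<phi>) \<in> X"
  shows "inj_on \<phi> U" "open (\<phi> ` U)"
    and "(W, \<psi>) \<in> X \<Longrightarrow> open (\<phi> ` (U \<inter> W))"
    and "(W, \<psi>) \<in> X \<Longrightarrow> x \<in> \<phi> ` (U \<inter> W) \<Longrightarrow> cdiff2 (\<psi> \<circ> inv_into U \<phi>) x"
  using assms unfolding holo_atlas_def holo2_iff by fast+

lemma openin_surf_topD:
  "holo_atlas X \<Longrightarrow> openin (surf_top X) A \<Longrightarrow> (U, \<phi>) \<in> X \<Longrightarrow> open (\<phi> ` (A \<inter> U))"
  by (auto simp: openin_surf_top)

lemma openin_surf_topI: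
  "holo_atlas X \<Longrightarrow> A \<subseteq> pts X \<Longrightarrow> (\<And>U \<phi>. (U, \<phi>) \<in> X \<Longrightarrow> open (\<phi> ` (A \<inter> U))) \<Longrightarrow> openin (surf_top X) A"
  by (auto simp: openin_surf_top)

lemma openin_chart:
  assumes "holo_atlas X" "(U, \<phi>) \<in> X"
  shows "openin (surf_top X) U"
proof (rule openin_surf_topI[OF assms(1)])
  show "U \<subseteq> pts X" using assms(2) by (auto simp: pts_def)
  fix W \<psi> assume "(W, \<psi>) \<in> X"
  from holo_atlasD(3)[OF assms(1) this assms(2)] show "open (\<psi> ` (U \<inter> W))"
    by (simp add: Int_commute)
qed

lemma topspace_surf_top [simp]:
  assumes "holo_atlas X"
  shows "topspace (surf_top X) = pts X"
proof
  show "topspace (surf_top X) \<subseteq> pts X"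
    using openin_topspace[of "surf_top X"] unfolding openin_surf_top[OF assms] by (rule conjunct1)
  have "openin (surf_top X) (pts X)"
  proof (rule openin_surf_topI[OF assms])
    fix U \<phi> assume c: "(U, \<phi>) \<in> X"
    then have "pts X \<inter> U = U" by (auto simp: pts_def)
    then show "open (\<phi> ` (pts X \<inter> U))" using holo_atlasD(2)[OF assms c] by simp
  qed simp
  then show "pts X \<subseteq> topspace (surf_top X)" by (rule openin_subset)
qed

text \<open>An immersion in one chart is continuous there, and injectivity of the chart pulls its
  open image back to \<open>A\<close>. Hence \<open>g\<close> is continuous at \<open>x\<close>
  against every open set of the surface, not only against chart domains.\<close>

lemma pimm_eventually:
  assumes X: "holo_atlas X" and g: "pimm X g x" and A: "openin (surf_top X) A" "g x \<in> A"
  shows "eventually (\<lambda>y. g y \<in> A) (nhds x)"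
proof -
  obtain U \<phi> where c: "(U, \<phi>) \<in> X" "g x \<in> U" using pimmD(1)[OF g] by (rule in_ptsE)
  have "open (\<phi> ` (A \<inter> U))" by (rule openin_surf_topD[OF X A(1) c(1)])
  moreover have "(\<phi> \<circ> g) x \<in> \<phi> ` (A \<inter> U)" using A(2) c(2) by simp
  ultimately have "eventually (\<lambda>y. y \<in> \<phi> ` (A \<inter> U)) (nhds ((\<phi> \<circ> g) x))"
    by (rule eventually_nhds_in_open)
  then have "eventually (\<lambda>y. (\<phi> \<circ> g) y \<in> \<phi> ` (A \<inter> U)) (nhds x)"
    by (rule eventually_isCont[OF immers_isCont[OF pimmD(3)[OF g c]]])
  then show ?thesis
    using pimmD(2)[OF g c]
  proof eventually_elim
    case (elim y)
    then obtain a where "a \<in> A" "a \<in> U" "\<phi> (g y) = \<phi> a" by auto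
    with elim(2) holo_atlasD(1)[OF X c(1)] show ?case by (auto dest: inj_onD)
  qed
qed

lemma param_open_vimage:
  assumes X: "holo_atlas X" and g: "param X \<Omega> g" and A: "openin (surf_top X) A"
  shows "open {x \<in> \<Omega>. g x \<in> A}"
  unfolding open_subopen[of "{x \<in> \<Omega>. g x \<in> A}"]
proof (intro ballI)
  fix x assume x: "x \<in> {x \<in> \<Omega>. g x \<in> A}"
  have "eventually (\<lambda>y. g y \<in> A) (nhds x)"
    by (rule pimm_eventually[OF X paramD(3)[OF g] A]) (use x in auto)
  moreover have "eventually (\<lambda>y. y \<in> \<Omega>) (nhds x)"
    by (rule eventually_nhds_in_open[OF paramD(1)[OF g]]) (use x in auto)
  ultimately have "eventually (\<lambda>y. y \<in> \<Omega> \<and> g y \<in> A) (nhds x)" by eventually_elim simp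
  then show "\<exists>T. open T \<and> x \<in> T \<and> T \<subseteq> {x \<in> \<Omega>. g x \<in> A}"
    unfolding eventually_nhds by auto
qed

lemma param_chart:
  assumes X: "holo_atlas X" and g: "param X \<Omega> g" and c: "(U, \<phi>) \<in> X"
  shows "continuous_on {x \<in> \<Omega>. g x \<in> U} (\<phi> \<circ> g)" "inj_on (\<phi> \<circ> g) {x \<in> \<Omega>. g x \<in> U}"
    "open {x \<in> \<Omega>. g x \<in> U}"
proof -
  show "continuous_on {x \<in> \<Omega>. g x \<in> U} (\<phi> \<circ> g)"
    by (rule continuous_at_imp_continuous_on)
      (auto intro!: immers_isCont pimmD(3)[OF paramD(3)[OF g] c])
  show "inj_on (\<phi> \<circ> g) {x \<in> \<Omega>. g x \<in> U}"
    using paramD(2)[OF g] holo_atlasD(1)[OF X c] by (auto simp: inj_on_def)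
  show "open {x \<in> \<Omega>. g x \<in> U}" by (rule param_open_vimage[OF X g openin_chart[OF X c]])
qed

text \<open>Differentiability is known only pointwise, so openness comes from invariance of domain:
  in each chart \<open>g\<close> is continuous and injective on an open set, into a space of the
  same dimension.\<close>

lemma param_open_image:
  assumes X: "holo_atlas X" and g: "param X \<Omega> g" and A: "open A" "A \<subseteq> \<Omega>"
  shows "openin (surf_top X) (g ` A)"
proof (rule openin_surf_topI[OF X])
  show "g ` A \<subseteq> pts X" using paramD(4)[OF g] A(2) by auto
  fix U \<phi> assume c: "(U, \<phi>) \<in> X"
  have gA: "param X A g" by (rule param_subset[OF g A])
  have "\<phi> ` (g ` A \<inter> U) = (\<phi> \<circ> g) ` {x \<in> A. g x \<in> U}" by auto
  also have "open \<dots>" using param_chart[OF X gA c] by (intro invariance_of_domain)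
  finally show "open (\<phi> ` (g ` A \<inter> U))" .
qed

text \<open>\<tau> expresses \<open>g\<close> in the coordinates of \<open>a\<close>. Through an
  atlas chart it is \<theta> after \<open>\<phi> \<circ> g\<close>, where \<theta> inverts
  \<open>\<phi> \<circ> a\<close>; and \<theta> is differentiable at the point because
  \<open>\<phi> \<circ> a\<close> is continuous on an open set with invertible derivative at the
  point.\<close>

lemma param_transition:
  assumes X: "holo_atlas X" and a: "param X S a" and g: "pimm X g x" and gx: "g x \<in> a ` S"
  defines "\<tau> \<equiv> inv_into S a \<circ> g"
  shows "immers \<tau> x" and "eventually (\<lambda>y. \<tau> y \<in> S \<and> g y = a (\<tau> y)) (nhds x)"
proof -
  have "eventually (\<lambda>y. g y \<in> a ` S) (nhds x)"
    by (rule pimm_eventually[OF X g param_open_image[OF X a paramD(1)[OF a] order_refl] gx])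
  then show "eventually (\<lambda>y. \<tau> y \<in> S \<and> g y = a (\<tau> y)) (nhds x)"
    by eventually_elim (auto simp: \<tau>_def f_inv_into_f intro: inv_into_into)
  define y where "y = \<tau> x"
  have yS: "y \<in> S" and ay: "a y = g x" using gx by (simp_all add: y_def \<tau>_def f_inv_into_f inv_into_into)
  obtain U \<phi> where c: "(U, \<phi>) \<in> X" "g x \<in> U" using pimmD(1)[OF g] by (rule in_ptsE)
  define N where "N = {s \<in> S. a s \<in> U}"
  note pc = param_chart[OF X a c(1), folded N_def]
  have yN: "y \<in> N" using yS ay c(2) by (simp add: N_def)
  define \<theta> where "\<theta> = inv_into S a \<circ> inv_into U \<phi>"
  have \<theta>: "\<theta> ((\<phi> \<circ> a) s) = s" if "s \<in> N" for s
    using that holo_atlasD(1)[OF X c(1)] paramD(2)[OF a] by (simp add: \<theta>_def N_def)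
  have "immers (\<phi> \<circ> a) y"
    by (rule pimmD(3)[OF paramD(3)[OF a yS] c(1)]) (simp add: ay c(2))
  then obtain A B C E where D: "A * E \<noteq> B * C" "((\<phi> \<circ> a) has_derivative mat2 A B C E) (at y)"
    unfolding immers_def by (elim exE conjE)
  define d where "d = A * E - B * C"
  have d0: "d \<noteq> 0" using D(1) by (simp add: d_def)
  \<comment> \<open>The adjugate divided by the determinant.\<close>
  have inv: "mat2 A B C E \<circ> mat2 (E/d) (-B/d) (-C/d) (A/d) = id"
  proof -
    have "A * (E/d) + B * (-C/d) = 1" "C * (-B/d) + E * (A/d) = 1"
      using d0 by (simp_all add: diff_divide_distrib[symmetric] d_def[symmetric] mult.commute)
    moreover have "A * (-B/d) + B * (A/d) = 0" "C * (E/d) + E * (-C/d) = 0" by simp_all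
    ultimately show ?thesis unfolding mat2_comp mat2_id by simp
  qed
  have "(\<theta> has_derivative mat2 (E/d) (-B/d) (-C/d) (A/d)) (at ((\<phi> \<circ> a) y))"
    by (rule has_derivative_inverse_strong[OF pc(3) yN pc(1) \<theta> D(2) inv])
  moreover have "(E/d) * (A/d) \<noteq> (-B/d) * (-C/d)"
  proof
    assume "(E/d) * (A/d) = (-B/d) * (-C/d)"
    then have "E * A / (d * d) = B * C / (d * d)" by simp
    then have "E * A = B * C" using d0 by simp
    then show False using D(1) by (simp add: mult.commute)
  qed
  ultimately have i\<theta>: "immers \<theta> ((\<phi> \<circ> a) y)" unfolding immers_def by metis
  have "immers (\<theta> \<circ> (\<phi> \<circ> g)) x"
    by (rule immers_compose[OF _ pimmD(3)[OF g c]]) (use i\<theta> ay in simp)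
  moreover have "eventually (\<lambda>z. (\<theta> \<circ> (\<phi> \<circ> g)) z = \<tau> z) (nhds x)"
    using pimmD(2)[OF g c]
    by eventually_elim (use holo_atlasD(1)[OF X c(1)] in \<open>simp add: \<theta>_def \<tau>_def\<close>)
  ultimately show "immers \<tau> x" using immers_cong_ev by metis
qed

subsection \<open>Restriction and biholomorphic maps\<close>

lemma pts_restr [simp]: "pts (restr X W) = pts X \<inter> W"
  unfolding pts_def restr_def by auto

lemma restr_iff: "(U, \<phi>) \<in> restr X W \<longleftrightarrow> (\<exists>U'. (U', \<phi>) \<in> X \<and> U = U' \<inter> W)"
  unfolding restr_def by force

lemma holo_atlas_restr:
  assumes X: "holo_atlas X" and W: "openin (surf_top X) W"
  shows "holo_atlas (restr X W)"
proof -
  have 1: "inj_on \<phi> (U \<inter> W)" "open (\<phi> ` (U \<inter> W))" if c: "(U, \<phi>) \<in> X" for U \<phi>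
  proof -
    show "inj_on \<phi> (U \<inter> W)" using holo_atlasD(1)[OF X c] by (rule inj_on_subset) simp
    show "open (\<phi> ` (U \<inter> W))" using openin_surf_topD[OF X W c] by (simp add: Int_commute)
  qed
  have 2: "open (\<phi> ` (U \<inter> W \<inter> (U' \<inter> W)))" if c: "(U, \<phi>) \<in> X" "(U', \<phi>') \<in> X" for U \<phi> U' \<phi>'
  proof -
    have "openin (surf_top X) (U' \<inter> W)" using openin_chart[OF X c(2)] W by (rule openin_Int)
    from openin_surf_topD[OF X this c(1)] have "open (\<phi> ` (U' \<inter> W \<inter> U))" .
    moreover have "U \<inter> W \<inter> (U' \<inter> W) = U' \<inter> W \<inter> U" by blast
    ultimately show ?thesis by simp
  qed
  have 3: "cdiff2 (\<phi>' \<circ> inv_into (U \<inter> W) \<phi>) x"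
    if c: "(U, \<phi>) \<in> X" "(U', \<phi>') \<in> X" and x: "x \<in> \<phi> ` (U \<inter> W \<inter> (U' \<inter> W))" for U \<phi> U' \<phi>' x
  proof -
    have "cdiff2 (\<phi>' \<circ> inv_into U \<phi>) x"
      by (rule holo_atlasD(4)[OF X c]) (use x in blast)
    \<comment> \<open>\<open>inv_into\<close> depends on the set it inverts over, but on this open
      image both choices return the same point.\<close>
    moreover have "eventually (\<lambda>y. y \<in> \<phi> ` (U \<inter> W)) (nhds x)"
      by (rule eventually_nhds_in_open[OF 1(2)[OF c(1)]]) (use x in blast)
    then have "eventually (\<lambda>y. (\<phi>' \<circ> inv_into (U \<inter> W) \<phi>) y = (\<phi>' \<circ> inv_into U \<phi>) y) (nhds x)"
    proof eventually_elim
      case (elim y)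
      then obtain q where q: "q \<in> U" "q \<in> W" "y = \<phi> q" by blast
      then have "inv_into U \<phi> y = q" "inv_into (U \<inter> W) \<phi> y = q"
        using holo_atlasD(1)[OF X c(1)] 1(1)[OF c(1)] by simp_all
      then show ?case by simp
    qed
    ultimately show ?thesis using cdiff2_cong_ev by blast
  qed
  show ?thesis
    unfolding holo_atlas_def holo2_iff
    using 1 2 3 by (fastforce simp: restr_iff)
qed

lemma openin_restr:
  assumes X: "holo_atlas X" and W: "openin (surf_top X) W"
  shows "openin (surf_top (restr X W)) A \<longleftrightarrow> openin (surf_top X) A \<and> A \<subseteq> W"
proof
  assume A: "openin (surf_top (restr X W)) A"
  have AW: "A \<subseteq> pts X \<inter> W"
    using openin_subset[OF A] topspace_surf_top[OF holo_atlas_restr[OF X W]] by simp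
  have "openin (surf_top X) A"
  proof (rule openin_surf_topI[OF X])
    show "A \<subseteq> pts X" using AW by blast
    fix U \<phi> assume "(U, \<phi>) \<in> X"
    then have "(U \<inter> W, \<phi>) \<in> restr X W" by (auto simp: restr_iff)
    from openin_surf_topD[OF holo_atlas_restr[OF X W] A this]
    have "open (\<phi> ` (A \<inter> (U \<inter> W)))" .
    moreover have "A \<inter> (U \<inter> W) = A \<inter> U" using AW by blast
    ultimately show "open (\<phi> ` (A \<inter> U))" by simp
  qed
  then show "openin (surf_top X) A \<and> A \<subseteq> W" using AW by blast
next
  assume A: "openin (surf_top X) A \<and> A \<subseteq> W"
  show "openin (surf_top (restr X W)) A"
  proof (rule openin_surf_topI[OF holo_atlas_restr[OF X W]])
    show "A \<subseteq> pts (restr X W)" using A openin_subset[of "surf_top X" A] topspace_surf_top[OF X] by auto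
    fix U \<phi> assume "(U, \<phi>) \<in> restr X W"
    then obtain U' where U': "(U', \<phi>) \<in> X" "U = U' \<inter> W" by (auto simp: restr_iff)
    have "A \<inter> U = A \<inter> U'" using A U' by blast
    then show "open (\<phi> ` (A \<inter> U))" using openin_surf_topD[OF X conjunct1[OF A] U'(1)] by simp
  qed
qed

lemma pimm_restr:
  assumes X: "holo_atlas X" and W: "openin (surf_top X) W"
  shows "pimm (restr X W) g x \<longleftrightarrow> pimm X g x \<and> g x \<in> W"
proof
  assume g: "pimm (restr X W) g x"
  have gx: "g x \<in> pts X" "g x \<in> W" using pimmD(1)[OF g] by auto
  have "pimm X g x"
  proof (rule pimmI[of g x, OF gx(1)])
    fix U \<phi> assume c: "(U, \<phi>) \<in> X" "g x \<in> U"
    then have c': "(U \<inter> W, \<phi>) \<in> restr X W" "g x \<in> U \<inter> W" using gx by (auto simp: restr_iff)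
    show "eventually (\<lambda>y. g y \<in> U) (nhds x) \<and> immers (\<phi> \<circ> g) x"
      using pimmD(2,3)[OF g c'] by (auto elim: eventually_mono)
  qed
  then show "pimm X g x \<and> g x \<in> W" using gx by blast
next
  assume g: "pimm X g x \<and> g x \<in> W"
  show "pimm (restr X W) g x"
  proof (rule pimmI)
    show "g x \<in> pts (restr X W)" using g pimmD(1)[OF conjunct1[OF g]] by simp
    fix U \<phi> assume c: "(U, \<phi>) \<in> restr X W" "g x \<in> U"
    then obtain U' where U': "(U', \<phi>) \<in> X" "U = U' \<inter> W" by (auto simp: restr_iff)
    have "eventually (\<lambda>y. g y \<in> W) (nhds x)" using pimm_eventually[OF X _ W] g by blast
    moreover have "eventually (\<lambda>y. g y \<in> U') (nhds x)" "immers (\<phi> \<circ> g) x"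
      using pimmD(2,3)[OF conjunct1[OF g] U'(1)] c U' by auto
    ultimately show "eventually (\<lambda>y. g y \<in> U) (nhds x) \<and> immers (\<phi> \<circ> g) x"
      unfolding U'(2) by (auto elim: eventually_elim2)
  qed
qed

lemma param_restr:
  assumes X: "holo_atlas X" and W: "openin (surf_top X) W"
  shows "param (restr X W) \<Omega> g \<longleftrightarrow> param X \<Omega> g \<and> g ` \<Omega> \<subseteq> W"
  unfolding param_def pimm_restr[OF X W] by blast

lemma holo_mapD:
  assumes "holo_map X Y f"
  shows "continuous_map (surf_top X) (surf_top Y) f"
    and "(U, \<phi>) \<in> X \<Longrightarrow> (W, \<psi>) \<in> Y \<Longrightarrow> x \<in> \<phi> ` (U \<inter> f -` W) \<Longrightarrow> cdiff2 (\<psi> \<circ> f \<circ> inv_into U \<phi>) x"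
  using assms unfolding holo_map_def holo2_iff by fast+

text \<open>A holomorphic left inverse makes the chart expression of \<open>f\<close> an immersion.
  Applied to the inverse of a biholomorphic map, this transports parametrisations from a model to
  the surface.\<close>

lemma pimm_holo:
  assumes X: "holo_atlas X" and Y: "holo_atlas Y" and f: "holo_map X Y f" and f': "holo_map Y X f'"
    and f'f: "\<And>q. q \<in> pts X \<Longrightarrow> f' (f q) = q" and g: "pimm X g x"
  shows "pimm Y (f \<circ> g) x"
proof -
  have gx: "g x \<in> pts X" by (rule pimmD(1)[OF g])
  have fim: "f q \<in> pts Y" if "q \<in> pts X" for q
    using continuous_map_image_subset_topspace[OF holo_mapD(1)[OF f]] that
    by (auto simp: topspace_surf_top[OF X] topspace_surf_top[OF Y])
  show ?thesis
  proof (rule pimmI)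
    show "(f \<circ> g) x \<in> pts Y" using fim gx by simp
    fix W \<psi> assume d: "(W, \<psi>) \<in> Y" "(f \<circ> g) x \<in> W"
    obtain U \<phi> where c: "(U, \<phi>) \<in> X" "g x \<in> U" using gx by (rule in_ptsE)
    define A where "A = {q \<in> pts X. f q \<in> W}"
    have A: "openin (surf_top X) A"
      using openin_continuous_map_preimage[OF holo_mapD(1)[OF f] openin_chart[OF Y d(1)]]
      by (simp add: A_def topspace_surf_top[OF X])
    have gA: "g x \<in> A" using gx d by (simp add: A_def)
    have evA: "eventually (\<lambda>y. g y \<in> A) (nhds x)" by (rule pimm_eventually[OF X g A gA])
    define F where "F = \<psi> \<circ> f \<circ> inv_into U \<phi>"
    have inv: "inv_into U \<phi> (\<phi> q) = q" if "q \<in> U" for q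
      using holo_atlasD(1)[OF X c(1)] that by simp
    have invW: "inv_into W \<psi> (\<psi> q) = q" if "q \<in> W" for q
      using holo_atlasD(1)[OF Y d(1)] that by simp
    have F1: "cdiff2 F (\<phi> (g x))"
      unfolding F_def by (rule holo_mapD(2)[OF f c(1) d(1)]) (use c d in auto)
    have Fx: "F (\<phi> (g x)) = \<psi> (f (g x))" by (simp add: F_def inv c)
    have F2: "cdiff2 (\<phi> \<circ> f' \<circ> inv_into W \<psi>) (F (\<phi> (g x)))"
      unfolding Fx by (rule holo_mapD(2)[OF f' d(1) c(1)]) (use c d f'f gx in auto)
    have "eventually (\<lambda>y. y \<in> \<phi> ` (A \<inter> U)) (nhds (\<phi> (g x)))"
      by (rule eventually_nhds_in_open[OF openin_surf_topD[OF X A c(1)]]) (use gA c in auto)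
    then have "eventually (\<lambda>y. (\<phi> \<circ> f' \<circ> inv_into W \<psi>) (F y) = y) (nhds (\<phi> (g x)))"
      by eventually_elim (auto simp: F_def A_def inv invW f'f)
    from immers_left_inverse[OF F1 F2 this] have "immers F ((\<phi> \<circ> g) x)" by simp
    from immers_compose[OF this pimmD(3)[OF g c]] have "immers (F \<circ> (\<phi> \<circ> g)) x" .
    moreover have "eventually (\<lambda>y. (F \<circ> (\<phi> \<circ> g)) y = (\<psi> \<circ> (f \<circ> g)) y) (nhds x)"
      using pimmD(2)[OF g c] by eventually_elim (simp add: F_def inv)
    ultimately have "immers (\<psi> \<circ> (f \<circ> g)) x" using immers_cong_ev by metis
    moreover have "eventually (\<lambda>y. (f \<circ> g) y \<in> W) (nhds x)"
      using evA by eventually_elim (simp add: A_def)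
    ultimately show "eventually (\<lambda>y. (f \<circ> g) y \<in> W) (nhds x) \<and> immers (\<psi> \<circ> (f \<circ> g)) x" by simp
  qed
qed

lemma biholoD:
  assumes "biholo X Y f"
  shows "bij_betw f (pts X) (pts Y)" "holo_map X Y f" "holo_map Y X (inv_into (pts X) f)"
  using assms unfolding biholo_def by auto

lemma pimm_biholo_inv:
  assumes X: "holo_atlas X" and Y: "holo_atlas Y" and f: "biholo X Y f" and g: "pimm Y g x"
  shows "pimm X (inv_into (pts X) f \<circ> g) x"
proof (rule pimm_holo[OF Y X biholoD(3,2)[OF f] _ g])
  fix q assume "q \<in> pts Y"
  then show "f (inv_into (pts X) f q) = q"
    using biholoD(1)[OF f] by (simp add: bij_betw_inv_into_right)
qed

lemma param_biholo_inv:
  assumes X: "holo_atlas X" and Y: "holo_atlas Y" and f: "biholo X Y f" and g: "param Y \<Omega> g"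
  shows "param X \<Omega> (inv_into (pts X) f \<circ> g)"
  unfolding param_def
proof (intro conjI ballI)
  show "open \<Omega>" by (rule paramD(1)[OF g])
  have "inj_on (inv_into (pts X) f) (pts Y)"
    using bij_betw_inv_into[OF biholoD(1)[OF f]] by (rule bij_betw_imp_inj_on)
  then have "inj_on (inv_into (pts X) f) (g ` \<Omega>)"
    by (rule inj_on_subset) (use paramD(4)[OF g] in auto)
  with paramD(2)[OF g] show "inj_on (inv_into (pts X) f \<circ> g) \<Omega>" by (rule comp_inj_on)
  show "pimm X (inv_into (pts X) f \<circ> g) x" if "x \<in> \<Omega>" for x
    by (rule pimm_biholo_inv[OF X Y f paramD(3)[OF g that]])
qed

text \<open>The transition maps in the two directions are holomorphic and inverse to each other near
  the point, so each is an immersion.\<close>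

lemma param_of_chart:
  assumes X: "holo_atlas X" and c: "(U, \<phi>) \<in> X"
  shows "param X (\<phi> ` U) (inv_into U \<phi>)"
  unfolding param_def
proof (intro conjI ballI)
  note inj = holo_atlasD(1)[OF X c]
  show "open (\<phi> ` U)" by (rule holo_atlasD(2)[OF X c])
  show "inj_on (inv_into U \<phi>) (\<phi> ` U)" by (rule inj_on_inv_into) simp
  fix x assume "x \<in> \<phi> ` U"
  then obtain q where q: "q \<in> U" "x = \<phi> q" by blast
  have invx: "inv_into U \<phi> x = q" using q inj by simp
  show "pimm X (inv_into U \<phi>) x"
  proof (rule pimmI)
    show "inv_into U \<phi> x \<in> pts X" unfolding invx by (rule in_ptsI[OF c q(1)])
    fix W \<psi> assume d: "(W, \<psi>) \<in> X" "inv_into U \<phi> x \<in> W"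
    then have qW: "q \<in> W" by (simp add: invx)
    have ev: "eventually (\<lambda>y. y \<in> \<phi> ` (U \<inter> W)) (nhds x)"
      by (rule eventually_nhds_in_open[OF holo_atlasD(3)[OF X c d(1)]]) (use q qW in auto)
    have 1: "eventually (\<lambda>y. inv_into U \<phi> y \<in> W) (nhds x)"
      using ev by eventually_elim (use inj in auto)
    have "immers (\<psi> \<circ> inv_into U \<phi>) x"
    proof (rule immers_left_inverse)
      show "cdiff2 (\<psi> \<circ> inv_into U \<phi>) x"
        by (rule holo_atlasD(4)[OF X c d(1)]) (use q qW in auto)
      show "cdiff2 (\<phi> \<circ> inv_into W \<psi>) ((\<psi> \<circ> inv_into U \<phi>) x)"
        by (rule holo_atlasD(4)[OF X d(1) c]) (use q qW invx in auto)
      show "eventually (\<lambda>y. (\<phi> \<circ> inv_into W \<psi>) ((\<psi> \<circ> inv_into U \<phi>) y) = y) (nhds x)"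
        using ev by eventually_elim (use inj holo_atlasD(1)[OF X d(1)] in auto)
    qed
    with 1 show "eventually (\<lambda>y. inv_into U \<phi> y \<in> W) (nhds x) \<and> immers (\<psi> \<circ> inv_into U \<phi>) x" by blast
  qed
qed

lemma cdiff2_ident: "cdiff2 (\<lambda>z. z) x"
  unfolding cdiff2_def mat2_id[symmetric] using has_derivative_ident by (metis mat2_id(1))

lemma immers_ident: "immers (\<lambda>z. z) x"
  by (rule immers_left_inverse[where g="\<lambda>z. z"]) (simp_all add: cdiff2_ident)

lemma pts_C2 [simp]: "pts C2 = UNIV"
  by (simp add: pts_def C2_def)

lemma holo_atlas_C2: "holo_atlas C2"
proof -
  have "inv_into UNIV (\<lambda>z::complex \<times> complex. z) = (\<lambda>z. z)"
    by (rule ext) (metis UNIV_I inv_into_f_f inj_on_def)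
  then show ?thesis
    unfolding holo_atlas_def C2_def holo2_iff by (simp add: o_def cdiff2_ident)
qed

lemma openin_C2: "openin (surf_top C2) A \<longleftrightarrow> open A"
  by (simp add: openin_surf_top[OF holo_atlas_C2]) (simp add: C2_def)

lemma pimm_C2: "pimm C2 g x \<longleftrightarrow> immers g x"
  by (simp add: pimm_def) (simp add: C2_def o_def)

subsection \<open>Charts of the blow-up\<close>

definition span2 :: "complex \<times> complex \<Rightarrow> (complex \<times> complex) set" where
  "span2 v = range (\<lambda>c. cscale c v)"

lemma span2_iff:
  "z \<in> span2 (1, t) \<longleftrightarrow> snd z = fst z * t" "z \<in> span2 (t, 1) \<longleftrightarrow> fst z = snd z * t"
  by (auto simp: span2_def cscale_def image_iff prod_eq_iff)

lemma span2_CP1: "v \<noteq> 0 \<Longrightarrow> span2 v \<in> CP1"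
  unfolding CP1_def span2_def by blast

lemma span2_scale:
  assumes "c \<noteq> 0" shows "span2 (cscale c v) = span2 v"
proof -
  have 1: "cscale d v = cscale (d / c) (cscale c v)" for d using assms by (simp add: cscale_def)
  have 2: "cscale d (cscale c v) = cscale (d * c) v" for d by (simp add: cscale_def mult.assoc)
  show ?thesis unfolding span2_def
  proof
    show "range (\<lambda>d. cscale d (cscale c v)) \<subseteq> range (\<lambda>d. cscale d v)" unfolding 2 by blast
    show "range (\<lambda>d. cscale d v) \<subseteq> range (\<lambda>d. cscale d (cscale c v))"
    proof
      fix z assume "z \<in> range (\<lambda>d. cscale d v)"
      then obtain d where "z = cscale d v" by (rule rangeE)
      then have "z = cscale (d / c) (cscale c v)" using 1 by (rule trans)
      then show "z \<in> range (\<lambda>d. cscale d (cscale c v))" by (rule range_eqI)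
    qed
  qed
qed

text \<open>The two affine charts of the projective line: a nonzero coordinate of a spanning vector
  is scaled to 1.\<close>

lemma CP1_cases:
  assumes "l \<in> CP1"
  shows "(0,1) \<notin> l \<Longrightarrow> \<exists>t. l = span2 (1,t)" "(1,0) \<notin> l \<Longrightarrow> \<exists>t. l = span2 (t,1)"
proof -
  obtain a b where l: "l = span2 (a,b)" "(a,b) \<noteq> 0"
    using assms unfolding CP1_def span2_def by (auto simp del: zero_prod_def)
  show "\<exists>t. l = span2 (1,t)" if "(0,1) \<notin> l"
  proof (cases "a = 0")
    case True
    then have "b \<noteq> 0" using l by (simp add: zero_prod_def)
    then have "(0,1) = cscale (1/b) (a,b)" using True by (simp add: cscale_def)
    then have "(0,1) \<in> l" unfolding l span2_def by (rule range_eqI)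
    then show ?thesis using that by simp
  next
    case False
    then have "(a,b) = cscale a (1, b/a)" by (simp add: cscale_def)
    then have "l = span2 (1, b/a)" using span2_scale[OF False] l by metis
    then show ?thesis by (rule exI)
  qed
  show "\<exists>t. l = span2 (t,1)" if "(1,0) \<notin> l"
  proof (cases "b = 0")
    case True
    then have "a \<noteq> 0" using l by (simp add: zero_prod_def)
    then have "(1,0) = cscale (1/a) (a,b)" using True by (simp add: cscale_def)
    then have "(1,0) \<in> l" unfolding l span2_def by (rule range_eqI)
    then show ?thesis using that by simp
  next
    case False
    then have "(a,b) = cscale b (a/b, 1)" by (simp add: cscale_def)
    then have "l = span2 (a/b, 1)" using span2_scale[OF False] l by metis
    then show ?thesis by (rule exI)
  qed
qed

text \<open>Inverses of the two charts of \<open>Bl0\<close>, which avoid the definite descriptions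
  in the charts. In \<open>bl_param2\<close> the first argument is the second coordinate of the
  point, and the second argument is the inverse slope of the line.\<close>

definition bl_param1 :: "complex \<times> complex \<Rightarrow> (complex \<times> complex) \<times> (complex \<times> complex) set" where
  "bl_param1 z = ((fst z, fst z * snd z), span2 (1, snd z))"
definition bl_param2 :: "complex \<times> complex \<Rightarrow> (complex \<times> complex) \<times> (complex \<times> complex) set" where
  "bl_param2 z = ((fst z * snd z, fst z), span2 (snd z, 1))"
abbreviation "bl_dom1 \<equiv> {(x, l) \<in> Bl0_pts. (0, 1) \<notin> l}"
abbreviation "bl_dom2 \<equiv> {(x, l) \<in> Bl0_pts. (1, 0) \<notin> l}"
definition bl_chart1 :: "(complex \<times> complex) \<times> (complex \<times> complex) set \<Rightarrow> complex \<times> complex" where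
  "bl_chart1 = (\<lambda>(x, l). (fst x, THE t. (1, t) \<in> l))"
definition bl_chart2 :: "(complex \<times> complex) \<times> (complex \<times> complex) set \<Rightarrow> complex \<times> complex" where
  "bl_chart2 = (\<lambda>(x, l). (snd x, THE t. (t, 1) \<in> l))"

lemma Bl0_eq: "Bl0 = {(bl_dom1, bl_chart1), (bl_dom2, bl_chart2)}"
  unfolding Bl0_def bl_chart1_def bl_chart2_def ..

lemma chi_beta [simp]: "bl_chart1 (bl_param1 z) = z" "bl_chart2 (bl_param2 z) = z"
  by (simp_all add: bl_chart1_def bl_param1_def bl_chart2_def bl_param2_def span2_iff)

lemma beta_Bl0_pts: "bl_param1 z \<in> Bl0_pts" "bl_param2 z \<in> Bl0_pts"
  by (auto simp: bl_param1_def bl_param2_def Bl0_pts_def span2_iff zero_prod_def intro!: span2_CP1)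

lemma B1_eq: "bl_dom1 = range bl_param1"
proof
  show "bl_dom1 \<subseteq> range bl_param1"
  proof (clarify)
    fix x1 x2 l assume a: "((x1,x2), l) \<in> Bl0_pts" "(0,1) \<notin> l"
    then have "l \<in> CP1" "(x1,x2) \<in> l" by (auto simp: Bl0_pts_def)
    with CP1_cases(1) a(2) obtain t where t: "l = span2 (1,t)" by blast
    have "((x1,x2), l) = bl_param1 (x1, t)"
      using \<open>(x1,x2) \<in> l\<close> by (simp add: bl_param1_def t span2_iff)
    then show "((x1,x2), l) \<in> range bl_param1" by (rule range_eqI)
  qed
  show "range bl_param1 \<subseteq> bl_dom1"
    using beta_Bl0_pts(1) by (auto simp: bl_param1_def span2_iff)
qed

lemma B2_eq: "bl_dom2 = range bl_param2"
proof
  show "bl_dom2 \<subseteq> range bl_param2"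
  proof (clarify)
    fix x1 x2 l assume a: "((x1,x2), l) \<in> Bl0_pts" "(1,0) \<notin> l"
    then have "l \<in> CP1" "(x1,x2) \<in> l" by (auto simp: Bl0_pts_def)
    with CP1_cases(2) a(2) obtain t where t: "l = span2 (t,1)" by blast
    have "((x1,x2), l) = bl_param2 (x2, t)"
      using \<open>(x1,x2) \<in> l\<close> by (simp add: bl_param2_def t span2_iff)
    then show "((x1,x2), l) \<in> range bl_param2" by (rule range_eqI)
  qed
  show "range bl_param2 \<subseteq> bl_dom2"
    using beta_Bl0_pts(2) by (auto simp: bl_param2_def span2_iff)
qed

lemma beta12:
  assumes "t \<noteq> 0"
  shows "bl_param1 (x, t) = bl_param2 (x * t, 1 / t)" "bl_param2 (x, t) = bl_param1 (x * t, 1 / t)"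
proof -
  have "span2 (1, t) = span2 (1/t, 1)"
    using span2_scale[of t "(1/t, 1)"] assms by (simp add: cscale_def)
  then show "bl_param1 (x, t) = bl_param2 (x * t, 1 / t)" using assms by (simp add: bl_param1_def bl_param2_def)
  have "span2 (t, 1) = span2 (1, 1/t)"
    using span2_scale[of t "(1, 1/t)"] assms by (simp add: cscale_def)
  then show "bl_param2 (x, t) = bl_param1 (x * t, 1 / t)" using assms by (simp add: bl_param1_def bl_param2_def)
qed

lemma beta1_in_B2: "bl_param1 z \<in> range bl_param2 \<longleftrightarrow> snd z \<noteq> 0"
proof
  assume "bl_param1 z \<in> range bl_param2"
  then have "bl_param1 z \<in> bl_dom2" by (simp only: B2_eq)
  then show "snd z \<noteq> 0" by (auto simp: bl_param1_def span2_iff)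
next
  assume "snd z \<noteq> 0"
  then have "bl_param1 z = bl_param2 (fst z * snd z, 1 / snd z)" using beta12(1)[of "snd z" "fst z"] by simp
  then show "bl_param1 z \<in> range bl_param2" by (rule range_eqI)
qed

lemma beta2_in_B1: "bl_param2 z \<in> range bl_param1 \<longleftrightarrow> snd z \<noteq> 0"
proof
  assume "bl_param2 z \<in> range bl_param1"
  then have "bl_param2 z \<in> bl_dom1" by (simp only: B1_eq)
  then show "snd z \<noteq> 0" by (auto simp: bl_param2_def span2_iff)
next
  assume "snd z \<noteq> 0"
  then have "bl_param2 z = bl_param1 (fst z * snd z, 1 / snd z)" using beta12(2)[of "snd z" "fst z"] by simp
  then show "bl_param2 z \<in> range bl_param1" by (rule range_eqI)
qed

lemma inv_beta [simp]: "inv_into (range bl_param1) bl_chart1 z = bl_param1 z" "inv_into (range bl_param2) bl_chart2 z = bl_param2 z"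
proof -
  have "inj_on bl_chart1 (range bl_param1)" "inj_on bl_chart2 (range bl_param2)" by (auto simp: inj_on_def)
  then show "inv_into (range bl_param1) bl_chart1 z = bl_param1 z" "inv_into (range bl_param2) bl_chart2 z = bl_param2 z"
    by (metis chi_beta inv_into_f_f rangeI)+
qed

lemma chi_image:
  "bl_chart1 ` (range bl_param1) = UNIV" "bl_chart2 ` (range bl_param2) = UNIV"
  "bl_chart1 ` (range bl_param1 \<inter> A) = {z. bl_param1 z \<in> A}" "bl_chart2 ` (range bl_param2 \<inter> A) = {z. bl_param2 z \<in> A}"
  by (force simp: image_iff)+

lemma open_snd_nz: "open {z::complex\<times>complex. snd z \<noteq> 0}"
  by (intro open_Collect_neq continuous_intros)

lemma cdiff2_swapchart:
  assumes "snd z \<noteq> 0"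
  shows "cdiff2 (\<lambda>z. (fst z * snd z, 1 / snd z)) z"
  by (intro cdiff2_pairI sdf_intros assms)

text \<open>On the overlap both transition maps send (x, t) to (x t, 1/t), which is holomorphic
  where t is nonzero.\<close>

lemma holo_atlas_Bl0: "holo_atlas Bl0"
proof -
  have 12: "cdiff2 (bl_chart2 \<circ> bl_param1) z" if "snd z \<noteq> 0" for z
  proof -
    have "eventually (\<lambda>y. y \<in> {z::complex\<times>complex. snd z \<noteq> 0}) (nhds z)"
      by (rule eventually_nhds_in_open[OF open_snd_nz]) (simp add: that)
    then have "eventually (\<lambda>y. (bl_chart2 \<circ> bl_param1) y = (fst y * snd y, 1 / snd y)) (nhds z)"
      by eventually_elim (use beta12(1) in \<open>auto simp: split_paired_all\<close>)
    from cdiff2_cong_ev[OF this] show ?thesis using cdiff2_swapchart[OF that] by (simp add: o_def)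
  qed
  have 21: "cdiff2 (bl_chart1 \<circ> bl_param2) z" if "snd z \<noteq> 0" for z
  proof -
    have "eventually (\<lambda>y. y \<in> {z::complex\<times>complex. snd z \<noteq> 0}) (nhds z)"
      by (rule eventually_nhds_in_open[OF open_snd_nz]) (simp add: that)
    then have "eventually (\<lambda>y. (bl_chart1 \<circ> bl_param2) y = (fst y * snd y, 1 / snd y)) (nhds z)"
      by eventually_elim (use beta12(2) in \<open>auto simp: split_paired_all\<close>)
    from cdiff2_cong_ev[OF this] show ?thesis using cdiff2_swapchart[OF that] by (simp add: o_def)
  qed
  have inv: "inv_into (range bl_param1) bl_chart1 = bl_param1" "inv_into (range bl_param2) bl_chart2 = bl_param2" by (auto simp: fun_eq_iff)
  have idc: "bl_chart1 \<circ> bl_param1 = (\<lambda>z. z)" "bl_chart2 \<circ> bl_param2 = (\<lambda>z. z)" by (auto simp: fun_eq_iff)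
  have inj: "inj_on bl_chart1 (range bl_param1)" "inj_on bl_chart2 (range bl_param2)" by (auto simp: inj_on_def)
  have tr: "\<forall>x\<in>range bl_param1 \<inter> range bl_param2. cdiff2 (bl_chart2 \<circ> bl_param1) (bl_chart1 x)"
    "\<forall>x\<in>range bl_param2 \<inter> range bl_param1. cdiff2 (bl_chart1 \<circ> bl_param2) (bl_chart2 x)"
  proof (intro ballI)
    fix x assume x: "x \<in> range bl_param1 \<inter> range bl_param2"
    then obtain z where z: "x = bl_param1 z" by blast
    then have "snd z \<noteq> 0" using beta1_in_B2[of z] x by simp
    then show "cdiff2 (bl_chart2 \<circ> bl_param1) (bl_chart1 x)" using 12 z by simp
  next
    show "\<forall>x\<in>range bl_param2 \<inter> range bl_param1. cdiff2 (bl_chart1 \<circ> bl_param2) (bl_chart2 x)"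
    proof (intro ballI)
      fix x assume x: "x \<in> range bl_param2 \<inter> range bl_param1"
      then obtain z where z: "x = bl_param2 z" by blast
      then have "snd z \<noteq> 0" using beta2_in_B1[of z] x by simp
      then show "cdiff2 (bl_chart1 \<circ> bl_param2) (bl_chart2 x)" using 21 z by simp
    qed
  qed
  show ?thesis
    unfolding holo_atlas_def holo2_iff Bl0_eq B1_eq B2_eq
    using tr open_snd_nz inj
    by (simp add: inv idc cdiff2_ident chi_image beta1_in_B2 beta2_in_B1)
qed

text \<open>No line through the origin contains both basis vectors, so every point lies in one of
  the two chart domains.\<close>

lemma pts_Bl0: "pts Bl0 = Bl0_pts"
proof
  show "pts Bl0 \<subseteq> Bl0_pts" by (auto simp: pts_def Bl0_eq)
  have "(0,1) \<notin> l \<or> (1,0) \<notin> l" if "(x,l) \<in> Bl0_pts" "(x1, x2) = x" for x l x1 x2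
  proof -
    have "l \<in> CP1" using that by (simp add: Bl0_pts_def)
    show ?thesis
    proof (rule ccontr)
      assume a: "\<not> ?thesis"
      obtain v where v: "l = span2 v" using \<open>l \<in> CP1\<close> unfolding CP1_def span2_def by blast
      obtain c d where "(0,1) = cscale c v" "(1,0) = cscale d v"
        using a unfolding v span2_def by blast
      then show False by (auto simp: cscale_def)
    qed
  qed
  then show "Bl0_pts \<subseteq> pts Bl0" by (auto simp: pts_def Bl0_eq)
qed

lemma Bl0_cases:
  assumes "q \<in> Bl0_pts"
  shows "(\<exists>z. q = bl_param1 z) \<or> (\<exists>z. q = bl_param2 z)"
proof -
  have "q \<in> bl_dom1 \<union> bl_dom2" using assms unfolding pts_Bl0[symmetric] by (auto simp: pts_def Bl0_eq)
  then show ?thesis unfolding B1_eq B2_eq by auto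
qed

lemma param_beta: "param Bl0 UNIV bl_param1" "param Bl0 UNIV bl_param2"
proof -
  have "(range bl_param1, bl_chart1) \<in> Bl0" "(range bl_param2, bl_chart2) \<in> Bl0" by (simp_all add: Bl0_eq B1_eq B2_eq)
  from this[THEN param_of_chart[OF holo_atlas_Bl0]]
  moreover have "inv_into (range bl_param1) bl_chart1 = bl_param1" "inv_into (range bl_param2) bl_chart2 = bl_param2" by (simp_all add: fun_eq_iff)
  ultimately show "param Bl0 UNIV bl_param1" "param Bl0 UNIV bl_param2" by (simp_all only: chi_image)
qed

lemma openin_Bl0:
  assumes "open S"
  shows "openin (surf_top Bl0) {(x, l) \<in> Bl0_pts. x \<in> S}"
proof (rule openin_surf_topI[OF holo_atlas_Bl0])
  show "{(x, l) \<in> Bl0_pts. x \<in> S} \<subseteq> pts Bl0" by (auto simp: pts_Bl0)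
  fix U \<phi> assume "(U, \<phi>) \<in> Bl0"
  then have "U = range bl_param1 \<and> \<phi> = bl_chart1 \<or> U = range bl_param2 \<and> \<phi> = bl_chart2" by (simp add: Bl0_eq B1_eq B2_eq)
  then show "open (\<phi> ` ({(x, l) \<in> Bl0_pts. x \<in> S} \<inter> U))"
  proof (elim disjE conjE)
    assume u: "U = range bl_param1" "\<phi> = bl_chart1"
    have "\<phi> ` ({(x, l) \<in> Bl0_pts. x \<in> S} \<inter> U) = {z. bl_param1 z \<in> {(x, l) \<in> Bl0_pts. x \<in> S}}"
      unfolding u Int_commute[of _ "range bl_param1"] chi_image ..
    also have "\<dots> = (\<lambda>z. (fst z, fst z * snd z)) -` S" using beta_Bl0_pts by (auto simp: bl_param1_def)
    also have "open \<dots>" by (intro open_vimage assms continuous_intros)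
    finally show ?thesis .
  next
    assume u: "U = range bl_param2" "\<phi> = bl_chart2"
    have "\<phi> ` ({(x, l) \<in> Bl0_pts. x \<in> S} \<inter> U) = {z. bl_param2 z \<in> {(x, l) \<in> Bl0_pts. x \<in> S}}"
      unfolding u Int_commute[of _ "range bl_param2"] chi_image ..
    also have "\<dots> = (\<lambda>z. (fst z * snd z, fst z)) -` S" using beta_Bl0_pts by (auto simp: bl_param2_def)
    also have "open \<dots>" by (intro open_vimage assms continuous_intros)
    finally show ?thesis .
  qed
qed

section \<open>The blow-up map and its local model\<close>

locale blown =
  fixes X :: "'b atlas" and p :: 'b and X' :: "'a atlas" and \<pi> :: "'a \<Rightarrow> 'b"
  assumes blowup: "blowup X p X' \<pi>"
begin

lemma X: "holo_atlas X" and X': "holo_atlas X'" and p: "p \<in> pts X"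
  and haus: "Hausdorff_space (surf_top X)"
  and pi: "continuous_map (surf_top X') (surf_top X) \<pi>"
  and off: "biholo (restr X' (pts X' - \<pi> -` {p})) (restr X (pts X - {p})) \<pi>"
  using blowup unfolding blowup_def complex_surface_def holo_map_def by blast+

definition sig :: "'b \<Rightarrow> 'a" where
  "sig = inv_into (pts X' - \<pi> -` {p}) \<pi>"

lemma pi_pts: "q \<in> pts X' \<Longrightarrow> \<pi> q \<in> pts X"
  using continuous_map_image_subset_topspace[OF pi] by (auto simp: topspace_surf_top[OF X] topspace_surf_top[OF X'])

lemma openin_pi: "openin (surf_top X) A \<Longrightarrow> openin (surf_top X') {q \<in> pts X'. \<pi> q \<in> A}"
  using openin_continuous_map_preimage[OF pi, of A] by (simp add: topspace_surf_top[OF X'])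

text \<open>Points are closed because the surface is Hausdorff, so the restrictions to the
  complement of the centre and of its preimage are restrictions to open sets.\<close>

lemma open_off: "openin (surf_top X) (pts X - {p})" 
proof -
  have "closedin (surf_top X) {p}"
    by (rule closedin_Hausdorff_singleton[OF haus]) (simp add: topspace_surf_top[OF X] p)
  then show ?thesis by (simp add: closedin_def topspace_surf_top[OF X])
qed

lemma open_off': "openin (surf_top X') (pts X' - \<pi> -` {p})"
proof -
  have "{q \<in> pts X'. \<pi> q \<in> pts X - {p}} = pts X' - \<pi> -` {p}" using pi_pts by auto
  then show ?thesis using openin_pi[OF open_off] by simp
qed

lemma bij: "bij_betw \<pi> (pts X' - \<pi> -` {p}) (pts X - {p})"
proof -
  have "pts (restr X' (pts X' - \<pi> -` {p})) = pts X' - \<pi> -` {p}" "pts (restr X (pts X - {p})) = pts X - {p}"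
    by auto
  then show ?thesis using biholoD(1)[OF off] by metis
qed

lemma pi_sig: "q \<in> pts X \<Longrightarrow> q \<noteq> p \<Longrightarrow> \<pi> (sig q) = q"
  and sig_pts: "q \<in> pts X \<Longrightarrow> q \<noteq> p \<Longrightarrow> sig q \<in> pts X'"
  and sig_pi: "q' \<in> pts X' \<Longrightarrow> \<pi> q' \<noteq> p \<Longrightarrow> sig (\<pi> q') = q'"
proof -
  assume q: "q \<in> pts X" "q \<noteq> p"
  show "\<pi> (sig q) = q" unfolding sig_def using bij_betw_inv_into_right[OF bij] q by blast
  have "sig q \<in> pts X' - \<pi> -` {p}" 
    unfolding sig_def using bij_betw_imp_surj_on[OF bij] q by (intro inv_into_into) auto
  then show "sig q \<in> pts X'" by simp
next
  assume "q' \<in> pts X'" "\<pi> q' \<noteq> p"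
  then show "sig (\<pi> q') = q'" unfolding sig_def using bij_betw_inv_into_left[OF bij] by auto
qed

lemma sig_inv: "sig = inv_into (pts (restr X' (pts X' - \<pi> -` {p}))) \<pi>"
proof -
  have "pts (restr X' (pts X' - \<pi> -` {p})) = pts X' - \<pi> -` {p}" by auto
  then show ?thesis by (simp only: sig_def)
qed

lemma pimm_sig:
  assumes "pimm X g x" "g x \<noteq> p"
  shows "pimm X' (sig \<circ> g) x"
proof -
  have "pimm (restr X (pts X - {p})) g x"
    using assms pimmD(1)[OF assms(1)] by (simp add: pimm_restr[OF X open_off])
  from pimm_biholo_inv[OF holo_atlas_restr[OF X' open_off'] holo_atlas_restr[OF X open_off] off this]
  show ?thesis unfolding sig_inv by (simp add: pimm_restr[OF X' open_off'])
qed

lemma param_sig: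
  assumes "param X \<Omega> g" "p \<notin> g ` \<Omega>"
  shows "param X' \<Omega> (sig \<circ> g)"
  unfolding param_def
proof (intro conjI ballI)
  show "open \<Omega>" by (rule paramD(1)[OF assms(1)])
  show "inj_on (sig \<circ> g) \<Omega>"
  proof (rule comp_inj_on[OF paramD(2)[OF assms(1)]])
    show "inj_on sig (g ` \<Omega>)"
      by (rule inj_on_inverseI[where g=\<pi>]) (use paramD(4)[OF assms(1)] assms(2) pi_sig in blast)
  qed
  show "pimm X' (sig \<circ> g) x" if "x \<in> \<Omega>" for x
    by (rule pimm_sig[OF paramD(3)[OF assms(1) that]]) (use that assms(2) in auto)
qed

text \<open>Turns the unspecified local isomorphisms of \<open>blowup\<close> into parametrisations:
  \<open>a\<close> inverts the chart centred at \<open>p\<close>, and \<open>b1\<close>,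
  \<open>b2\<close> are the two charts of \<open>Bl0\<close> transported to \<open>X'\<close>. The
  last three conclusions say how \<open>b1\<close> and \<open>b2\<close> overlap, that over the
  centre they overlap nowhere else, and that together they cover the exceptional curve.\<close>

lemma local_model:
  obtains S a b1 b2 where "open S" "(0,0) \<in> S" "param X S a" "a (0,0) = p"
    "param X' {z. (fst z, fst z * snd z) \<in> S} b1" "\<And>x t. (x, x * t) \<in> S \<Longrightarrow> \<pi> (b1 (x, t)) = a (x, x * t)"
    "param X' {z. (fst z * snd z, fst z) \<in> S} b2" "\<And>x t. (x * t, x) \<in> S \<Longrightarrow> \<pi> (b2 (x, t)) = a (x * t, x)"
    "\<And>x t. t \<noteq> 0 \<Longrightarrow> b1 (x, t) = b2 (x * t, 1 / t)"
    "\<And>t s. b1 (0, t) = b2 (0, s) \<Longrightarrow> t * s = 1"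
    "\<And>q. q \<in> pts X' \<Longrightarrow> \<pi> q = p \<Longrightarrow> (\<exists>t. q = b1 (0, t)) \<or> (\<exists>t. q = b2 (0, t))"
proof -
  obtain U S \<phi> \<Phi> where U: "openin (surf_top X) U" "p \<in> U" and S: "open S"
    and \<phi>: "biholo (restr X U) (restr C2 S) \<phi>" "\<phi> p = (0, 0)"
    and \<Phi>: "biholo (restr X' (pts X' \<inter> \<pi> -` U)) (restr Bl0 {(x, l) \<in> Bl0_pts. x \<in> S}) \<Phi>"
    and comm: "\<forall>z \<in> pts X' \<inter> \<pi> -` U. fst (\<Phi> z) = \<phi> (\<pi> z)"
    using blowup unfolding blowup_def by blast
  define U' where "U' = pts X' \<inter> \<pi> -` U"
  have "U' = {q \<in> pts X'. \<pi> q \<in> U}" by (auto simp: U'_def)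
  then have U': "openin (surf_top X') U'" using openin_pi[OF U(1)] by simp
  have UX: "U \<subseteq> pts X" using openin_subset[OF U(1)] by (simp add: topspace_surf_top[OF X])
  define W where "W = {(x, l) \<in> Bl0_pts. x \<in> S}"
  have W: "openin (surf_top Bl0) W" unfolding W_def by (rule openin_Bl0[OF S])
  have SC: "openin (surf_top C2) S" by (simp add: openin_C2 S)
  have pU: "pts (restr X U) = U" "pts (restr C2 S) = S" "pts (restr X' U') = U'" "pts (restr Bl0 W) = W"
    using UX by (auto simp: U'_def W_def pts_Bl0)
  note \<Phi> = \<Phi>[folded U'_def W_def]
  have bij\<phi>: "bij_betw \<phi> U S" using biholoD(1)[OF \<phi>(1)] by (simp only: pU)
  have bij\<Phi>: "bij_betw \<Phi> U' W" using biholoD(1)[OF \<Phi>] by (simp only: pU)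
  define a where "a = inv_into U \<phi> \<circ> (\<lambda>z. z)"
  define G where "G = inv_into U' \<Phi>"
  have "param (restr C2 S) S (\<lambda>z. z)"
    unfolding param_restr[OF holo_atlas_C2 SC] using S by (simp add: param_def pimm_C2 immers_ident)
  from param_biholo_inv[OF holo_atlas_restr[OF X U(1)] holo_atlas_restr[OF holo_atlas_C2 SC] \<phi>(1) this]
  have a: "param X S a" unfolding pU a_def by (simp add: param_restr[OF X U(1)])
  have par: "param X' N (G \<circ> \<beta>)" if "param Bl0 UNIV \<beta>" "\<beta> ` N \<subseteq> W" "open N" for \<beta> N
  proof -
    have "param (restr Bl0 W) N \<beta>"
      using param_subset[OF that(1,3)] that(2) by (simp add: param_restr[OF holo_atlas_Bl0 W])
    from param_biholo_inv[OF holo_atlas_restr[OF X' U'] holo_atlas_restr[OF holo_atlas_Bl0 W] \<Phi> this]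
    show ?thesis unfolding pU G_def by (simp add: param_restr[OF X' U'])
  qed
  have G: "\<Phi> (G w) = w" "G w \<in> U'" if "w \<in> W" for w
  proof -
    show "\<Phi> (G w) = w" unfolding G_def by (rule bij_betw_inv_into_right[OF bij\<Phi> that])
    show "G w \<in> U'" unfolding G_def using bij_betw_imp_surj_on[OF bij\<Phi>] that by (intro inv_into_into) auto
  qed
  have piG: "\<pi> (G w) = a (fst w)" if "w \<in> W" for w
  proof -
    have "fst (\<Phi> (G w)) = \<phi> (\<pi> (G w))"
      by (rule bspec[OF comm]) (use G[OF that] in \<open>simp add: U'_def\<close>)
    then have "\<phi> (\<pi> (G w)) = fst w" by (simp add: G[OF that])
    moreover have "\<pi> (G w) \<in> U" using G[OF that] by (simp add: U'_def)
    ultimately show ?thesis unfolding a_def using bij_betw_inv_into_left[OF bij\<phi>] by fastforce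
  qed
  have inW: "(fst z, fst z * snd z) \<in> S \<Longrightarrow> bl_param1 z \<in> W" "(fst z * snd z, fst z) \<in> S \<Longrightarrow> bl_param2 z \<in> W" for z
    using beta_Bl0_pts[of z] by (simp_all add: W_def bl_param1_def bl_param2_def)
  have S0: "(0,0) \<in> S" using bij_betw_apply[OF bij\<phi> U(2)] \<phi>(2) by simp
  show thesis
  proof (rule that[of S a "G \<circ> bl_param1" "G \<circ> bl_param2"])
    show "open S" by fact
    show "(0,0) \<in> S" by fact
    show "param X S a" by fact
    show "a (0,0) = p" unfolding a_def using bij_betw_inv_into_left[OF bij\<phi> U(2)] \<phi>(2) by simp
    show "param X' {z. (fst z, fst z * snd z) \<in> S} (G \<circ> bl_param1)"
    proof (rule par[OF param_beta(1)])
      have "open ((\<lambda>z::complex\<times>complex. (fst z, fst z * snd z)) -` S)"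
        by (intro open_vimage S continuous_intros)
      then show "open {z. (fst z, fst z * snd z) \<in> S}" by (simp add: vimage_def)
    qed (use inW in auto)
    show "param X' {z. (fst z * snd z, fst z) \<in> S} (G \<circ> bl_param2)"
    proof (rule par[OF param_beta(2)])
      have "open ((\<lambda>z::complex\<times>complex. (fst z * snd z, fst z)) -` S)"
        by (intro open_vimage S continuous_intros)
      then show "open {z. (fst z * snd z, fst z) \<in> S}" by (simp add: vimage_def)
    qed (use inW in auto)
    show "\<pi> ((G \<circ> bl_param1) (x, t)) = a (x, x * t)" if "(x, x * t) \<in> S" for x t
      using piG inW(1)[of "(x,t)"] that by (simp add: bl_param1_def)
    show "\<pi> ((G \<circ> bl_param2) (x, t)) = a (x * t, x)" if "(x * t, x) \<in> S" for x t
      using piG inW(2)[of "(x,t)"] that by (simp add: bl_param2_def)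
    show "(G \<circ> bl_param1) (x, t) = (G \<circ> bl_param2) (x * t, 1 / t)" if "t \<noteq> 0" for x t
      using beta12(1)[OF that] by simp
    show "t * s = 1" if "(G \<circ> bl_param1) (0, t) = (G \<circ> bl_param2) (0, s)" for t s
    proof -
      have "bl_param1 (0, t) \<in> W" "bl_param2 (0, s) \<in> W" using inW[of "(0,t)"] inW[of "(0,s)"] S0 by simp_all
      from this[THEN G(1)] have "bl_param1 (0, t) = bl_param2 (0, s)"
        using arg_cong[OF that, of \<Phi>] by (simp only: o_apply)
      then have "span2 (1,t) = span2 (s,1)" by (simp add: bl_param1_def bl_param2_def)
      moreover have "(1,t) \<in> span2 (1,t)" by (simp add: span2_iff)
      ultimately have "(1,t) \<in> span2 (s,1)" by simp
      then show ?thesis by (simp add: span2_iff)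
    qed
    fix q assume q: "q \<in> pts X'" "\<pi> q = p"
    then have qU: "q \<in> U'" using U(2) by (simp add: U'_def)
    then have w: "\<Phi> q \<in> W" by (rule bij_betw_apply[OF bij\<Phi>])
    have f0: "fst (\<Phi> q) = (0,0)" using comm qU q(2) \<phi>(2) by (simp add: U'_def)
    have "q = G (\<Phi> q)" unfolding G_def using bij_betw_inv_into_left[OF bij\<Phi> qU] by simp
    moreover have "(\<exists>z. \<Phi> q = bl_param1 z) \<or> (\<exists>z. \<Phi> q = bl_param2 z)"
      by (rule Bl0_cases) (use w in \<open>auto simp: W_def\<close>)
    ultimately show "(\<exists>t. q = (G \<circ> bl_param1) (0, t)) \<or> (\<exists>t. q = (G \<circ> bl_param2) (0, t))"
      using f0 by (force simp: bl_param1_def bl_param2_def)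
  qed
qed

end

subsection \<open>Lifting parametrisations to the blow-up\<close>

definition blow_down :: "complex \<times> complex \<Rightarrow> complex \<times> complex" where
  "blow_down z = (fst z, fst z * snd z)"

lemma open_bd_vimage: "open S \<Longrightarrow> open {z. blow_down z \<in> S}"
proof -
  assume "open S"
  moreover have "continuous_on UNIV blow_down" unfolding blow_down_def by (intro continuous_intros)
  ultimately have "open (blow_down -` S)" by (rule open_vimage)
  then show ?thesis by (simp add: vimage_def)
qed

lemma immers_bd:
  assumes "fst z \<noteq> 0" shows "immers blow_down z"
proof -
  have "immers (\<lambda>z. (fst z, fst z * snd z)) z"
    by (rule immers_pairI[OF sdiff_fst sdiff_mult[OF sdiff_fst sdiff_snd]]) (use assms in simp)
  then show ?thesis by (simp add: blow_down_def[abs_def])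
qed

text \<open>\<open>K1\<close> and \<open>K2\<close> are the components of
  \<open>\<tau> \<circ> blow_down\<close> divided by z, so (z K1, K2 / K1) is the lift of \<tau> in
  the first chart of the blow-up. Over z = 0 its slope is (C + E w) / (A + B w), the action of the
  derivative on directions, and \<open>nz\<close> keeps this slope finite at w0.\<close>

lemma blowup_coordinates_immers:
  assumes N: "open N" "(0,0) \<in> N" and \<tau>: "\<And>z. z \<in> N \<Longrightarrow> cdiff2 \<tau> z" and \<tau>0: "\<tau> (0,0) = (0,0)"
    and D: "(\<tau> has_derivative mat2 A B C E) (at (0,0))" and det: "A * E \<noteq> B * C" and nz: "A + B * w0 \<noteq> 0"
  defines "K1 \<equiv> \<lambda>z. if fst z = 0 then A + B * snd z else fst (\<tau> (blow_down z)) / fst z"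
    and "K2 \<equiv> \<lambda>z. if fst z = 0 then C + E * snd z else snd (\<tau> (blow_down z)) / fst z"
  shows "immers (\<lambda>z. (fst z * K1 z, K2 z / K1 z)) (0, w0)" and "isCont K1 (0, w0)"
proof -
  have sd: "sdf (\<lambda>z. fst (\<tau> z)) z" "sdf (\<lambda>z. snd (\<tau> z)) z" if "z \<in> N" for z
    using \<tau>[OF that] sdiff_fst_snd unfolding cdiff2_def sdf_def by blast+
  obtain C1 where C1: "sdiff K1 (0,w0) C1 B"
    using sdiff_divided[OF N sd(1) _ sdiff_fst_snd(1)[OF D]] \<tau>0 unfolding K1_def blow_down_def by auto
  obtain C2 where C2: "sdiff K2 (0,w0) C2 E"
    using sdiff_divided[OF N sd(2) _ sdiff_fst_snd(2)[OF D]] \<tau>0 unfolding K2_def blow_down_def by auto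
  show "isCont K1 (0, w0)" using C1 sdf_isCont unfolding sdf_def by blast
  have K: "K1 (0,w0) = A + B * w0" "K2 (0,w0) = C + E * w0" by (simp_all add: K1_def K2_def)
  show "immers (\<lambda>z. (fst z * K1 z, K2 z / K1 z)) (0, w0)"
  proof (rule immers_pairI[OF sdiff_mult[OF sdiff_fst C1] sdiff_divide[OF C2 C1]])
    show "K1 (0,w0) \<noteq> 0" using nz K by simp
    \<comment> \<open>At z = 0 the Jacobian is triangular, with diagonal entries K1 and (A E - B C)
      / K1^2.\<close>
    have "E * (A + B * w0) - (C + E * w0) * B \<noteq> 0" using det by (simp add: algebra_simps)
    then show "(1 * K1 (0, w0) + fst (0, w0) * C1) * ((E * K1 (0, w0) - K2 (0, w0) * B) / (K1 (0, w0))\<^sup>2)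
      \<noteq> (0 * K1 (0, w0) + fst (0, w0) * B) * ((C2 * K1 (0, w0) - K2 (0, w0) * C1) / (K1 (0, w0))\<^sup>2)"
      unfolding K using nz by simp
  qed
qed

context blown
begin

text \<open>Off the exceptional curve the lift is forced by \<open>sig\<close>, on it by the
  derivative of \<tau>; near (0, w0) both prescriptions agree with
  \<open>b \<circ> \<kappa>\<close>, which is an immersion. The maps \<open>a\<close> and
  \<open>b\<close> are kept general so that swapping coordinates covers the second chart as
  well.\<close>

lemma pimm_lift_at_exc:
  assumes S: "(0,0) \<in> S" and b: "param X' {z. blow_down z \<in> S} b"
    and pib: "\<And>x t. (x, x * t) \<in> S \<Longrightarrow> \<pi> (b (x, t)) = a (x, x * t)"
    and N: "open N" "(0,0) \<in> N" and \<tau>: "\<And>z. z \<in> N \<Longrightarrow> \<tau> z \<in> S \<and> g z = a (\<tau> z) \<and> cdiff2 \<tau> z"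
    and gp: "\<And>z. z \<in> N \<Longrightarrow> g z = p \<longleftrightarrow> z = (0,0)" and \<tau>0: "\<tau> (0,0) = (0,0)"
    and D: "(\<tau> has_derivative mat2 A B C E) (at (0,0))" and det: "A * E \<noteq> B * C" and nz: "A + B * w0 \<noteq> 0"
    and g'1: "\<And>z. fst z \<noteq> 0 \<Longrightarrow> g' z = sig (g (blow_down z))"
    and g'0: "\<And>w. A + B * w \<noteq> 0 \<Longrightarrow> g' (0, w) = b (0, (C + E * w) / (A + B * w))"
  shows "pimm X' g' (0, w0)"
proof -
  define K1 where "K1 = (\<lambda>z. if fst z = 0 then A + B * snd z else fst (\<tau> (blow_down z)) / fst z)"
  define K2 where "K2 = (\<lambda>z. if fst z = 0 then C + E * snd z else snd (\<tau> (blow_down z)) / fst z)"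
  define \<kappa> where "\<kappa> = (\<lambda>z. (fst z * K1 z, K2 z / K1 z))"
  have \<tau>c: "\<And>z. z \<in> N \<Longrightarrow> cdiff2 \<tau> z" using \<tau> by blast
  note bi = blowup_coordinates_immers[OF N \<tau>c \<tau>0 D det nz]
  have i: "immers \<kappa> (0, w0)" using bi(1) by (simp only: \<kappa>_def K1_def K2_def)
  have cK1: "isCont K1 (0, w0)" using bi(2) by (simp only: K1_def)
  have "pimm X' b (\<kappa> (0, w0))"
    by (rule paramD(3)[OF b]) (simp add: \<kappa>_def blow_down_def S)
  from pimm_compose[OF this i] have "pimm X' (b \<circ> \<kappa>) (0, w0)" .
  moreover have "eventually (\<lambda>z. g' z = (b \<circ> \<kappa>) z) (nhds (0, w0))"
  proof -
    have "eventually (\<lambda>z. z \<in> {z. blow_down z \<in> N}) (nhds (0, w0))"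
      by (rule eventually_nhds_in_open[OF open_bd_vimage[OF N(1)]]) (simp add: blow_down_def N)
    moreover have "eventually (\<lambda>y. y \<in> - {0}) (nhds (K1 (0, w0)))"
      by (rule eventually_nhds_in_open) (use nz in \<open>auto simp: K1_def\<close>)
    then have "eventually (\<lambda>z. K1 z \<in> - {0}) (nhds (0, w0))"
      by (rule eventually_isCont[OF cK1])
    ultimately show ?thesis
    proof eventually_elim
      case (elim z)
      then have zN: "blow_down z \<in> N" and K1: "K1 z \<noteq> 0" by auto
      show ?case
      proof (cases "fst z = 0")
        case True
        then have z: "z = (0, snd z)" by (simp add: prod_eq_iff)
        have "A + B * snd z \<noteq> 0" using K1 True by (simp add: K1_def)
        from g'0[OF this] have "g' z = b (0, (C + E * snd z) / (A + B * snd z))" using z by simp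
        then show ?thesis using True by (simp add: \<kappa>_def K1_def K2_def)
      next
        case False
        have e: "\<tau> (blow_down z) = (fst (\<kappa> z), fst (\<kappa> z) * snd (\<kappa> z))"
          using False K1 by (simp add: \<kappa>_def prod_eq_iff) (simp add: K1_def K2_def)
        have inS: "(fst (\<kappa> z), fst (\<kappa> z) * snd (\<kappa> z)) \<in> S" using \<tau>[OF zN] unfolding e by blast
        have "\<pi> (b (\<kappa> z)) = a (\<tau> (blow_down z))" using pib[OF inS] by (simp add: e)
        also have "\<dots> = g (blow_down z)" using \<tau>[OF zN] by simp
        finally have pb: "\<pi> (b (\<kappa> z)) = g (blow_down z)" .
        have "b (\<kappa> z) \<in> pts X'" by (rule paramD(4)[OF b]) (use inS in \<open>simp add: blow_down_def\<close>)
        moreover have "g (blow_down z) \<noteq> p" using gp[OF zN] False by (simp add: blow_down_def)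
        ultimately have "sig (g (blow_down z)) = b (\<kappa> z)" using sig_pi[of "b (\<kappa> z)"] pb by simp
        then show ?thesis using g'1[OF False] by simp
      qed
    qed
  qed
  ultimately show ?thesis by (rule pimm_cong_ev)
qed

text \<open>Blowing up does not depend on the coordinates chosen at the centre: any \<open>g\<close>
  centred at \<open>p\<close> lifts to two standard charts, which over \<open>p\<close> differ from
  those of the local model by the action of the derivative on directions. The chart
  \<open>g'\<close> sees every direction except (0, 1), which is the origin of
  \<open>g''\<close>.\<close>

lemma lift:
  assumes g: "param X \<Omega> g" and 0: "(0,0) \<in> \<Omega>" and gp: "g (0,0) = p"
  obtains g' g'' where
    "param X' {z. blow_down z \<in> \<Omega>} g'" "\<And>z. blow_down z \<in> \<Omega> \<Longrightarrow> \<pi> (g' z) = g (blow_down z)"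
    "param X' {z. prod.swap (blow_down z) \<in> \<Omega>} g''" "\<And>z. prod.swap (blow_down z) \<in> \<Omega> \<Longrightarrow> \<pi> (g'' z) = g (prod.swap (blow_down z))"
    "\<And>q. q \<in> pts X' \<Longrightarrow> \<pi> q = p \<Longrightarrow> q = g'' (0,0) \<or> (\<exists>w. q = g' (0, w))"
proof (rule local_model)
  fix S a b1 b2
  assume S: "open S" "(0,0) \<in> S" and a: "param X S a" "a (0,0) = p"
    and b1: "param X' {z. (fst z, fst z * snd z) \<in> S} b1" "\<And>x t. (x, x * t) \<in> S \<Longrightarrow> \<pi> (b1 (x, t)) = a (x, x * t)"
    and b2: "param X' {z. (fst z * snd z, fst z) \<in> S} b2" "\<And>x t. (x * t, x) \<in> S \<Longrightarrow> \<pi> (b2 (x, t)) = a (x * t, x)"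
    and b12: "\<And>x t. t \<noteq> 0 \<Longrightarrow> b1 (x, t) = b2 (x * t, 1 / t)"
    and b12': "\<And>t s. b1 (0, t) = b2 (0, s) \<Longrightarrow> t * s = 1"
    and exc: "\<And>q. q \<in> pts X' \<Longrightarrow> \<pi> q = p \<Longrightarrow> (\<exists>t. q = b1 (0, t)) \<or> (\<exists>t. q = b2 (0, t))"
  \<comment> \<open>The point of the exceptional curve for the direction \<open>v\<close>, measured
    in the coordinates of \<open>a\<close>. A vanishing first entry gives the vertical direction;
    for the zero vector this is only a default value.\<close>
  define dir where "dir = (\<lambda>v::complex\<times>complex. if fst v \<noteq> 0 then b1 (0, snd v / fst v) else b2 (0, 0))"
  have dir2: "dir v = b2 (0, fst v / snd v)" if "snd v \<noteq> 0" for v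
    using that b12[of "snd v / fst v" 0] by (simp add: dir_def)
  have dir_scale: "dir (cscale c v) = dir v" if "c \<noteq> 0" for c v
    using that by (simp add: dir_def cscale_def)
  have dir_exc: "\<exists>v. v \<noteq> (0,0) \<and> q = dir v" if q: "q \<in> pts X'" "\<pi> q = p" for q
    using exc[OF q]
  proof
    assume "\<exists>t. q = b1 (0, t)"
    then obtain t where "q = b1 (0, t)" ..
    then show ?thesis by (intro exI[of _ "(1,t)"]) (simp add: dir_def)
  next
    assume "\<exists>t. q = b2 (0, t)"
    then obtain t where "q = b2 (0, t)" ..
    then show ?thesis by (intro exI[of _ "(t,1)"]) (simp add: dir2)
  qed
  have pi_dir: "\<pi> (dir v) = p" for v
    using b1(2)[of 0] b2(2)[of 0] S a by (simp add: dir_def)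
  have b1_inj: "t = s" if "b1 (0, t) = b1 (0, s)" for t s
    using inj_onD[OF paramD(2)[OF b1(1)] that] S by simp
  have dir_inj: "fst v * snd w = fst w * snd v" if "dir v = dir w" for v w
  proof -
    consider "fst v \<noteq> 0" "fst w \<noteq> 0" | "fst v = 0" "fst w = 0" | "fst v \<noteq> 0" "fst w = 0" | "fst v = 0" "fst w \<noteq> 0" by blast
    then show ?thesis
    proof cases
      case 1
      then have "snd v / fst v = snd w / fst w" using that by (intro b1_inj) (simp add: dir_def)
      then show ?thesis using 1 by (simp add: field_simps)
    next
      case 3
      then have "snd v / fst v * 0 = 1" using that by (intro b12') (simp add: dir_def)
      then show ?thesis by simp
    next
      case 4
      then have "snd w / fst w * 0 = 1" using that by (intro b12') (simp add: dir_def)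
      then show ?thesis by simp
    qed simp
  qed
  \<comment> \<open>Stated for an arbitrary parametrisation, so that it serves both \<open>g\<close>
    and \<open>g\<close> with swapped coordinates.\<close>
  have main: "param X' {z. blow_down z \<in> \<Omega>} g' \<and> (\<forall>z. blow_down z \<in> \<Omega> \<longrightarrow> \<pi> (g' z) = g (blow_down z))"
    if g: "param X \<Omega> g" and 0: "(0,0) \<in> \<Omega>" and gp: "g (0,0) = p"
      and D: "(inv_into S a \<circ> g has_derivative mat2 A B C E) (at (0,0))" and det: "A * E \<noteq> B * C"
      and g': "g' = (\<lambda>z. if fst z = 0 then dir (A + B * snd z, C + E * snd z) else sig (g (blow_down z)))"
    for g \<Omega> A B C E g'
  proof -
    have gp': "g z = p \<longleftrightarrow> z = (0,0)" if "z \<in> \<Omega>" for z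
      using inj_onD[OF paramD(2)[OF g] _ that 0] gp by auto
    have pig': "\<pi> (g' z) = g (blow_down z)" if z: "blow_down z \<in> \<Omega>" for z
    proof (cases "fst z = 0")
      case True
      then show ?thesis by (simp add: g' pi_dir gp blow_down_def)
    next
      case False
      then have "g (blow_down z) \<noteq> p" using gp'[OF z] by (simp add: blow_down_def)
      then show ?thesis using False pi_sig[OF paramD(4)[OF g z]] by (simp add: g')
    qed
    have "inj_on g' {z. blow_down z \<in> \<Omega>}"
    proof (rule inj_onI)
      fix z z' assume z: "z \<in> {z. blow_down z \<in> \<Omega>}" "z' \<in> {z. blow_down z \<in> \<Omega>}" and e: "g' z = g' z'"
      have "g (blow_down z) = g (blow_down z')" using pig' z e by (metis mem_Collect_eq)
      then have bz: "blow_down z = blow_down z'" using inj_onD[OF paramD(2)[OF g]] z by blast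
      show "z = z'"
      proof (cases "fst z = 0")
        case False
        then show ?thesis using bz by (auto simp: blow_down_def prod_eq_iff)
      next
        case True
        then have "fst z' = 0" using bz by (simp add: blow_down_def)
        then have "dir (A + B * snd z, C + E * snd z) = dir (A + B * snd z', C + E * snd z')"
          using e True by (simp add: g')
        \<comment> \<open>An invertible derivative acts injectively on directions.\<close>
        from dir_inj[OF this] have "(A * E - B * C) * (snd z' - snd z) = 0" by (simp add: algebra_simps)
        then show ?thesis using det True \<open>fst z' = 0\<close> by (auto simp: prod_eq_iff)
      qed
    qed
    moreover have "pimm X' g' z" if z: "blow_down z \<in> \<Omega>" for z
    proof (cases "fst z = 0")
      case False
      have "g (blow_down z) \<noteq> p" using gp'[OF z] False by (simp add: blow_down_def)
      then have "pimm X' (sig \<circ> g) (blow_down z)" by (intro pimm_sig paramD(3)[OF g z])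
      from pimm_compose[OF this immers_bd[OF False]] have "pimm X' (sig \<circ> g \<circ> blow_down) z" .
      moreover have "eventually (\<lambda>y. y \<in> {y::complex\<times>complex. fst y \<noteq> 0}) (nhds z)"
        by (rule eventually_nhds_in_open) (use False in \<open>auto intro!: open_Collect_neq continuous_intros\<close>)
      then have "eventually (\<lambda>y. g' y = (sig \<circ> g \<circ> blow_down) y) (nhds z)"
        by eventually_elim (simp add: g')
      ultimately show ?thesis by (rule pimm_cong_ev)
    next
      case True
      define \<tau> where "\<tau> = inv_into S a \<circ> g"
      define N where "N = {z \<in> \<Omega>. g z \<in> a ` S}"
      have N: "open N" "(0,0) \<in> N"
        using param_open_vimage[OF X g param_open_image[OF X a(1) S(1) order_refl]] 0 gp a(2) S(2)
        by (force simp: N_def)+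
      have \<tau>: "\<tau> z \<in> S \<and> g z = a (\<tau> z) \<and> cdiff2 \<tau> z" if "z \<in> N" for z
      proof -
        have zN: "z \<in> \<Omega>" "g z \<in> a ` S" using that by (auto simp: N_def)
        note pt = param_transition[OF X a(1) paramD(3)[OF g zN(1)] zN(2), folded \<tau>_def]
        show ?thesis
          using eventually_nhds_x_imp_x[OF pt(2)] immers_cdiff2[OF pt(1)] by blast
      qed
      have \<tau>0: "\<tau> (0,0) = (0,0)"
        using paramD(2)[OF a(1)] S(2) a(2) gp by (metis \<tau>_def comp_apply inv_into_f_f)
      have gpN: "g z = p \<longleftrightarrow> z = (0,0)" if "z \<in> N" for z using gp' that by (simp add: N_def)
      have b1': "param X' {z. blow_down z \<in> S} b1" using b1(1) by (simp add: blow_down_def)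
      have zz: "z = (0, snd z)" using True by (simp add: prod_eq_iff)
      show ?thesis
      proof (cases "A + B * snd z = 0")
        case False
        have "pimm X' g' (0, snd z)"
          by (rule pimm_lift_at_exc[OF S(2) b1' b1(2) N \<tau> gpN \<tau>0 D[folded \<tau>_def] det False])
            (simp_all add: g' dir_def)
        then show ?thesis using zz by simp
      next
        \<comment> \<open>The image direction is vertical, so its slope in \<open>b1\<close> is
          infinite; exchanging the two target coordinates moves the argument to
          \<open>b2\<close>.\<close>
        case AB: True
        have CE: "C + E * snd z \<noteq> 0"
        proof
          assume "C + E * snd z = 0"
          then have "A = - B * snd z" "C = - E * snd z" using AB by (simp_all add: eq_neg_iff_add_eq_0)
          then show False using det by simp
        qed
        define T where "T = {z. prod.swap z \<in> S}"
        have b2': "param X' {z. blow_down z \<in> T} b2" using b2(1) by (simp add: blow_down_def T_def)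
        have T0: "(0,0) \<in> T" using S by (simp add: T_def)
        have cs: "cdiff2 prod.swap z" for z
          by (simp add: prod.swap_def[abs_def] cdiff2_pairI sdf_fst sdf_snd)
        have dsw: "(prod.swap has_derivative mat2 0 1 1 0) (at z)" for z
          using sdiff_pair[OF sdiff_snd sdiff_fst] by (simp add: prod.swap_def[abs_def])
        have D': "(prod.swap \<circ> \<tau> has_derivative mat2 C E A B) (at (0,0))"
          using diff_chain_at[OF D[folded \<tau>_def] dsw] by (simp add: mat2_comp)
        have "pimm X' g' (0, snd z)"
        proof (rule pimm_lift_at_exc[OF T0 b2' _ N _ gpN _ D' _ CE])
          show "\<pi> (b2 (x, t)) = (a \<circ> prod.swap) (x, x * t)" if "(x, x * t) \<in> T" for x t
            using b2(2) that by (simp add: T_def)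
          show "(prod.swap \<circ> \<tau>) z \<in> T \<and> g z = (a \<circ> prod.swap) ((prod.swap \<circ> \<tau>) z) \<and> cdiff2 (prod.swap \<circ> \<tau>) z"
            if "z \<in> N" for z
            using \<tau>[OF that] cdiff2_compose[OF cs] by (simp add: T_def)
          show "(prod.swap \<circ> \<tau>) (0,0) = (0,0)" by (simp add: \<tau>0)
          show "C * B \<noteq> E * A" using det by (simp add: mult.commute)
        qed (simp_all add: g' dir2)
        then show ?thesis using zz by simp
      qed
    qed
    ultimately show ?thesis
      using open_bd_vimage[OF paramD(1)[OF g]] pig' unfolding param_def by blast
  qed
  have g0S: "g (0,0) \<in> a ` S" using gp a S by force
  from param_transition(1)[OF X a(1) paramD(3)[OF g 0] g0S]
  obtain A B C E where det: "A * E \<noteq> B * C" and D: "(inv_into S a \<circ> g has_derivative mat2 A B C E) (at (0,0))"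
    unfolding immers_def by blast
  define g' where "g' = (\<lambda>z. if fst z = 0 then dir (A + B * snd z, C + E * snd z) else sig (g (blow_down z)))"
  note 1 = main[OF g 0 gp D det g'_def]
  define gs where "gs = g \<circ> prod.swap"
  define \<Omega>s where "\<Omega>s = {z. prod.swap z \<in> \<Omega>}"
  have dsw: "(prod.swap has_derivative mat2 0 1 1 0) (at z)" for z :: "complex \<times> complex"
    using sdiff_pair[OF sdiff_snd sdiff_fst] by (simp add: prod.swap_def[abs_def])
  have isw: "immers prod.swap z" for z
    unfolding immers_def
    by (rule exI[of _ 0], rule exI[of _ 1], rule exI[of _ 1], rule exI[of _ 0]) (simp add: dsw)
  have "open (prod.swap -` \<Omega> :: (complex\<times>complex) set)"
    using paramD(1)[OF g] by (intro open_vimage) (auto intro: continuous_on_swap)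
  then have o: "open \<Omega>s" by (simp add: \<Omega>s_def vimage_def)
  have gs: "param X \<Omega>s gs"
    unfolding gs_def by (rule param_compose[OF g o _ _ isw]) (auto simp: \<Omega>s_def)
  have Ds: "(inv_into S a \<circ> gs has_derivative mat2 B A E C) (at (0,0))"
  proof -
    have "(inv_into S a \<circ> g has_derivative mat2 A B C E) (at (prod.swap (0,0)))" using D by simp
    from diff_chain_at[OF dsw this] show ?thesis 
      by (simp only: mat2_comp gs_def o_assoc mult_zero_right mult_1_right add_0_left add_0_right)
  qed
  define g'' where "g'' = (\<lambda>z. if fst z = 0 then dir (B + A * snd z, E + C * snd z) else sig (gs (blow_down z)))"
  have 2: "param X' {z. blow_down z \<in> \<Omega>s} g'' \<and> (\<forall>z. blow_down z \<in> \<Omega>s \<longrightarrow> \<pi> (g'' z) = gs (blow_down z))"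
  proof (rule main[OF gs _ _ Ds _ g''_def])
    show "(0,0) \<in> \<Omega>s" using 0 by (simp add: \<Omega>s_def)
    show "gs (0,0) = p" using gp by (simp add: gs_def)
    show "B * C \<noteq> A * E" using det by simp
  qed
  show thesis
  proof (rule that[of g' g''])
    show "param X' {z. blow_down z \<in> \<Omega>} g'" using 1 by simp
    show "\<pi> (g' z) = g (blow_down z)" if "blow_down z \<in> \<Omega>" for z using 1 that by blast
    show "param X' {z. prod.swap (blow_down z) \<in> \<Omega>} g''" using 2 by (simp add: \<Omega>s_def)
    show "\<pi> (g'' z) = g (prod.swap (blow_down z))" if "prod.swap (blow_down z) \<in> \<Omega>" for z
    proof -
      have "blow_down z \<in> \<Omega>s" using that by (simp add: \<Omega>s_def)
      then have "\<pi> (g'' z) = gs (blow_down z)" using 2 by blast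
      then show ?thesis by (simp only: gs_def o_apply)
    qed
    fix q assume q: "q \<in> pts X'" "\<pi> q = p"
    obtain v where v: "v \<noteq> (0,0)" "q = dir v" using dir_exc[OF q] by blast
    define d where "d = A * E - B * C"
    have d: "d \<noteq> 0" using det by (simp add: d_def)
    \<comment> \<open>Cramer's rule: (x, y) is the direction in the coordinates of \<open>g\<close>
      that the derivative sends to \<open>v\<close>. For x = 0 it is the direction that only
      \<open>g''\<close> sees.\<close>
    define x y where "x = (E * fst v - B * snd v) / d" and "y = (A * snd v - C * fst v) / d"
    have xy: "A * x + B * y = fst v" "C * x + E * y = snd v"
    proof -
      have dx: "d * x = E * fst v - B * snd v" "d * y = A * snd v - C * fst v"
        using d by (simp_all add: x_def y_def)
      have "d * (A * x + B * y) = A * (d * x) + B * (d * y)" by (simp add: algebra_simps)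
      also have "\<dots> = d * fst v" unfolding dx by (simp add: d_def algebra_simps)
      finally show "A * x + B * y = fst v" using d by simp
      have "d * (C * x + E * y) = C * (d * x) + E * (d * y)" by (simp add: algebra_simps)
      also have "\<dots> = d * snd v" unfolding dx by (simp add: d_def algebra_simps)
      finally show "C * x + E * y = snd v" using d by simp
    qed
    show "q = g'' (0,0) \<or> (\<exists>w. q = g' (0, w))"
    proof (cases "x = 0")
      case True
      then have "v = cscale y (B, E)" using xy by (simp add: cscale_def prod_eq_iff mult.commute)
      moreover have "y \<noteq> 0" using True xy v(1) by (auto simp: prod_eq_iff)
      ultimately have "q = dir (B, E)" using v(2) dir_scale by simp
      then show ?thesis by (simp add: g''_def)
    next
      case False
      then have "v = cscale x (A + B * (y / x), C + E * (y / x))"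
        using xy by (simp add: cscale_def prod_eq_iff algebra_simps)
      then have "q = g' (0, y / x)" using v(2) dir_scale[OF False] by (simp add: g'_def)
      then show ?thesis by blast
    qed
  qed
qed

end

subsection \<open>Coordinates along the tower\<close>

text \<open>\<open>tcoord\<close> is \<open>t\<close> in terms of \<open>(\<zeta>, w)\<close>, with the centres collected in \<open>R\<close>, and \<open>tower_map\<close> is
  \<open>(u, v) = (t\<^sup>2 / (1 - \<zeta>), t\<^sup>3 / (1 - \<zeta>))\<close>. For \<open>m = 0\<close> and \<open>R = 0\<close> the coordinate \<open>w\<close> is \<open>t\<close> itself.\<close>

definition tcoord :: "complex poly \<Rightarrow> nat \<Rightarrow> complex \<times> complex \<Rightarrow> complex" where
  "tcoord R m z = poly R (fst z) + fst z ^ m * snd z"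

text \<open>On this set \<open>tower_map\<close> has a nonzero denominator and both its coordinates
  are nonzero, which is where \<zeta> and t can be recovered from u and v.\<close>

definition tower_dom :: "complex poly \<Rightarrow> nat \<Rightarrow> (complex \<times> complex) set" where
  "tower_dom R m = {z. fst z \<noteq> 1 \<and> tcoord R m z \<noteq> 0}"

definition tower_map :: "complex poly \<Rightarrow> nat \<Rightarrow> complex \<times> complex \<Rightarrow> complex \<times> complex" where
  "tower_map R m z = (tcoord R m z ^ 2 / (1 - fst z), tcoord R m z ^ 3 / (1 - fst z))"

text \<open>The induction invariant. \<open>C\<close> is the curve whose proper transform is removed
  at the next blow-up: \<open>L0\<close> at stage 0, the last exceptional curve afterwards. Treating
  \<open>L0\<close> like an exceptional curve makes the first blow-up and the later ones the same
  step. \<open>G\<close> identifies the complement of \<open>L0\<close> with the complement of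
  \<open>C\<close>, and \<open>tower_map\<close> compares \<open>g\<close> with it.\<close>

definition tower_coords ::
    "nat \<Rightarrow> 'a atlas \<Rightarrow> 'a set \<Rightarrow> (complex \<times> complex \<Rightarrow> 'a) \<Rightarrow> complex poly \<Rightarrow> (complex \<times> complex \<Rightarrow> 'a) \<Rightarrow> bool" where
  "tower_coords m X C G R g \<longleftrightarrow> holo_atlas X \<and> closedin (surf_top X) C \<and>
     param X (- L0) G \<and> G ` (- L0) = pts X - C \<and> param X (tower_dom R m) g \<and>
     (\<forall>z\<in>tower_dom R m. g z \<in> C \<longleftrightarrow> fst z = 0) \<and> (\<forall>z\<in>tower_dom R m. fst z \<noteq> 0 \<longrightarrow> g z = G (tower_map R m z))"

text \<open>Blowing up at (0, c) replaces w by c + \<zeta> w, and \<zeta>^m (c + \<zeta> w) = c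
  \<zeta>^m + \<zeta>^(m+1) w: the centre becomes a coefficient of the polynomial and the exponent
  grows by one.\<close>

lemma tower_dom_blow_down:
  "(fst (blow_down z), c + snd (blow_down z)) \<in> tower_dom R m \<longleftrightarrow> z \<in> tower_dom (R + monom c m) (Suc m)"
  "tower_map R m (fst (blow_down z), c + snd (blow_down z)) = tower_map (R + monom c m) (Suc m) z"
proof -
  have "tcoord R m (fst (blow_down z), c + snd (blow_down z)) = tcoord (R + monom c m) (Suc m) z"
    by (simp add: tcoord_def blow_down_def poly_monom algebra_simps)
  then show "(fst (blow_down z), c + snd (blow_down z)) \<in> tower_dom R m \<longleftrightarrow> z \<in> tower_dom (R + monom c m) (Suc m)"
    "tower_map R m (fst (blow_down z), c + snd (blow_down z)) = tower_map (R + monom c m) (Suc m) z"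
    by (simp_all add: tower_dom_def tower_map_def blow_down_def)
qed

text \<open>In the coordinates of \<open>g\<close> the curve \<open>C\<close> is \<zeta> = 0, whose
  direction is the one missed by the lifted chart \<open>g'\<close>. Its proper transform therefore
  contains the origin of \<open>g''\<close> and avoids the image of \<open>g'\<close>, so that
  removing it leaves exactly the exceptional points seen by \<open>g'\<close>.\<close>

lemma (in blown) tower_coords_step:
  assumes T: "tower_coords m X C G R g" and c: "(0, c) \<in> tower_dom R m" and gp: "g (0, c) = p"
    and F_def: "F = proper_transform p X' \<pi> C"
  defines "R' \<equiv> R + monom c m"
  shows "\<exists>G' g'. tower_coords (Suc m) (restr X' (pts X' - F)) (exc_curve p X' \<pi> - F) G' R' g' \<and>
    exc_curve p X' \<pi> - F \<subseteq> g' ` (tower_dom R' (Suc m))"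
proof -
  have Ccl: "closedin (surf_top X) C" and G: "param X (- L0) G" "G ` (- L0) = pts X - C"
    and g: "param X (tower_dom R m) g" and gC: "\<And>z. z \<in> tower_dom R m \<Longrightarrow> g z \<in> C \<longleftrightarrow> fst z = 0"
    and gG: "\<And>z. z \<in> tower_dom R m \<Longrightarrow> fst z \<noteq> 0 \<Longrightarrow> g z = G (tower_map R m z)"
    using T unfolding tower_coords_def by blast+
  have pC: "p \<in> C" using gC[OF c] gp by simp
  define E' where "E' = exc_curve p X' \<pi> - F"
  have E': "q \<in> E' \<longleftrightarrow> q \<in> pts X' \<and> \<pi> q = p \<and> q \<notin> F" for q by (auto simp: E'_def exc_curve_def)
  define P where "P = pts X' \<inter> \<pi> -` (C - {p})"
  have F: "F = surf_top X' closure_of P" by (simp add: F_def proper_transform_def P_def)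
  define W where "W = pts X' - F"
  have W: "openin (surf_top X') W"
  proof -
    have "closedin (surf_top X') F" unfolding F by (rule closedin_closure_of)
    then show ?thesis by (simp add: W_def closedin_def topspace_surf_top[OF X'])
  qed
  have PF: "P \<subseteq> F"
    unfolding F by (rule closure_of_subset) (simp add: P_def topspace_surf_top[OF X'])
  have FC: "\<pi> q \<in> C" if "q \<in> F" for q
  proof -
    have "closedin (surf_top X') {q \<in> pts X'. \<pi> q \<in> C}"
      using closedin_continuous_map_preimage[OF pi Ccl] by (simp add: topspace_surf_top[OF X'])
    then have "F \<subseteq> {q \<in> pts X'. \<pi> q \<in> C}"
      unfolding F by (intro closure_of_minimal) (auto simp: P_def)
    then show ?thesis using that by blast
  qed
  \<comment> \<open>Translates the centre (0, c) to the origin, as \<open>lift\<close>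
    requires.\<close>
  define sh where "sh = (\<lambda>z::complex\<times>complex. (fst z, c + snd z))"
  define \<Omega> where "\<Omega> = {z. sh z \<in> tower_dom R m}"
  have ish: "immers sh z" for z
    unfolding sh_def by (rule immers_pairI[OF sdiff_fst sdiff_add[OF sdiff_const sdiff_snd]]) simp
  have "continuous_on UNIV sh" unfolding sh_def by (intro continuous_intros)
  then have "open (sh -` tower_dom R m)" using paramD(1)[OF g] by (intro open_vimage)
  then have o\<Omega>: "open \<Omega>" by (simp add: \<Omega>_def vimage_def)
  have gs: "param X \<Omega> (g \<circ> sh)"
    by (rule param_compose[OF g o\<Omega> _ _ ish]) (auto simp: \<Omega>_def sh_def inj_on_def prod_eq_iff)
  have 0: "(0,0) \<in> \<Omega>" using c by (simp add: \<Omega>_def sh_def)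
  have blow_down\<Omega>: "blow_down z \<in> \<Omega> \<longleftrightarrow> z \<in> tower_dom R' (Suc m)" for z
    using tower_dom_blow_down(1) by (simp add: \<Omega>_def sh_def R'_def)
  have gp0: "(g \<circ> sh) (0,0) = p" using gp by (simp add: sh_def)
  show ?thesis
  proof (rule lift[OF gs 0 gp0])
    fix g' g''
    assume g'0: "param X' {z. blow_down z \<in> \<Omega>} g'" and pg'0: "\<And>z. blow_down z \<in> \<Omega> \<Longrightarrow> \<pi> (g' z) = (g \<circ> sh) (blow_down z)"
      and g'': "param X' {z. prod.swap (blow_down z) \<in> \<Omega>} g''"
      and pg'': "\<And>z. prod.swap (blow_down z) \<in> \<Omega> \<Longrightarrow> \<pi> (g'' z) = (g \<circ> sh) (prod.swap (blow_down z))"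
      and exc: "\<And>q. q \<in> pts X' \<Longrightarrow> \<pi> q = p \<Longrightarrow> q = g'' (0,0) \<or> (\<exists>w. q = g' (0, w))"
    let ?\<Omega>' = "tower_dom R' (Suc m)"
    have g': "param X' ?\<Omega>' g'" using g'0 by (simp add: blow_down\<Omega>)
    have pg': "\<pi> (g' z) = g (sh (blow_down z))" if "z \<in> ?\<Omega>'" for z
      using pg'0 that by (simp add: blow_down\<Omega>)
    have shO: "sh (blow_down z) \<in> tower_dom R m" if "z \<in> ?\<Omega>'" for z
      using that unfolding blow_down\<Omega>[symmetric] by (simp add: \<Omega>_def)
    have shz: "sh (blow_down z) = (0, c)" if "fst z = 0" for z using that by (simp add: sh_def blow_down_def)
    \<comment> \<open>In the chart \<open>g'\<close>, lying above \<open>C\<close> means \<zeta> =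
      0, and all such points lie above the centre itself.\<close>
    have g'P: "g' z \<notin> P" if z: "z \<in> ?\<Omega>'" for z
    proof
      assume "g' z \<in> P"
      then have a: "\<pi> (g' z) \<in> C" "\<pi> (g' z) \<noteq> p" by (auto simp: P_def)
      then have "fst (sh (blow_down z)) = 0" using gC[OF shO[OF z]] pg'[OF z] by simp
      then have "fst z = 0" by (simp add: sh_def blow_down_def)
      then show False using a(2) pg'[OF z] shz gp by simp
    qed
    have g'F: "g' z \<notin> F" if "z \<in> ?\<Omega>'" for z
    proof -
      have "openin (surf_top X') (g' ` ?\<Omega>')"
        by (rule param_open_image[OF X' g' paramD(1)[OF g'] order_refl])
      moreover have "g' ` ?\<Omega>' \<inter> P = {}" using g'P by blast
      ultimately have "g' ` ?\<Omega>' \<inter> F = {}" unfolding F by (simp add: openin_Int_closure_of_eq_empty)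
      then show ?thesis using that by blast
    qed
    have infF: "g'' (0,0) \<in> F"
      unfolding F in_closure_of
    proof (intro conjI allI impI)
      have O: "(0,0) \<in> {z. prod.swap (blow_down z) \<in> \<Omega>}" using 0 by (simp add: blow_down_def)
      show "g'' (0,0) \<in> topspace (surf_top X')"
        using paramD(4)[OF g'' O] by (simp add: topspace_surf_top[OF X'])
      fix T assume T: "g'' (0,0) \<in> T \<and> openin (surf_top X') T"
      have "open {z \<in> {z. prod.swap (blow_down z) \<in> \<Omega>}. g'' z \<in> T}"
        by (rule param_open_vimage[OF X' g'']) (use T in blast)
      moreover have "(0,0) \<in> {z \<in> {z. prod.swap (blow_down z) \<in> \<Omega>}. g'' z \<in> T}" using T O by blast
      ultimately obtain e where e: "e > 0" "ball (0,0) e \<subseteq> {z \<in> {z. prod.swap (blow_down z) \<in> \<Omega>}. g'' z \<in> T}"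
        unfolding open_contains_ball by blast
      \<comment> \<open>The first coordinate of \<open>g''\<close> runs along \<open>C\<close>:
        after the swap and the translation this is (0, c + e/2), a point of \<open>C\<close> other
        than the centre and as close to it as desired.\<close>
      define z :: "complex \<times> complex" where "z = (of_real (e/2), 0)"
      have "z \<in> ball (0,0) e" using e(1) by (simp add: z_def dist_Pair_Pair)
      then have z: "prod.swap (blow_down z) \<in> \<Omega>" "g'' z \<in> T" using e(2) by auto
      have sz: "sh (prod.swap (blow_down z)) = (0, c + of_real (e/2))" by (simp add: z_def blow_down_def sh_def)
      have szO: "sh (prod.swap (blow_down z)) \<in> tower_dom R m" using z(1) by (simp add: \<Omega>_def)
      have "\<pi> (g'' z) = g (sh (prod.swap (blow_down z)))" using pg''[OF z(1)] by simp
      moreover have "g (sh (prod.swap (blow_down z))) \<in> C" using gC[OF szO] sz by simp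
      moreover have "g (sh (prod.swap (blow_down z))) \<noteq> g (0, c)"
        using inj_onD[OF paramD(2)[OF g] _ szO c] sz e(1) by auto
      moreover have "g'' z \<in> pts X'" by (rule paramD(4)[OF g'']) (use z in simp)
      ultimately have "g'' z \<in> P" using gp by (simp add: P_def)
      then show "\<exists>y. y \<in> P \<and> y \<in> T" using z(2) by blast
    qed
    have E'g': "E' \<subseteq> g' ` ?\<Omega>'"
    proof
      fix q assume "q \<in> E'"
      then have q: "q \<in> pts X'" "\<pi> q = p" "q \<notin> F" by (simp_all add: E')
      then obtain w where w: "q = g' (0, w)" using exc[OF q(1,2)] infF by blast
      have "(0, w) \<in> ?\<Omega>'" unfolding blow_down\<Omega>[symmetric] using 0 by (simp add: blow_down_def)
      then show "q \<in> g' ` ?\<Omega>'" using w by blast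
    qed
    have pV: "pts (restr X' W) = W" by (auto simp: W_def)
    have V: "holo_atlas (restr X' W)" by (rule holo_atlas_restr[OF X' W])
    have sigG: "param X' (- L0) (sig \<circ> G)"
      by (rule param_sig[OF G(1)]) (use G(2) pC in blast)
    have sigGW: "(sig \<circ> G) ` (- L0) = W - E'"
    proof
      show "(sig \<circ> G) ` (- L0) \<subseteq> W - E'"
      proof clarify
        fix x assume "x \<notin> L0"
        then have "G x \<in> pts X - C" using G(2) by blast
        then have q: "G x \<in> pts X" "G x \<notin> C" "G x \<noteq> p" using pC by auto
        then have "\<pi> (sig (G x)) = G x" "sig (G x) \<in> pts X'" by (simp_all add: pi_sig sig_pts)
        then show "(sig \<circ> G) x \<in> W - E'" using q FC[of "sig (G x)"] by (auto simp: W_def E')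
      qed
      show "W - E' \<subseteq> (sig \<circ> G) ` (- L0)"
      proof
        fix q assume "q \<in> W - E'"
        then have q: "q \<in> pts X'" "q \<notin> F" "\<pi> q \<noteq> p" by (auto simp: W_def E')
        \<comment> \<open>Otherwise \<open>q\<close> would lie in \<open>P\<close>, hence in the
          removed closure.\<close>
        then have "\<pi> q \<notin> C" using PF by (auto simp: P_def)
        then have "\<pi> q \<in> G ` (- L0)" using G(2) pi_pts[OF q(1)] by simp
        then obtain x where "x \<in> - L0" "\<pi> q = G x" by blast
        then show "q \<in> (sig \<circ> G) ` (- L0)" using sig_pi[OF q(1,3)] by force
      qed
    qed
    have "tower_coords (Suc m) (restr X' W) E' (sig \<circ> G) R' g'"
      unfolding tower_coords_def pV
    proof (intro conjI ballI impI)
      show "holo_atlas (restr X' W)" by fact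
      have "openin (surf_top (restr X' W)) (W - E')"
      proof -
        have "W - E' = W \<inter> (pts X' - \<pi> -` {p})" by (auto simp: W_def E')
        then show ?thesis using openin_Int[OF W open_off'] by (simp add: openin_restr[OF X' W])
      qed
      moreover have "E' \<subseteq> W" by (auto simp: W_def E')
      ultimately show "closedin (surf_top (restr X' W)) E'"
        by (simp only: closedin_def topspace_surf_top[OF V] pV)
      show "param (restr X' W) (- L0) (sig \<circ> G)"
        unfolding param_restr[OF X' W] using sigG sigGW by blast
      show "(sig \<circ> G) ` (- L0) = W - E'" by fact
      show "param (restr X' W) ?\<Omega>' g'"
        unfolding param_restr[OF X' W] using g' g'F paramD(4)[OF g'] by (auto simp: W_def)
      fix z assume z: "z \<in> ?\<Omega>'"
      have pz: "\<pi> (g' z) = p \<longleftrightarrow> fst z = 0"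
      proof
        assume "\<pi> (g' z) = p"
        then have "g (sh (blow_down z)) = g (0, c)" using pg'[OF z] gp by simp
        from inj_onD[OF paramD(2)[OF g] this shO[OF z] c] show "fst z = 0" by (simp add: sh_def blow_down_def)
      next
        assume "fst z = 0"
        then show "\<pi> (g' z) = p" using pg'[OF z] shz gp by simp
      qed
      show "g' z \<in> E' \<longleftrightarrow> fst z = 0" using pz g'F[OF z] paramD(4)[OF g' z] by (simp add: E')
      assume "fst z \<noteq> 0"
      then have "g' z = sig (\<pi> (g' z))" using sig_pi[OF paramD(4)[OF g' z]] pz by simp
      also have "\<dots> = sig (G (tower_map R m (sh (blow_down z))))"
        using pg'[OF z] gG[OF shO[OF z]] \<open>fst z \<noteq> 0\<close> by (simp add: sh_def blow_down_def)
      also have "tower_map R m (sh (blow_down z)) = tower_map R' (Suc m) z"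
        using tower_dom_blow_down(2) by (simp add: sh_def R'_def)
      finally show "g' z = (sig \<circ> G) (tower_map R' (Suc m) z)" by simp
    qed
    then show ?thesis using E'g' unfolding E'_def W_def by blast
  qed
qed

section \<open>The base of the tower and the induction\<close>

lemma closed_L0: "closed L0"
proof -
  have "L0 = {z. fst z ^ 3 - snd z ^ 2 = 0}" by (auto simp: L0_def)
  moreover have "closed {z::complex\<times>complex. fst z ^ 3 - snd z ^ 2 = 0}"
    by (intro closed_Collect_eq continuous_intros)
  ultimately show ?thesis by simp
qed

text \<open>\<rho> recovers (\<zeta>, t) from (u, v). It is holomorphic where u is nonzero, so
  \<open>tower_map 0 0\<close> is injective and immersive on its domain.\<close>

lemma tower_coords_base: "tower_coords 0 C2 L0 (\<lambda>z. z) 0 (tower_map 0 0)"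
  unfolding tower_coords_def
proof (intro conjI ballI impI)
  show "holo_atlas C2" by (rule holo_atlas_C2)
  show "closedin (surf_top C2) L0"
    unfolding closedin_def topspace_surf_top[OF holo_atlas_C2] openin_C2 pts_C2
    using open_Compl[OF closed_L0] unfolding Compl_eq_Diff_UNIV by blast
  show "param C2 (- L0) (\<lambda>z. z)" 
    unfolding param_def pimm_C2 by (intro conjI ballI immers_ident open_Compl closed_L0) simp
  show "(\<lambda>z. z) ` (- L0) = pts C2 - L0" by auto
  have Om0: "tower_dom 0 0 = {z. fst z \<noteq> 1 \<and> snd z \<noteq> 0}" by (simp add: tower_dom_def tcoord_def)
  have Gam0: "tower_map 0 0 z = (snd z ^ 2 / (1 - fst z), snd z ^ 3 / (1 - fst z))" for z
    by (simp add: tower_map_def tcoord_def)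
  define \<rho> :: "complex \<times> complex \<Rightarrow> complex \<times> complex" where
    "\<rho> = (\<lambda>z. (1 - snd z ^ 2 / fst z ^ 3, snd z / fst z))"
  have \<rho>: "\<rho> (tower_map 0 0 z) = z" if "z \<in> tower_dom 0 0" for z
  proof -
    have "(w ^ 3 / s) ^ 2 / (w ^ 2 / s) ^ 3 = s" "(w ^ 3 / s) / (w ^ 2 / s) = w"
      if "w \<noteq> 0" "s \<noteq> 0" for w s :: complex
      using that by (simp_all add: power_divide power2_eq_square power3_eq_cube)
    from this[of "snd z" "1 - fst z"] show ?thesis
      using that by (simp add: Om0 Gam0 \<rho>_def prod_eq_iff)
  qed
  have oO: "open (tower_dom 0 0)"
    unfolding Om0 by (intro open_Collect_conj open_Collect_neq continuous_intros)
  have i: "immers (tower_map 0 0) z" if z: "z \<in> tower_dom 0 0" for z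
  proof (rule immers_left_inverse[where g=\<rho>])
    show "cdiff2 (tower_map 0 0) z"
      unfolding Gam0[abs_def] by (intro cdiff2_pairI sdf_intros sdf_power) (use z in \<open>auto simp: Om0\<close>)
    show "cdiff2 \<rho> (tower_map 0 0 z)"
      unfolding \<rho>_def by (intro cdiff2_pairI sdf_intros sdf_power) (use z in \<open>auto simp: Om0 Gam0\<close>)
    show "eventually (\<lambda>y. \<rho> (tower_map 0 0 y) = y) (nhds z)"
      using eventually_nhds_in_open[OF oO z] by eventually_elim (rule \<rho>)
  qed
  show "param C2 (tower_dom 0 0) (tower_map 0 0)"
    unfolding param_def pimm_C2 using oO i inj_on_inverseI[of "tower_dom 0 0" \<rho>] \<rho> by blast
  fix z assume z: "z \<in> tower_dom 0 0"
  define s where "s = 1 - fst z"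
  have s: "s \<noteq> 0" using z by (simp add: Om0 s_def)
  \<comment> \<open>This is u^3 - v^2 with s = 1 - \<zeta>; as t is nonzero on the domain, it
    vanishes exactly for \<zeta> = 0.\<close>
  have "(snd z ^ 2 / s) ^ 3 - (snd z ^ 3 / s) ^ 2 = snd z ^ 6 * (1 - s) / s ^ 3"
    using s by (simp add: field_simps power2_eq_square power3_eq_cube eval_nat_numeral)
  then have "(snd z ^ 2 / s) ^ 3 - (snd z ^ 3 / s) ^ 2 = 0 \<longleftrightarrow> s = 1"
    using z s by (auto simp only: Om0 mem_Collect_eq divide_eq_0_iff mult_eq_0_iff power_eq_0_iff right_minus_eq)
  then show "tower_map 0 0 z \<in> L0 \<longleftrightarrow> fst z = 0"
    by (simp add: Gam0 L0_def s_def)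
  show "tower_map 0 0 z = tower_map 0 0 z" ..
qed

text \<open>That \<open>E\<close> lies in the image of \<open>g\<close> makes every point of
  \<open>E\<close> available as the next centre. The first centre contributes the constant term 1 to
  \<open>R\<close> and every later one a term of positive degree; for the latter the induction
  carries \<open>m \<ge> 1\<close>.\<close>

lemma V_surface_coords:
  assumes "V_surface m V E"
  shows "m \<ge> 1 \<and> (\<exists>G R g. tower_coords m V E G R g \<and> E \<subseteq> g ` tower_dom R m \<and> poly R 0 \<noteq> 0)"
  using assms
proof induction
  case (first V' \<pi> L)
  interpret blown C2 "(1,1)" V' \<pi> by unfold_locales (rule first)
  have c: "(0, 1) \<in> tower_dom 0 0" by (simp add: tower_dom_def tcoord_def)
  have "tower_map 0 0 (0, 1) = (1, 1)" by (simp add: tower_map_def tcoord_def)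
  from tower_coords_step[OF tower_coords_base c this first(2)]
  show ?case by (force simp: poly_monom)
next
  case (step i V E p V' \<pi> F)
  then obtain G R g where T: "tower_coords i V E G R g" "E \<subseteq> g ` tower_dom R i" "poly R 0 \<noteq> 0" and i: "i \<ge> 1" by blast
  interpret blown V p V' \<pi> by unfold_locales (rule step)
  obtain z where z: "z \<in> tower_dom R i" "p = g z" using step T(2) by blast
  then have "fst z = 0" using T(1) step unfolding tower_coords_def by blast
  then have "z = (0, snd z)" by (simp add: prod_eq_iff)
  with z have "(0, snd z) \<in> tower_dom R i" "g (0, snd z) = p" by simp_all
  from tower_coords_step[OF T(1) this step(4)]
  obtain G' g' where "tower_coords (Suc i) (restr V' (pts V' - F)) (exc_curve p V' \<pi> - F) G' (R + monom (snd z) i) g'"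
    "exc_curve p V' \<pi> - F \<subseteq> g' ` tower_dom (R + monom (snd z) i) (Suc i)" by blast
  moreover have "poly (R + monom (snd z) i) 0 \<noteq> 0" using T(3) i by (cases i) (simp_all add: poly_monom)
  ultimately show ?case by (intro conjI) (simp, blast)
qed

subsection \<open>Interpolation and entire curves\<close>

text \<open>The difference quotient has a removable singularity at \<open>r\<close>. As it is
  defined on the whole plane, the identity holds for every z and not only near
  \<open>r\<close>.\<close>

lemma germ_divide:
  assumes "f analytic_on {r}"
  obtains d where "d analytic_on {r}" "\<And>z. f z = f r + (z - r) * d z"
proof -
  obtain S where S: "open S" "r \<in> S" "f holomorphic_on S" using assms unfolding analytic_at by blast
  define d where "d = (\<lambda>z. if z = r then deriv f r else (f z - f r) / (z - r))"
  have "d holomorphic_on S" unfolding d_def by (rule pole_lemma_open[OF S(3,1)])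
  then have "d analytic_on {r}" using S unfolding analytic_at by blast
  moreover have "f z = f r + (z - r) * d z" for z by (simp add: d_def)
  ultimately show thesis by (rule that)
qed

text \<open>Iterated division by z - r; the constants split off along the way form the
  polynomial.\<close>

lemma germ_taylor:
  assumes "f analytic_on {r}"
  shows "\<exists>q d. d analytic_on {r} \<and> (\<forall>z. f z = poly q z + (z - r) ^ N * d z)"
  using assms
proof (induction N arbitrary: f)
  case 0
  then show ?case by (intro exI[of _ 0] exI[of _ f]) simp
next
  case (Suc N)
  obtain f1 where f1: "f1 analytic_on {r}" "\<And>z. f z = f r + (z - r) * f1 z"
    using germ_divide[OF Suc.prems] by blast
  obtain q d where qd: "d analytic_on {r}" "\<And>z. f1 z = poly q z + (z - r) ^ N * d z"
    using Suc.IH[OF f1(1)] by blast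
  have "f z = poly ([:f r:] + [:- r, 1:] * q) z + (z - r) ^ Suc N * d z" for z
  proof -
    have "f z = f r + (z - r) * (poly q z + (z - r) ^ N * d z)" using f1(2)[of z] qd(2)[of z] by simp
    then show ?thesis by (simp add: algebra_simps)
  qed
  then show ?case using qd(1) by blast
qed

lemma analytic_poly: "poly p analytic_on {x}" for p :: "complex poly"
  by (intro holomorphic_on_imp_analytic_at[of _ UNIV]) (auto intro: poly_holomorphic_on)

text \<open>Newton's scheme: an interpolant for \<open>A\<close> is corrected at a new node
  \<open>r\<close> by a multiple of \<open>W\<close>, which vanishes to order \<open>N\<close> on
  \<open>A\<close> and not at \<open>r\<close>. The factor \<open>q\<close> is a Taylor polynomial
  at \<open>r\<close> of the remaining error divided by \<open>W\<close>.\<close>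

lemma hermite_interpolation:
  fixes A :: "complex set"
  assumes "finite A" "\<And>r. r \<in> A \<Longrightarrow> l r analytic_on {r}"
  shows "\<exists>\<mu>. \<forall>r\<in>A. \<exists>d. d analytic_on {r} \<and> (\<forall>\<^sub>F z in nhds r. poly \<mu> z = l r z + (z - r) ^ N * d z)"
  using assms
proof (induction A rule: finite_induct)
  case empty
  then show ?case by simp
next
  case (insert r A)
  obtain \<mu> where \<mu>: "\<forall>a\<in>A. \<exists>d. d analytic_on {a} \<and> (\<forall>\<^sub>F z in nhds a. poly \<mu> z = l a z + (z - a) ^ N * d z)"
    using insert by blast
  define W where "W = (\<Prod>a\<in>A. [:- a, 1:] ^ N)"
  have Wr: "poly W r \<noteq> 0" using insert.hyps by (auto simp: W_def poly_prod)
  have "(\<lambda>z. (l r z - poly \<mu> z) / poly W z) analytic_on {r}"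
    using Wr insert.prems by (intro analytic_on_divide analytic_on_diff analytic_poly) auto
  from germ_taylor[OF this, of N] obtain q d where qd: "d analytic_on {r}"
    "\<And>z. (l r z - poly \<mu> z) / poly W z = poly q z + (z - r) ^ N * d z" by blast
  have "\<exists>d. d analytic_on {a} \<and> (\<forall>\<^sub>F z in nhds a. poly (\<mu> + W * q) z = l a z + (z - a) ^ N * d z)"
    if a: "a \<in> insert r A" for a
  proof (cases "a = r")
    case True
    have "continuous_on UNIV (poly W)" by (intro continuous_intros)
    then have "open (poly W -` (- {0}))" by (intro open_vimage) auto
    then have "\<forall>\<^sub>F z in nhds r. z \<in> poly W -` (- {0})"
      by (rule eventually_nhds_in_open) (use Wr in simp)
    then have "\<forall>\<^sub>F z in nhds r. poly (\<mu> + W * q) z = l r z + (z - r) ^ N * - (poly W z * d z)"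
    proof eventually_elim
      case (elim z)
      then have "l r z - poly \<mu> z = poly W z * (poly q z + (z - r) ^ N * d z)"
        using qd(2)[of z] by (simp add: field_simps)
      then show ?case by (simp add: algebra_simps)
    qed
    moreover have "(\<lambda>z. - (poly W z * d z)) analytic_on {r}"
      using qd(1) by (intro analytic_on_neg analytic_on_mult analytic_poly)
    ultimately show ?thesis using True by blast
  next
    case False
    then have aA: "a \<in> A" using a by simp
    then obtain d' where d': "d' analytic_on {a}" "\<forall>\<^sub>F z in nhds a. poly \<mu> z = l a z + (z - a) ^ N * d' z"
      using \<mu> by blast
    \<comment> \<open>Splitting off the factor of \<open>W\<close> belonging to \<open>a\<close>
      shows that the correction respects the old congruence at \<open>a\<close>.\<close>
    define W' where "W' = (\<Prod>a\<in>A - {a}. [:- a, 1:] ^ N)"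
    have "W = [:- a, 1:] ^ N * W'"
      unfolding W_def W'_def using prod.remove[OF insert.hyps(1) aA] by blast
    then have Wz: "poly W z = (z - a) ^ N * poly W' z" for z by simp
    have "\<forall>\<^sub>F z in nhds a. poly (\<mu> + W * q) z = l a z + (z - a) ^ N * (d' z + poly (W' * q) z)"
      using d'(2) by eventually_elim (simp add: Wz algebra_simps)
    moreover have "(\<lambda>z. d' z + poly (W' * q) z) analytic_on {a}"
      using d'(1) by (intro analytic_on_add analytic_poly)
    ultimately show ?thesis by blast
  qed
  then show ?case by blast
qed

text \<open>(exp w - 1) / w extends to an entire function. So a zero of the exponent of given order
  is passed on to the difference between the exponential and 1.\<close>

lemma exp_minus_1_germ:
  assumes "f analytic_on {r}"
  obtains e where "e analytic_on {r}" "\<And>z. exp (f z) = 1 + f z * e z"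
proof -
  define E where "E = (\<lambda>w::complex. if w = 0 then deriv exp 0 else (exp w - exp 0) / (w - 0))"
  have "E holomorphic_on UNIV" unfolding E_def by (rule pole_lemma_open) (auto intro: holomorphic_intros)
  then have "E analytic_on UNIV" by (simp add: analytic_on_open)
  then have "(\<lambda>z. E (f z)) analytic_on {r}"
    using analytic_on_compose_gen[OF assms, of E UNIV] by (simp add: o_def)
  moreover have "exp (f z) = 1 + f z * E (f z)" for z by (simp add: E_def)
  ultimately show thesis by (rule that)
qed

text \<open>Dividing by the value at \<open>r\<close> brings the argument to 1, away from the branch
  cut of \<open>Ln\<close>; the logarithm of that value is added back.\<close>

lemma log_germ:
  fixes f :: "complex \<Rightarrow> complex"
  assumes "f analytic_on {r}" "f r \<noteq> 0"
  obtains l where "l analytic_on {r}" "\<forall>\<^sub>F z in nhds r. exp (l z) = f z"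
proof -
  define l where "l = (\<lambda>z. Ln (f z / f r) + Ln (f r))"
  have "(\<lambda>z. f z / f r) analytic_on {r}" using assms by (intro analytic_on_divide analytic_on_const) auto
  then have l: "l analytic_on {r}"
    unfolding l_def using assms(2) by (intro analytic_on_add analytic_on_const analytic_on_ln) auto
  have "isCont f r" using assms(1) analytic_on_imp_differentiable_at field_differentiable_imp_continuous_at by blast
  moreover have "\<forall>\<^sub>F y in nhds (f r). y \<in> - {0}"
    by (rule eventually_nhds_in_open) (use assms(2) in auto)
  ultimately have "\<forall>\<^sub>F z in nhds r. f z \<in> - {0}"
    by (rule eventually_isCont)
  then have "\<forall>\<^sub>F z in nhds r. exp (l z) = f z"
    by eventually_elim (use assms(2) in \<open>simp add: l_def exp_add\<close>)
  with l show thesis by (rule that)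
qed

text \<open>A common zero of \<alpha> and \<beta> is a zero of v0 \<alpha> - u0 \<beta>, whose
  constant term cancels. The quadratic coefficients do not affect the 1-jet and are chosen so that
  this combination vanishes only at 0, where \<alpha> and \<beta> are not both zero.\<close>

lemma coprime_quadratics:
  fixes u0 v0 u1 v1 :: complex
  assumes "(u0, v0) \<noteq> (0, 0)"
  obtains \<alpha> \<beta> where "poly \<alpha> 0 = u0" "poly \<beta> 0 = v0" "poly (pderiv \<alpha>) 0 = u1" "poly (pderiv \<beta>) 0 = v1"
    "\<And>x. poly \<alpha> x = 0 \<Longrightarrow> poly \<beta> x \<noteq> 0"
proof -
  have "\<exists>a b. \<forall>x. x * ((v0 * u1 - u0 * v1) + x * (v0 * a - u0 * b)) = 0 \<longrightarrow> x = 0"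
  proof (cases "v0 * u1 - u0 * v1 = 0")
    case False
    then show ?thesis by (intro exI[of _ 0]) simp
  next
    case True
    \<comment> \<open>The linear coefficient is zero in this case, and conjugates make the quadratic
      one the positive number |v0|^2 + |u0|^2.\<close>
    have "v0 * cnj v0 - u0 * - cnj u0 = of_real ((cmod v0)\<^sup>2 + (cmod u0)\<^sup>2)"
      by (simp add: complex_norm_square flip: of_real_power)
    also have "\<dots> \<noteq> 0"
      using assms unfolding of_real_eq_0_iff by (subst add_nonneg_eq_0_iff) auto
    finally show ?thesis using True by (intro exI[of _ "cnj v0"] exI[of _ "- cnj u0"]) simp
  qed
  then obtain a b where ab: "\<And>x. x * ((v0 * u1 - u0 * v1) + x * (v0 * a - u0 * b)) = 0 \<Longrightarrow> x = 0" by blast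
  have "poly [:v0, v1, b:] x \<noteq> 0" if "poly [:u0, u1, a:] x = 0" for x
  proof
    assume "poly [:v0, v1, b:] x = 0"
    then have "v0 * poly [:u0, u1, a:] x - u0 * poly [:v0, v1, b:] x = 0" using that by simp
    then have "x = 0" by (rule_tac ab) (simp add: algebra_simps)
    then show False using that \<open>poly [:v0, v1, b:] x = 0\<close> assms by simp
  qed
  then show thesis by (intro that[of "[:u0, u1, a:]" "[:v0, v1, b:]"]) (simp_all add: pderiv_pCons)
qed

section \<open>Entire curves given by local parametrisations\<close>

lemma curve_chart_deriv:
  assumes k: "(\<phi> \<circ> k has_derivative mat2 A B C E) (at (x s))"
    and x1: "((\<lambda>\<xi>. fst (x \<xi>)) has_field_derivative x1) (at s)"
    and x2: "((\<lambda>\<xi>. snd (x \<xi>)) has_field_derivative x2) (at s)"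
    and h: "\<forall>\<^sub>F \<xi> in nhds s. h \<xi> = k (x \<xi>)"
  shows "((\<lambda>\<xi>. fst (\<phi> (h \<xi>))) has_field_derivative fst (mat2 A B C E (x1, x2))) (at s)"
    and "((\<lambda>\<xi>. snd (\<phi> (h \<xi>))) has_field_derivative snd (mat2 A B C E (x1, x2))) (at s)"
proof -
  have "(x has_derivative (\<lambda>t. (x1 * t, x2 * t))) (at s)"
    using has_derivative_Pair[OF x1[unfolded has_field_derivative_def] x2[unfolded has_field_derivative_def]]
    by simp
  from diff_chain_at[OF this k]
  have "((\<phi> \<circ> k \<circ> x) has_derivative (\<lambda>t. (fst (mat2 A B C E (x1, x2)) * t, snd (mat2 A B C E (x1, x2)) * t))) (at s)"
    by (simp add: o_def mat2_def algebra_simps)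
  moreover have "\<forall>\<^sub>F \<xi> in nhds s. (\<phi> \<circ> k \<circ> x) \<xi> = \<phi> (h \<xi>)"
    using h by eventually_elim simp
  ultimately have "((\<lambda>\<xi>. \<phi> (h \<xi>)) has_derivative (\<lambda>t. (fst (mat2 A B C E (x1, x2)) * t, snd (mat2 A B C E (x1, x2)) * t))) (at s)"
    by (rule iffD1[OF has_derivative_cong_ev, rotated])
  from has_derivative_fst[OF this] has_derivative_snd[OF this]
  show "((\<lambda>\<xi>. fst (\<phi> (h \<xi>))) has_field_derivative fst (mat2 A B C E (x1, x2))) (at s)"
    "((\<lambda>\<xi>. snd (\<phi> (h \<xi>))) has_field_derivative snd (mat2 A B C E (x1, x2))) (at s)"
    by (simp_all add: has_field_derivative_def)
qed

text \<open>Complex differentiability of \<open>h\<close> at \<open>s\<close>, certified by a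
  factorisation through a pointwise immersion \<open>k\<close>. Since \<open>k\<close> may vary with
  \<open>s\<close>, one curve can be described by \<open>G\<close> off the last exceptional curve
  and by \<open>g\<close> near it.\<close>

definition curve_at :: "'a atlas \<Rightarrow> (complex \<Rightarrow> 'a) \<Rightarrow> complex \<Rightarrow> bool" where
  "curve_at X h s \<longleftrightarrow> (\<exists>k x x1 x2. pimm X k (x s) \<and> ((\<lambda>\<xi>. fst (x \<xi>)) has_field_derivative x1) (at s) \<and>
     ((\<lambda>\<xi>. snd (x \<xi>)) has_field_derivative x2) (at s) \<and> (\<forall>\<^sub>F \<xi> in nhds s. h \<xi> = k (x \<xi>)))"

lemma curve_atI:
  assumes "pimm X k (x1 s, x2 s)" "x1 analytic_on {s}" "x2 analytic_on {s}"
    "\<forall>\<^sub>F \<xi> in nhds s. h \<xi> = k (x1 \<xi>, x2 \<xi>)"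
  shows "curve_at X h s"
proof -
  obtain d1 where d1: "(x1 has_field_derivative d1) (at s)"
    using analytic_on_imp_differentiable_at[OF assms(2)] unfolding field_differentiable_def by blast
  obtain d2 where d2: "(x2 has_field_derivative d2) (at s)"
    using analytic_on_imp_differentiable_at[OF assms(3)] unfolding field_differentiable_def by blast
  show ?thesis
    unfolding curve_at_def
    by (rule exI[of _ k], rule exI[of _ "\<lambda>\<xi>. (x1 \<xi>, x2 \<xi>)"], rule exI[of _ d1], rule exI[of _ d2])
      (simp add: assms(1,4) d1 d2)
qed

text \<open>Continuity of \<open>k\<close> and \<open>x\<close> at each point makes preimages of
  open sets open, and on an open set complex differentiability at every point is holomorphy.\<close>

lemma entire_curveI:
  assumes X: "holo_atlas X" and h: "\<And>s. curve_at X h s"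
  shows "entire_curve X h"
proof -
  have ev: "\<forall>\<^sub>F \<xi> in nhds s. h \<xi> \<in> A" if A: "openin (surf_top X) A" "h s \<in> A" for A s
  proof -
    obtain k x x1 x2 where k: "pimm X k (x s)" and x1: "((\<lambda>\<xi>. fst (x \<xi>)) has_field_derivative x1) (at s)"
      and x2: "((\<lambda>\<xi>. snd (x \<xi>)) has_field_derivative x2) (at s)" and hk: "\<forall>\<^sub>F \<xi> in nhds s. h \<xi> = k (x \<xi>)"
      using h[of s] unfolding curve_at_def by blast
    have "k (x s) \<in> A" using eventually_nhds_x_imp_x[OF hk] A(2) by simp
    from pimm_eventually[OF X k A(1) this] have "\<forall>\<^sub>F y in nhds (x s). k y \<in> A" .
    moreover have "isCont x s"
    proof -
      have "isCont (\<lambda>\<xi>. (fst (x \<xi>), snd (x \<xi>))) s"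
        by (intro isCont_Pair DERIV_isCont[OF x1] DERIV_isCont[OF x2])
      then show ?thesis by simp
    qed
    ultimately have "\<forall>\<^sub>F \<xi> in nhds s. k (x \<xi>) \<in> A"
      by (rule eventually_isCont[where f=x and P="\<lambda>y. k y \<in> A", rotated])
    then show ?thesis using hk by eventually_elim simp
  qed
  have op: "open (h -` A)" if A: "openin (surf_top X) A" for A
    unfolding open_subopen[of "h -` A"]
  proof
    fix s assume "s \<in> h -` A"
    then have "\<forall>\<^sub>F \<xi> in nhds s. h \<xi> \<in> A" by (intro ev[OF A]) simp
    then obtain T where "open T" "s \<in> T" "\<forall>\<xi>\<in>T. h \<xi> \<in> A" unfolding eventually_nhds by blast
    then show "\<exists>T. open T \<and> s \<in> T \<and> T \<subseteq> h -` A" by blast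
  qed
  have hp: "h s \<in> pts X" for s
  proof -
    obtain k x where k: "pimm X k (x s)" and hk: "\<forall>\<^sub>F \<xi> in nhds s. h \<xi> = k (x \<xi>)"
      using h[of s] unfolding curve_at_def by blast
    show ?thesis using eventually_nhds_x_imp_x[OF hk] pimmD(1)[OF k] by simp
  qed
  have "continuous_map euclidean (surf_top X) h"
    unfolding continuous_map_def
  proof (intro conjI allI impI)
    show "h \<in> topspace euclidean \<rightarrow> topspace (surf_top X)" using hp by (simp add: topspace_surf_top[OF X])
    fix A assume "openin (surf_top X) A"
    from op[OF this] show "openin euclidean {x \<in> topspace euclidean. h x \<in> A}" by (simp add: vimage_def)
  qed
  moreover have "(\<lambda>\<xi>. fst (\<phi> (h \<xi>))) holomorphic_on (h -` U) \<and> (\<lambda>\<xi>. snd (\<phi> (h \<xi>))) holomorphic_on (h -` U)"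
    if c: "(U, \<phi>) \<in> X" for U \<phi>
  proof -
    have "(\<lambda>\<xi>. fst (\<phi> (h \<xi>))) field_differentiable at s within h -` U \<and>
      (\<lambda>\<xi>. snd (\<phi> (h \<xi>))) field_differentiable at s within h -` U" if s: "h s \<in> U" for s
    proof -
      obtain k x x1 x2 where k: "pimm X k (x s)" and x1: "((\<lambda>\<xi>. fst (x \<xi>)) has_field_derivative x1) (at s)"
        and x2: "((\<lambda>\<xi>. snd (x \<xi>)) has_field_derivative x2) (at s)" and hk: "\<forall>\<^sub>F \<xi> in nhds s. h \<xi> = k (x \<xi>)"
        using h[of s] unfolding curve_at_def by blast
      have "k (x s) \<in> U" using eventually_nhds_x_imp_x[OF hk] s by simp
      from pimmD(3)[OF k c this] obtain A B C E where "(\<phi> \<circ> k has_derivative mat2 A B C E) (at (x s))"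
        unfolding immers_def by blast
      from curve_chart_deriv[OF this x1 x2 hk] show ?thesis
        unfolding field_differentiable_def using has_field_derivative_at_within by blast
    qed
    then show ?thesis unfolding holomorphic_on_def by simp
  qed
  ultimately show ?thesis unfolding entire_curve_def by blast
qed

lemma eventually_poly_nonzero:
  fixes p :: "complex poly"
  assumes "poly p r \<noteq> 0"
  shows "\<forall>\<^sub>F z in nhds r. poly p z \<noteq> 0"
proof -
  have "\<forall>\<^sub>F y in nhds (poly p r). y \<in> - {0}"
    by (rule eventually_nhds_in_open) (use assms in auto)
  then have "\<forall>\<^sub>F z in nhds r. poly p z \<in> - {0}"
    by (rule eventually_isCont[rotated]) (rule poly_isCont)
  then show ?thesis by simp
qed

text \<open>With \<lambda> = exp \<mu>, the second coordinate of the lift near a root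
  \<open>r\<close> of \<open>p\<close> is w = (\<lambda> \<beta> / \<alpha> - R(\<zeta>)) /
  \<zeta>^m. This quotient is analytic once \<mu> agrees with a logarithm of \<alpha> R(\<zeta>) /
  \<beta> to at least the order of \<zeta>^m at \<open>r\<close>.\<close>

lemma rescaling_exists:
  fixes \<alpha> \<beta> R :: "complex poly" and m :: nat
  defines "p \<equiv> \<alpha> ^ 3 - \<beta> ^ 2"
  defines "\<zeta> \<equiv> \<lambda>z. poly p z / poly \<alpha> z ^ 3"
  assumes cop: "\<And>x. poly \<alpha> x = 0 \<Longrightarrow> poly \<beta> x \<noteq> 0" and p0: "poly p 0 \<noteq> 0" and R0: "poly R 0 \<noteq> 0"
  obtains \<mu> :: "complex poly" where "poly \<mu> 0 = 0" "poly (pderiv \<mu>) 0 = 0"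
    "\<And>r. poly p r = 0 \<Longrightarrow> \<exists>w. w analytic_on {r} \<and> (\<forall>\<^sub>F z in nhds r. poly \<alpha> z \<noteq> 0 \<and> poly \<beta> z \<noteq> 0 \<and>
       tcoord R m (\<zeta> z, w z) = exp (poly \<mu> z) * poly \<beta> z / poly \<alpha> z)"
proof -
  have pn0: "p \<noteq> 0" using p0 by auto
  \<comment> \<open>A root of \<open>p\<close> has order at most \<open>degree p\<close>, so
    \<zeta>^m vanishes there to order at most \<open>m * degree p\<close>. The extra 2 guarantees
    that \<mu> vanishes to second order at 0.\<close>
  define N where "N = m * degree p + 2"
  define Z where "Z = {r. poly p r = 0}"
  have finZ: "finite Z" unfolding Z_def using pn0 by (rule poly_roots_finite)
  have nz: "poly \<alpha> r \<noteq> 0" "poly \<beta> r \<noteq> 0" "\<zeta> r = 0" if "r \<in> Z" for r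
  proof -
    have "poly \<alpha> r ^ 3 = poly \<beta> r ^ 2" using that by (simp add: Z_def p_def)
    then show "poly \<alpha> r \<noteq> 0" "poly \<beta> r \<noteq> 0" using cop[of r] by auto
    show "\<zeta> r = 0" using that by (simp add: \<zeta>_def Z_def)
  qed
  have \<zeta>an: "\<zeta> analytic_on {r}" if "r \<in> Z" for r
    unfolding \<zeta>_def using nz[OF that] by (intro analytic_on_divide analytic_on_power analytic_poly) auto
  have R\<zeta>: "(\<lambda>z. poly R (\<zeta> z)) analytic_on {r}" if "r \<in> Z" for r
  proof -
    have "poly R analytic_on UNIV" by (simp add: analytic_on_open poly_holomorphic_on)
    from analytic_on_compose_gen[OF \<zeta>an[OF that] this] show ?thesis by (simp add: o_def)
  qed
  \<comment> \<open>The function that \<lambda> has to match near the roots. At a root \<zeta> is 0,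
    and \<open>R0\<close> makes \<open>f\<close> nonzero there, so a logarithm exists.\<close>
  define f where "f = (\<lambda>z. poly \<alpha> z * poly R (\<zeta> z) / poly \<beta> z)"
  have fan: "f analytic_on {r}" "f r \<noteq> 0" if "r \<in> Z" for r
  proof -
    show "f analytic_on {r}"
      unfolding f_def using nz[OF that] R\<zeta>[OF that] by (intro analytic_on_divide analytic_on_mult analytic_poly) auto
    show "f r \<noteq> 0" using nz[OF that] R0 by (simp add: f_def)
  qed
  have "\<forall>r\<in>Z. \<exists>l. l analytic_on {r} \<and> (\<forall>\<^sub>F z in nhds r. exp (l z) = f z)"
    using log_germ[OF fan] by metis
  then obtain l where l: "\<And>r. r \<in> Z \<Longrightarrow> l r analytic_on {r}" "\<And>r. r \<in> Z \<Longrightarrow> \<forall>\<^sub>F z in nhds r. exp (l r z) = f z"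
    unfolding bchoice_iff by blast
  \<comment> \<open>The node 0 with target 0 is added in order to keep the 1-jet of the curve; by
    \<open>p0\<close> it is not one of the roots.\<close>
  define l' where "l' = l(0 := \<lambda>z. 0)"
  have 0: "0 \<notin> Z" using p0 by (simp add: Z_def)
  have l'an: "l' r analytic_on {r}" if "r \<in> insert 0 Z" for r
    using that l(1)[of r] by (auto simp: l'_def)
  have fin: "finite (insert 0 Z)" using finZ by simp
  obtain \<mu> where "\<forall>r\<in>insert 0 Z.
      \<exists>d. d analytic_on {r} \<and> (\<forall>\<^sub>F z in nhds r. poly \<mu> z = l' r z + (z - r) ^ N * d z)"
    using hermite_interpolation[of "insert 0 Z" l' N, OF fin l'an] by blast
  then have \<mu>: "\<exists>d. d analytic_on {r} \<and> (\<forall>\<^sub>F z in nhds r. poly \<mu> z = l' r z + (z - r) ^ N * d z)"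
    if "r \<in> insert 0 Z" for r
    using that by (rule bspec)
  show thesis
  proof (rule that[of \<mu>])
    obtain d where d: "d analytic_on {0}" "\<forall>\<^sub>F z in nhds 0. poly \<mu> z = l' 0 z + (z - 0) ^ N * d z"
      using \<mu>[of 0] by auto
    have ev: "\<forall>\<^sub>F z in nhds 0. poly \<mu> z = z ^ N * d z" using d(2) by (simp add: l'_def)
    from eventually_nhds_x_imp_x[OF ev] show "poly \<mu> 0 = 0" by (simp add: N_def)
    obtain d' where d': "(d has_field_derivative d') (at 0)"
      using analytic_on_imp_differentiable_at[OF d(1)] unfolding field_differentiable_def by blast
    have "((\<lambda>z. z ^ N * d z) has_field_derivative 0) (at 0)"
      by (rule derivative_eq_intros d' refl | simp add: N_def)+
    moreover have "(poly \<mu> has_field_derivative poly (pderiv \<mu>) 0) (at 0)" by (rule poly_DERIV)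
    ultimately show "poly (pderiv \<mu>) 0 = 0"
      using DERIV_cong_ev[OF refl ev refl] DERIV_unique by blast
    fix r assume "poly p r = 0"
    then have r: "r \<in> Z" by (simp add: Z_def)
    then have "r \<noteq> 0" using 0 by blast
    obtain e where e: "e analytic_on {r}" "\<forall>\<^sub>F z in nhds r. poly \<mu> z = l r z + (z - r) ^ N * e z"
      using \<mu>[of r] r \<open>r \<noteq> 0\<close> by (auto simp: l'_def)
    have "(\<lambda>z. (z - r) ^ N * e z) analytic_on {r}"
      using e(1) by (intro analytic_on_mult analytic_on_power analytic_on_diff analytic_on_ident analytic_on_const)
    then obtain e' where e': "e' analytic_on {r}" "\<And>z. exp ((z - r) ^ N * e z) = 1 + (z - r) ^ N * e z * e' z"
      by (rule exp_minus_1_germ) (rule that)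
    define n where "n = order r p"
    obtain q where q: "p = [:- r, 1:] ^ n * q" "\<not> [:- r, 1:] dvd q"
      using order_decomp[OF pn0, of r] unfolding n_def by blast
    have qr: "poly q r \<noteq> 0" using q(2) by (simp add: poly_eq_0_iff_dvd)
    have pz: "poly p z = (z - r) ^ n * poly q z" for z by (simp add: q(1))
    have "m * n \<le> m * degree p" using order_degree[OF pn0, of r] by (simp add: n_def)
    then have "m * n \<le> N" unfolding N_def by (rule trans_le_add1)
    then have "n * m \<le> N" by (simp only: mult.commute)
    \<comment> \<open>Since \<lambda> \<beta> / \<alpha> = R(\<zeta>) (1 + (z - r)^N e e'), this is
      R(\<zeta>) (z - r)^N e e' divided by \<zeta>^m = (z - r)^(n m) q^m / \<alpha>^(3 m). The bound
      \<open>n * m \<le> N\<close> excludes a pole.\<close>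
    define w where "w = (\<lambda>z. poly R (\<zeta> z) * (z - r) ^ (N - n * m) * e z * e' z * (poly \<alpha> z ^ 3) ^ m / poly q z ^ m)"
    have "w analytic_on {r}"
      unfolding w_def using R\<zeta>[OF r] e(1) e'(1) qr
      by (intro analytic_on_divide analytic_on_mult analytic_on_power analytic_on_diff analytic_on_ident analytic_on_const analytic_poly)
        auto
    moreover have "\<forall>\<^sub>F z in nhds r. poly \<alpha> z \<noteq> 0 \<and> poly \<beta> z \<noteq> 0 \<and>
       tcoord R m (\<zeta> z, w z) = exp (poly \<mu> z) * poly \<beta> z / poly \<alpha> z"
      using eventually_poly_nonzero[OF nz(1)[OF r]] eventually_poly_nonzero[OF nz(2)[OF r]]
        eventually_poly_nonzero[OF qr] e(2) l(2)[OF r]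
    proof eventually_elim
      case (elim z)
      have "exp (poly \<mu> z) = f z * (1 + (z - r) ^ N * e z * e' z)"
        using elim e'(2)[of z] by (simp add: exp_add)
      then have 1: "exp (poly \<mu> z) * poly \<beta> z / poly \<alpha> z = poly R (\<zeta> z) * (1 + (z - r) ^ N * e z * e' z)"
        using elim by (simp add: f_def)
      have "\<zeta> z ^ m = (z - r) ^ (n * m) * poly q z ^ m / (poly \<alpha> z ^ 3) ^ m"
        unfolding \<zeta>_def pz by (simp only: power_mult power_divide power_mult_distrib)
      then have "\<zeta> z ^ m * w z = (z - r) ^ (n * m) * (z - r) ^ (N - n * m) * (poly R (\<zeta> z) * e z * e' z)"
        using elim by (simp add: w_def)
      also have "(z - r) ^ (n * m) * (z - r) ^ (N - n * m) = (z - r) ^ N"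
        using \<open>n * m \<le> N\<close> by (simp flip: power_add)
      finally have "\<zeta> z ^ m * w z = (z - r) ^ N * (poly R (\<zeta> z) * e z * e' z)" .
      then show ?case using elim 1 by (simp add: tcoord_def algebra_simps)
    qed
    ultimately show "\<exists>w. w analytic_on {r} \<and> (\<forall>\<^sub>F z in nhds r. poly \<alpha> z \<noteq> 0 \<and> poly \<beta> z \<noteq> 0 \<and>
       tcoord R m (\<zeta> z, w z) = exp (poly \<mu> z) * poly \<beta> z / poly \<alpha> z)" by blast
  qed
qed

text \<open>\<open>G\<close> carries the rescaled polynomial curve wherever it avoids
  \<open>L0\<close>, and \<open>g\<close> continues it across the roots of \<open>p\<close>. As 0 is
  not a root, the 1-jet at 0 can be computed in the plane.\<close>

lemma tower_curve:
  assumes T: "tower_coords m V E G R g" and R0: "poly R 0 \<noteq> 0" and uv: "(u0, v0) \<notin> L0"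
  obtains h x where "entire_curve V h" "\<forall>\<^sub>F \<xi> in nhds 0. h \<xi> = G (x \<xi>)" "x 0 = (u0, v0)"
    "((\<lambda>\<xi>. fst (x \<xi>)) has_field_derivative u1) (at 0)" "((\<lambda>\<xi>. snd (x \<xi>)) has_field_derivative v1) (at 0)"
proof -
  have V: "holo_atlas V" and G: "param V (- L0) G" and g: "param V (tower_dom R m) g"
    and gG: "\<And>z. z \<in> tower_dom R m \<Longrightarrow> fst z \<noteq> 0 \<Longrightarrow> g z = G (tower_map R m z)"
    using T unfolding tower_coords_def by blast+
  have "(u0, v0) \<noteq> (0, 0)" using uv by (auto simp: L0_def)
  then obtain \<alpha> \<beta> where \<alpha>\<beta>: "poly \<alpha> 0 = u0" "poly \<beta> 0 = v0" "poly (pderiv \<alpha>) 0 = u1" "poly (pderiv \<beta>) 0 = v1"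
    and cop: "\<And>x. poly \<alpha> x = 0 \<Longrightarrow> poly \<beta> x \<noteq> 0" by (rule coprime_quadratics[where ?u1.0=u1 and ?v1.0=v1]) (rule that)
  define p where "p = \<alpha> ^ 3 - \<beta> ^ 2"
  define \<zeta> where "\<zeta> = (\<lambda>z. poly p z / poly \<alpha> z ^ 3)"
  have pz: "poly p z = poly \<alpha> z ^ 3 - poly \<beta> z ^ 2" for z by (simp add: p_def)
  have p0: "poly p 0 \<noteq> 0" using uv by (simp add: pz \<alpha>\<beta> L0_def)
  obtain \<mu> where \<mu>: "poly \<mu> 0 = 0" "poly (pderiv \<mu>) 0 = 0"
    and lift: "\<And>r. poly p r = 0 \<Longrightarrow> \<exists>w. w analytic_on {r} \<and> (\<forall>\<^sub>F z in nhds r. poly \<alpha> z \<noteq> 0 \<and> poly \<beta> z \<noteq> 0 \<and>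
       tcoord R m (poly p z / poly \<alpha> z ^ 3, w z) = exp (poly \<mu> z) * poly \<beta> z / poly \<alpha> z)"
    by (rule rescaling_exists[OF cop p0[unfolded p_def] R0, where m=m, folded p_def], assumption, rule that)
  have "\<forall>r\<in>{r. poly p r = 0}. \<exists>w. w analytic_on {r} \<and> (\<forall>\<^sub>F z in nhds r. poly \<alpha> z \<noteq> 0 \<and> poly \<beta> z \<noteq> 0 \<and>
       tcoord R m (\<zeta> z, w z) = exp (poly \<mu> z) * poly \<beta> z / poly \<alpha> z)"
    using lift unfolding \<zeta>_def by simp
  from this[unfolded bchoice_iff] obtain w where "\<forall>r\<in>{r. poly p r = 0}. w r analytic_on {r} \<and>
      (\<forall>\<^sub>F z in nhds r. poly \<alpha> z \<noteq> 0 \<and> poly \<beta> z \<noteq> 0 \<and>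
       tcoord R m (\<zeta> z, w r z) = exp (poly \<mu> z) * poly \<beta> z / poly \<alpha> z)" by blast
  then have w: "\<And>r. poly p r = 0 \<Longrightarrow> w r analytic_on {r}"
    "\<And>r. poly p r = 0 \<Longrightarrow> \<forall>\<^sub>F z in nhds r. poly \<alpha> z \<noteq> 0 \<and> poly \<beta> z \<noteq> 0 \<and>
       tcoord R m (\<zeta> z, w r z) = exp (poly \<mu> z) * poly \<beta> z / poly \<alpha> z"
    by simp_all
  define x1 where "x1 = (\<lambda>z. exp (poly \<mu> z) ^ 2 * poly \<alpha> z)"
  define x2 where "x2 = (\<lambda>z. exp (poly \<mu> z) ^ 3 * poly \<beta> z)"
  \<comment> \<open>The first argument of \<open>w\<close> selects the root, the second is the
    point; here both are \<open>z\<close>, and \<zeta> vanishes there.\<close>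
  define h where "h = (\<lambda>z. if poly p z = 0 then g (0, w z z) else G (x1 z, x2 z))"
  have xL0: "(x1 z, x2 z) \<in> - L0" if "poly p z \<noteq> 0" for z
  proof -
    \<comment> \<open>Weighted homogeneity of u^3 - v^2: rescaling never creates or moves a contact
      with \<open>L0\<close> in the parameter.\<close>
    have "x1 z ^ 3 - x2 z ^ 2 = exp (poly \<mu> z) ^ 6 * poly p z"
      by (simp add: x1_def x2_def pz power_mult_distrib algebra_simps flip: power_mult)
    also have "\<dots> \<noteq> 0" using that by simp
    finally show ?thesis by (simp add: L0_def)
  qed
  have exp\<mu>: "(\<lambda>z. exp (poly \<mu> z)) analytic_on {s}" for s
    by (intro holomorphic_on_imp_analytic_at[of _ UNIV]) (auto intro!: holomorphic_intros poly_holomorphic_on)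
  have xan: "x1 analytic_on {s}" "x2 analytic_on {s}" for s
    unfolding x1_def x2_def by (intro analytic_on_mult analytic_on_power exp\<mu> analytic_poly)+
  have hev: "\<forall>\<^sub>F z in nhds s. h z = G (x1 z, x2 z)" if "poly p s \<noteq> 0" for s
    using eventually_poly_nonzero[OF that] by eventually_elim (simp add: h_def)
  have "curve_at V h s" for s
  proof (cases "poly p s = 0")
    case False
    show ?thesis
      by (rule curve_atI[where k=G and ?x1.0=x1 and ?x2.0=x2, OF paramD(3)[OF G xL0[OF False]] xan hev[OF False]])
  next
    case True
    note ws = w[OF True]
    have val: "(\<zeta> z, w s z) \<in> tower_dom R m \<and> (poly p z \<noteq> 0 \<longrightarrow> g (\<zeta> z, w s z) = G (x1 z, x2 z))"
      if a: "poly \<alpha> z \<noteq> 0" "poly \<beta> z \<noteq> 0" and t: "tcoord R m (\<zeta> z, w s z) = exp (poly \<mu> z) * poly \<beta> z / poly \<alpha> z" for z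
    proof -
      have \<zeta>1: "1 - \<zeta> z = poly \<beta> z ^ 2 / poly \<alpha> z ^ 3" using a by (simp add: \<zeta>_def pz field_simps)
      then have "1 - \<zeta> z \<noteq> 0" using a by simp
      then have O: "(\<zeta> z, w s z) \<in> tower_dom R m" using a t by (auto simp: tower_dom_def)
      moreover have "g (\<zeta> z, w s z) = G (x1 z, x2 z)" if "poly p z \<noteq> 0"
      proof -
        have "fst (\<zeta> z, w s z) \<noteq> 0" using that a by (simp add: \<zeta>_def)
        from gG[OF O this] have "g (\<zeta> z, w s z) = G (tower_map R m (\<zeta> z, w s z))" .
        \<comment> \<open>For t = \<lambda> \<beta> / \<alpha> and 1 - \<zeta> = \<beta>^2 /
          \<alpha>^3, the quotients t^2 / (1 - \<zeta>) and t^3 / (1 - \<zeta>) reduce to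
          \<lambda>^2 \<alpha> and \<lambda>^3 \<beta>.\<close>
        also have "tower_map R m (\<zeta> z, w s z) = (x1 z, x2 z)"
          unfolding tower_map_def t fst_conv \<zeta>1 using a
          by (simp add: x1_def x2_def power_divide power_mult_distrib power2_eq_square power3_eq_cube)
        finally show ?thesis .
      qed
      ultimately show ?thesis by blast
    qed
    have e: "\<forall>\<^sub>F z in nhds s. (\<zeta> z, w s z) \<in> tower_dom R m \<and> (poly p z \<noteq> 0 \<longrightarrow> g (\<zeta> z, w s z) = G (x1 z, x2 z)) \<and> poly \<alpha> z \<noteq> 0"
      using ws(2) by eventually_elim (use val in blast)
    have as: "poly \<alpha> s \<noteq> 0" and inO: "(\<zeta> s, w s s) \<in> tower_dom R m" using eventually_nhds_x_imp_x[OF e] by blast+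
    have "p \<noteq> 0" using p0 by auto
    \<comment> \<open>At another root \<open>h\<close> would use a different function of the family
      \<open>w\<close>, so other roots are kept away from \<open>s\<close>.\<close>
    have iso: "\<forall>\<^sub>F z in nhds s. poly p z = 0 \<longrightarrow> z = s"
    proof -
      have "open (- ({z. poly p z = 0} - {s}))"
        using poly_roots_finite[OF \<open>p \<noteq> 0\<close>] by (intro open_Compl finite_imp_closed) auto
      then have "\<forall>\<^sub>F z in nhds s. z \<in> - ({z. poly p z = 0} - {s})"
        by (rule eventually_nhds_in_open) simp
      then show ?thesis by eventually_elim auto
    qed
    show ?thesis
    proof (rule curve_atI[where k=g and ?x1.0=\<zeta> and ?x2.0="w s"])
      show "pimm V g (\<zeta> s, w s s)" by (rule paramD(3)[OF g inO])
      show "\<zeta> analytic_on {s}"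
        unfolding \<zeta>_def using as by (intro analytic_on_divide analytic_on_power analytic_poly) auto
      show "w s analytic_on {s}" by (rule ws(1))
      show "\<forall>\<^sub>F z in nhds s. h z = g (\<zeta> z, w s z)"
        using e iso
      proof eventually_elim
        case (elim z)
        show ?case
        proof (cases "poly p z = 0")
          case True
          then have "z = s" "\<zeta> z = 0" using elim by (auto simp: \<zeta>_def)
          then show ?thesis using True by (simp add: h_def)
        next
          case False
          then show ?thesis using elim by (simp add: h_def)
        qed
      qed
    qed
  qed
  from entire_curveI[OF V this] have ent: "entire_curve V h" .
  \<comment> \<open>\<mu> vanishes to second order at 0, so \<lambda> has value 1 and derivative 0
    there and the rescaled curve keeps the 1-jet of (\<alpha>, \<beta>).\<close>
  have dexp: "((\<lambda>z. exp (poly \<mu> z)) has_field_derivative 0) (at 0)"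
    using DERIV_chain2[OF DERIV_exp poly_DERIV[of \<mu> 0]] \<mu> by simp
  have dx1: "(x1 has_field_derivative u1) (at 0)"
    unfolding x1_def by (rule derivative_eq_intros dexp poly_DERIV refl | simp add: \<mu> \<alpha>\<beta>)+
  have dx2: "(x2 has_field_derivative v1) (at 0)"
    unfolding x2_def by (rule derivative_eq_intros dexp poly_DERIV refl | simp add: \<mu> \<alpha>\<beta>)+
  have x0: "x1 0 = u0" "x2 0 = v0" by (simp_all add: x1_def x2_def \<mu> \<alpha>\<beta>)
  show thesis
    by (rule that[of h "\<lambda>z. (x1 z, x2 z)", OF ent hev[OF p0]])
      (simp_all add: dx1 dx2 x0)
qed

section \<open>Prescribing an arbitrary tangent vector\<close>

theorem theorem4p1:
  fixes m :: nat and V Vstar :: "'a atlas" and E :: "'a set" and \<nu> :: "'a tvec"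
  assumes "m \<ge> 1"
    and "V_surface m V E"
    and "Vstar = restr V (pts V - E)"
    and "\<nu> \<in> tangent_bundle Vstar"
  shows "\<exists>h :: complex \<Rightarrow> 'a. entire_curve V h \<and> velocity Vstar h 0 = \<nu>"
proof -
  obtain G R g where T: "tower_coords m V E G R g" and R0: "poly R 0 \<noteq> 0"
    using V_surface_coords[OF assms(2)] by blast
  have V: "holo_atlas V" and Ecl: "closedin (surf_top V) E" and G: "param V (- L0) G" "G ` (- L0) = pts V - E"
    using T unfolding tower_coords_def by blast+
  have W: "openin (surf_top V) (pts V - E)" using Ecl by (simp add: closedin_def topspace_surf_top[OF V])
  have Vs: "holo_atlas Vstar" unfolding assms(3) by (rule holo_atlas_restr[OF V W])
  have Gs: "param Vstar (- L0) G" unfolding assms(3) param_restr[OF V W] using G by blast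
  obtain q v where \<nu>: "\<nu> = (q, v)" by (cases \<nu>)
  have q: "q \<in> pts Vstar"
    and tr: "\<And>U \<phi> W \<psi>. (U, \<phi>) \<in> Vstar \<Longrightarrow> (W, \<psi>) \<in> Vstar \<Longrightarrow> q \<in> U \<Longrightarrow> q \<in> W \<Longrightarrow>
        v (W, \<psi>) = frechet_derivative (\<psi> \<circ> inv_into U \<phi>) (at (\<phi> q)) (v (U, \<phi>))"
    and zero: "\<And>U \<phi>. \<not> ((U, \<phi>) \<in> Vstar \<and> q \<in> U) \<Longrightarrow> v (U, \<phi>) = 0"
    using assms(4) unfolding \<nu> tangent_bundle_def by blast+
  have "q \<in> G ` (- L0)" using q G(2) by (simp add: assms(3))
  then obtain u0 v0 where uv: "(u0, v0) \<notin> L0" "q = G (u0, v0)" by auto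
  have pG: "pimm Vstar G (u0, v0)" by (rule paramD(3)[OF Gs]) (simp add: uv)
  obtain U \<phi> where c: "(U, \<phi>) \<in> Vstar" "q \<in> U" using q by (rule in_ptsE)
  have cG: "G (u0, v0) \<in> U" using c uv by simp
  obtain A B C D where det: "A * D \<noteq> B * C" and M: "(\<phi> \<circ> G has_derivative mat2 A B C D) (at (u0, v0))"
    using pimmD(3)[OF pG c(1) cG] unfolding immers_def by blast
  define d where "d = A * D - B * C"
  have d: "d \<noteq> 0" using det by (simp add: d_def)
  obtain a b where ab: "v (U, \<phi>) = (a, b)" by (cases "v (U, \<phi>)")
  \<comment> \<open>The tangent vector pulled back to the plane along \<open>G\<close>, by Cramer's
    rule in one chart around \<open>q\<close>.\<close>
  define u1 v1 where "u1 = (D * a - B * b) / d" and "v1 = (A * b - C * a) / d"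
  have Muv: "mat2 A B C D (u1, v1) = v (U, \<phi>)"
  proof -
    have dx: "d * u1 = D * a - B * b" "d * v1 = A * b - C * a"
      using d by (simp_all add: u1_def v1_def)
    have "d * (A * u1 + B * v1) = A * (d * u1) + B * (d * v1)" by (simp add: algebra_simps)
    also have "\<dots> = d * a" unfolding dx by (simp add: d_def algebra_simps)
    finally have 1: "A * u1 + B * v1 = a" using d by simp
    have "d * (C * u1 + D * v1) = C * (d * u1) + D * (d * v1)" by (simp add: algebra_simps)
    also have "\<dots> = d * b" unfolding dx by (simp add: d_def algebra_simps)
    finally have 2: "C * u1 + D * v1 = b" using d by simp
    show ?thesis using 1 2 by (simp add: mat2_def ab)
  qed
  obtain h x where ent: "entire_curve V h" and hG: "\<forall>\<^sub>F \<xi> in nhds 0. h \<xi> = G (x \<xi>)" and x0: "x 0 = (u0, v0)"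
    and dx: "((\<lambda>\<xi>. fst (x \<xi>)) has_field_derivative u1) (at 0)" "((\<lambda>\<xi>. snd (x \<xi>)) has_field_derivative v1) (at 0)"
    by (rule tower_curve[OF T R0 uv(1)])
  have h0: "h 0 = q" using eventually_nhds_x_imp_x[OF hG] x0 uv by simp
  \<comment> \<open>One chart determines the vector: in any other chart around \<open>q\<close> the
    transformation rule of the bundle and the chain rule for \<open>h\<close> apply the same matrix,
    and elsewhere both sides are 0.\<close>
  have vel: "snd (velocity Vstar h 0) (W, \<psi>) = v (W, \<psi>)" for W \<psi>
  proof (cases "(W, \<psi>) \<in> Vstar \<and> q \<in> W")
    case False
    then show ?thesis using zero[of W \<psi>] h0 by (auto simp: velocity_def)
  next
    case True
    then have e: "(W, \<psi>) \<in> Vstar" "q \<in> W" by auto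
    have "cdiff2 (\<psi> \<circ> inv_into U \<phi>) (\<phi> q)"
      by (rule holo_atlasD(4)[OF Vs c(1) e(1)]) (use c e in blast)
    then obtain A' B' C' D' where M': "(\<psi> \<circ> inv_into U \<phi> has_derivative mat2 A' B' C' D') (at (\<phi> q))"
      unfolding cdiff2_def by blast
    have "v (W, \<psi>) = mat2 A' B' C' D' (v (U, \<phi>))"
      using tr[OF c(1) e(1) c(2) e(2)] frechet_derivative_at[OF M'] by simp
    also have "\<dots> = (mat2 A' B' C' D' \<circ> mat2 A B C D) (u1, v1)" by (simp add: Muv)
    finally have vW: "v (W, \<psi>) = (mat2 A' B' C' D' \<circ> mat2 A B C D) (u1, v1)" .
    have "(\<psi> \<circ> inv_into U \<phi> has_derivative mat2 A' B' C' D') (at ((\<phi> \<circ> G) (u0, v0)))" using M' uv by simp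
    from diff_chain_at[OF M this]
    have "(\<psi> \<circ> inv_into U \<phi> \<circ> (\<phi> \<circ> G) has_derivative mat2 A' B' C' D' \<circ> mat2 A B C D) (at (u0, v0))" .
    moreover have "\<forall>\<^sub>F y in nhds (u0, v0). (\<psi> \<circ> inv_into U \<phi> \<circ> (\<phi> \<circ> G)) y = (\<psi> \<circ> G) y"
      using pimmD(2)[OF pG c(1) cG] by eventually_elim (use holo_atlasD(1)[OF Vs c(1)] in simp)
    ultimately have "(\<psi> \<circ> G has_derivative mat2 A' B' C' D' \<circ> mat2 A B C D) (at (x 0))"
      unfolding x0 by (rule iffD1[OF has_derivative_cong_ev, rotated])
    from curve_chart_deriv[OF this[unfolded mat2_comp] dx hG]
    have "deriv (\<lambda>\<xi>. fst (\<psi> (h \<xi>))) 0 = fst (v (W, \<psi>))" "deriv (\<lambda>\<xi>. snd (\<psi> (h \<xi>))) 0 = snd (v (W, \<psi>))"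
      unfolding vW mat2_comp by (simp_all add: DERIV_imp_deriv)
    then show ?thesis using e h0 by (simp add: velocity_def)
  qed
  have "fst (velocity Vstar h 0) = q" using h0 by (simp add: velocity_def)
  moreover have "snd (velocity Vstar h 0) = v"
  proof
    fix c :: "'a chart"
    show "snd (velocity Vstar h 0) c = v c" using vel[of "fst c" "snd c"] by simp
  qed
  ultimately have "velocity Vstar h 0 = \<nu>" unfolding \<nu> by (simp add: prod_eq_iff)
  then show ?thesis using ent by blast
qed

end
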